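(* Suppose $1\le q<\infty$, $0<s<\infty$, and $f\in L^q_{\mathrm{loc}}(\mathbb{C}^n)$. Then $f\in\mathrm{IDA}^{s,q}$ if and only if $f$ admits a decomposition $f=f_1+f_2$ such that $$f_1\in C^2(\mathbb{C}^n),\qquad M_{q,r}(\overline\partial f_1)+M_{q,r}(f_2)\in L^s\qquad(\ast)$$ for some (or, equivalently, any) $r>0$. Furthermore, for fixed $\tau,r>0$, $$\|f\|_{\mathrm{IDA}^{s,q}}\simeq\|G_{q,\tau}(f)\|_{L^s}\simeq\inf\left\{\|M_{q,r}(\overline\partial f_1)\|_{L^s}+\|M_{q,r}(f_2)\|_{L^s}\right\},$$ where the infimum is taken over all decompositions $f=f_1+f_2$ that satisfy $(\ast)$ with the fixed $r$, and the constants implicit in $\simeq$ do not depend on $f$.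
   Context: $v$ is Lebesgue measure on $\mathbb{C}^n$; $B(z,r)=\{w\in\mathbb{C}^n:|w-z|<r\}$; $H(\Omega)$ is the set of holomorphic functions on $\Omega$; $L^s=L^s(\mathbb{C}^n,dv)$. $A\simeq B$ means $C^{-1}A\le B\le CA$ for some constant $C>0$. For $0<q<\infty$, $r>0$, $f\in L^q_{\mathrm{loc}}$: $$G_{q,r}(f)(z)=\inf_{h\in H(B(z,r))}\left(\frac1{|B(z,r)|}\int_{B(z,r)}|f-h|^qdv\right)^{1/q},\quad M_{q,r}(f)(z)=\left(\frac1{|B(z,r)|}\int_{B(z,r)}|f|^qdv\right)^{1/q}.$$ For a $(0,1)$-form $\omega=\sum_j\omega_jd\bar z_j$, $|\omega|=\sum_j|\omega_j|$ and $M_{q,r}(\omega)=M_{q,r}(|\omega|)$. For $0<s\le\infty$, $\mathrm{IDA}^{s,q}$ is the set of $f\in L^q_{\mathrm{loc}}$ with $\|f\|_{\mathrm{IDA}^{s,q}}=\|G_{q,1}(f)\|_{L^s}<\infty$. *)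

theory Defs
  imports "HOL-Analysis.Analysis"
begin

text \<open>
  The space \<open>\<complex>\<^sup>n\<close> is \<^typ>\<open>complex ^ 'n\<close> with \<open>n = CARD('n) \<ge> 1\<close>; its library norm is the
  Euclidean one, so \<^term>\<open>ball z r\<close> is \<open>B(z,r)\<close>, and \<^const>\<open>lebesgue\<close> is the measure \<open>v\<close>.
\<close>

text \<open>Only used for \<open>p > 0\<close>, whence \<open>\<infinity>\<close> is sent to \<open>\<infinity>\<close>.\<close>

definition epowr :: "ennreal \<Rightarrow> real \<Rightarrow> ennreal" where
  "epowr x p = (if x = \<infinity> then \<infinity> else ennreal (enn2real x powr p))"

text \<open>
  Several-variable holomorphy (on open sets): the real Frechet derivative exists and is
  complex linear.
\<close>

definition holomorphic_Cn :: "(complex ^ 'n \<Rightarrow> complex) \<Rightarrow> (complex ^ 'n) set \<Rightarrow> bool" where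
  "holomorphic_Cn h S \<longleftrightarrow>
     (\<forall>z\<in>S. \<exists>D. (h has_derivative D) (at z) \<and> (\<forall>c v. D (c *s v) = c * D v))"

text \<open>Real differentiability class \<open>C\<^sup>k\<close> on the whole space.\<close>

primrec Ck :: "nat \<Rightarrow> ('a::euclidean_space \<Rightarrow> 'b::real_normed_vector) \<Rightarrow> bool" where
  "Ck 0 f \<longleftrightarrow> continuous_on UNIV f"
| "Ck (Suc k) f \<longleftrightarrow> (\<forall>x. f differentiable (at x)) \<and>
     (\<forall>v. Ck k (\<lambda>x. frechet_derivative f (at x) v))"

text \<open>
  The form \<open>\<Sum>\<^sub>j \<omega>\<^sub>j d(cnj z\<^sub>j)\<close> is represented by its vector of coefficients. Its modulus is the sum of
  the moduli of the coefficients, which is not the norm of \<^typ>\<open>complex ^ 'n\<close>.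
\<close>

definition form_abs :: "complex ^ 'n \<Rightarrow> real" where
  "form_abs \<omega> = (\<Sum>j\<in>UNIV. cmod (\<omega> $ j))"

text \<open>Coefficients \<open>\<partial>f/\<partial>(cnj z\<^sub>j) = (\<partial>f/\<partial>x\<^sub>j + \<i> \<partial>f/\<partial>y\<^sub>j) / 2\<close>, where \<open>z\<^sub>j = x\<^sub>j + \<i> y\<^sub>j\<close>.\<close>

definition dbar :: "(complex ^ 'n \<Rightarrow> complex) \<Rightarrow> complex ^ 'n \<Rightarrow> complex ^ 'n" where
  "dbar f z = (\<chi> j. (frechet_derivative f (at z) (axis j 1)
                     + \<i> * frechet_derivative f (at z) (axis j \<i>)) / 2)"

definition L_loc :: "real \<Rightarrow> (complex ^ 'n \<Rightarrow> complex) set" where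
  "L_loc q = {f. f \<in> borel_measurable lebesgue \<and>
     (\<forall>K. compact K \<longrightarrow> (\<integral>\<^sup>+w\<in>K. ennreal (norm (f w) powr q) \<partial>lebesgue) < \<infinity>)}"

definition M_avg :: "real \<Rightarrow> real \<Rightarrow> (complex ^ 'n \<Rightarrow> 'b::real_normed_vector) \<Rightarrow> complex ^ 'n \<Rightarrow> ennreal"
  where
  "M_avg q r f z =
     epowr ((\<integral>\<^sup>+w\<in>ball z r. ennreal (norm (f w) powr q) \<partial>lebesgue) / emeasure lebesgue (ball z r)) (1 / q)"

definition M_form :: "real \<Rightarrow> real \<Rightarrow> (complex ^ 'n \<Rightarrow> complex ^ 'n) \<Rightarrow> complex ^ 'n \<Rightarrow> ennreal" where
  "M_form q r \<omega> = M_avg q r (\<lambda>w. form_abs (\<omega> w))"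

text \<open>Competitors \<open>h\<close> with \<open>f - h\<close> not in \<open>L\<^sup>q(B(z,r))\<close> contribute \<open>\<infinity>\<close> to the infimum.\<close>

definition G_dist :: "real \<Rightarrow> real \<Rightarrow> (complex ^ 'n \<Rightarrow> complex) \<Rightarrow> complex ^ 'n \<Rightarrow> ennreal" where
  "G_dist q r f z = (INF h\<in>{h. holomorphic_Cn h (ball z r)}. M_avg q r (\<lambda>w. f w - h w) z)"

text \<open>For \<open>0 < s < \<infinity>\<close>; only a quasi-norm if \<open>s < 1\<close>.\<close>

definition Ls_norm :: "real \<Rightarrow> (complex ^ 'n \<Rightarrow> ennreal) \<Rightarrow> ennreal" where
  "Ls_norm s F = epowr (\<integral>\<^sup>+z. epowr (F z) s \<partial>lebesgue) (1 / s)"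

definition in_Ls :: "real \<Rightarrow> (complex ^ 'n \<Rightarrow> ennreal) \<Rightarrow> bool" where
  "in_Ls s F \<longleftrightarrow> F \<in> borel_measurable lebesgue \<and> Ls_norm s F < \<infinity>"

definition IDA_norm :: "real \<Rightarrow> real \<Rightarrow> (complex ^ 'n \<Rightarrow> complex) \<Rightarrow> ennreal" where
  "IDA_norm s q f = Ls_norm s (G_dist q 1 f)"

definition IDA :: "real \<Rightarrow> real \<Rightarrow> (complex ^ 'n \<Rightarrow> complex) set" where
  "IDA s q = {f \<in> L_loc q. IDA_norm s q f < \<infinity>}"

text \<open>Equality in \<open>L_loc q\<close> is equality almost everywhere.\<close>

definition decomposes ::
  "(complex ^ 'n \<Rightarrow> complex) \<Rightarrow> (complex ^ 'n \<Rightarrow> complex) \<Rightarrow> (complex ^ 'n \<Rightarrow> complex) \<Rightarrow> bool" where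
  "decomposes f f1 f2 \<longleftrightarrow> (AE z in lebesgue. f z = f1 z + f2 z)"

definition star_cond ::
  "real \<Rightarrow> real \<Rightarrow> real \<Rightarrow> (complex ^ 'n \<Rightarrow> complex) \<Rightarrow> (complex ^ 'n \<Rightarrow> complex) \<Rightarrow> bool" where
  "star_cond s q r f1 f2 \<longleftrightarrow> Ck 2 f1 \<and> in_Ls s (\<lambda>z. M_form q r (dbar f1) z + M_avg q r f2 z)"

text \<open>The infimum is \<open>\<infinity>\<close> if there is no admissible decomposition.\<close>

definition decomp_inf :: "real \<Rightarrow> real \<Rightarrow> real \<Rightarrow> (complex ^ 'n \<Rightarrow> complex) \<Rightarrow> ennreal" where
  "decomp_inf s q r f =
     (INF (f1, f2)\<in>{(f1, f2). decomposes f f1 f2 \<and> star_cond s q r f1 f2}.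
        Ls_norm s (M_form q r (dbar f1)) + Ls_norm s (M_avg q r f2))"

text \<open>\<open>A f \<simeq> B f\<close> with one constant for all \<open>f \<in> X\<close>.\<close>

definition comparable_on :: "'a set \<Rightarrow> ('a \<Rightarrow> ennreal) \<Rightarrow> ('a \<Rightarrow> ennreal) \<Rightarrow> bool" where
  "comparable_on X A B \<longleftrightarrow>
     (\<exists>C::real. C > 0 \<and> (\<forall>f\<in>X. ennreal (inverse C) * A f \<le> B f \<and> B f \<le> ennreal C * A f))"

end

theory Submission
  imports Defs "HOL-Complex_Analysis.Cauchy_Integral_Formula"
begin

text \<open>
  The theorem follows from two one-sided estimates in which all radii are independent of each other.

  \<^bold>\<open>From a decomposition to the oscillation\<close> (\<open>Ls_norm_G_dist_le_decomp_inf\<close>).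
  Since \<open>f - h = (f1 - h) + f2\<close>, one needs on each ball a holomorphic \<open>h\<close> whose \<open>L\<^sup>q\<close> distance to
  \<open>f1\<close> is controlled by the Cauchy--Riemann derivatives of \<open>f1\<close> on a larger ball (\<open>dbar_ball_estimate\<close>). The ball is
  enclosed in a polydisc, where \<open>h\<close> is constructed one coordinate at a time. In one variable, the
  Cauchy--Pompeiu formula for \<open>f1\<close> multiplied by a cut-off function reads \<open>f1 = H f1 + T f1'\<close>, where \<open>f1'\<close> is the
  \<open>cnj z\<close>-derivative of \<open>f1\<close>. The operator \<open>T\<close> is a convolution with the locally integrable kernel \<open>1 / w\<close>, hence bounded on \<open>L\<^sup>q\<close> by
  Young's inequality. The operator \<open>H\<close> is a Cauchy integral averaged over an annulus; it produces
  functions holomorphic inside the annulus, and because of the averaging it is bounded on \<open>L\<^sup>q\<close> as well.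
  If \<open>h\<close> approximates \<open>f1\<close> and is holomorphic in the coordinates from \<open>J\<close>, then \<open>H h\<close>, taken in the
  coordinate \<open>i\<close>, is holomorphic in those from \<open>insert i J\<close>, and
  \<open>f1 - H h = (f1 - H f1) + H (f1 - h)\<close> shows that it is still a good approximation.

  \<^bold>\<open>From the oscillation to a decomposition\<close> (\<open>decomposition_from_oscillation\<close>).
  Space is cut into the cells of a cubic lattice that is fine compared with \<open>\<tau>\<close>. In each cell one
  chooses a centre and a holomorphic competitor \<open>h\<^sub>g\<close> that nearly attain the infimum of \<open>G_dist q \<tau> f\<close>
  over the cell. These infima form a measurable step function below \<open>G_dist q \<tau> f\<close>, with which all
  further estimates are made. With a partition of unity \<open>\<phi>\<^sub>g\<close> subordinate to
  slightly larger cubes let \<open>f1\<close> be the sum of the \<open>\<phi>\<^sub>g h\<^sub>g\<close>. The derivatives of the \<open>\<phi>\<^sub>g\<close> sum up to zero,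
  so the Cauchy--Riemann derivatives of \<open>f1\<close> at \<open>z\<close> are combinations of the numbers \<open>h\<^sub>g z - f z\<close>, and so is
  \<open>f1 z - f z\<close>. Hence both parts of the decomposition are dominated pointwise by boundedly many local
  errors \<open>\<bar>f - h\<^sub>g\<bar>\<close>, which gives the \<open>L\<^sup>s\<close> bound for every \<open>s > 0\<close> and every radius \<open>r\<close>.

  A change of radius in \<open>M_avg\<close> costs a finite sum of translates (\<open>M_avg_radius\<close>), which is harmless
  in \<open>L\<^sup>s\<close>. Going from \<open>G_dist q \<tau> f\<close> to a decomposition and back changes \<open>\<tau>\<close> arbitrarily.
\<close>

section \<open>Powers of extended nonnegative reals\<close>

lemma epowr_ennreal: "0 \<le> x \<Longrightarrow> epowr (ennreal x) p = ennreal (x powr p)"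
  by (simp add: epowr_def)

lemma epowr_0 [simp]: "epowr 0 p = 0"
  by (simp add: epowr_def)

lemma epowr_top [simp]: "epowr top p = top"
  by (simp add: epowr_def)

lemma epowr_less_top_iff [simp]: "epowr x p < top \<longleftrightarrow> x < top"
  by (cases x) (auto simp: epowr_def)

lemma epowr_mono: "x \<le> y \<Longrightarrow> 0 < p \<Longrightarrow> epowr x p \<le> epowr y p"
  by (cases x; cases y) (auto simp: epowr_ennreal top_unique intro!: ennreal_leI powr_mono2)

lemma epowr_mult: "0 < p \<Longrightarrow> epowr (x * y) p = epowr x p * epowr y p"
proof (cases x; cases y)
  fix a b assume "0 < p" "x = ennreal a" "0 \<le> a" "y = ennreal b" "0 \<le> b"
  then show ?thesis
    by (simp add: epowr_ennreal ennreal_mult[symmetric] powr_mult)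
next
  fix a assume "0 < p" "x = ennreal a" "0 \<le> a" "y = top"
  then show ?thesis
    by (cases "a = 0") (auto simp: epowr_ennreal ennreal_mult_top)
next
  fix a assume "0 < p" "y = ennreal a" "0 \<le> a" "x = top"
  then show ?thesis
    by (cases "a = 0") (auto simp: epowr_ennreal ennreal_top_mult)
qed auto

lemma epowr_measurable [measurable]: "(\<lambda>x. epowr x p) \<in> borel_measurable borel"
  unfolding epowr_def by measurable

text \<open>
  The sum is at most \<open>card A\<close> times its largest term. This serves exponents on both sides of \<open>1\<close>,
  so that no case distinction between \<open>s < 1\<close> and \<open>s \<ge> 1\<close> is ever needed.
\<close>

lemma epowr_sum_le:
  assumes "finite A" "0 < p"
  shows "epowr (\<Sum>a\<in>A. x a) p \<le> ennreal (real (card A) powr p) * (\<Sum>a\<in>A. epowr (x a) p)"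
proof (cases "A = {}")
  case False
  define m where "m = Max (x ` A)"
  have "m \<in> x ` A"
    unfolding m_def using assms False by (intro Max_in) auto
  then obtain a where a: "a \<in> A" "x a = m" by blast
  have "(\<Sum>a\<in>A. x a) \<le> of_nat (card A) * m"
    by (rule sum_bounded_above) (simp add: m_def assms)
  then have "epowr (\<Sum>a\<in>A. x a) p \<le> epowr (of_nat (card A) * m) p"
    using assms by (intro epowr_mono)
  also have "\<dots> = ennreal (real (card A) powr p) * epowr m p"
    by (simp add: epowr_mult assms ennreal_of_nat_eq_real_of_nat epowr_ennreal)
  also have "epowr m p \<le> (\<Sum>a\<in>A. epowr (x a) p)"
    unfolding a(2)[symmetric] using a assms by (intro member_le_sum) auto
  finally show ?thesis by (auto simp: mult_left_mono)
qed simp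

lemma epowr_add_le:
  assumes "0 < p"
  shows "epowr (x + y) p \<le> ennreal (2 powr p) * (epowr x p + epowr y p)"
  using epowr_sum_le[of "UNIV :: bool set" p "\<lambda>b. if b then x else y"] assms
  by (simp add: UNIV_bool add.commute)

section \<open>Translates in \<open>L\<^sup>s\<close> and averages over balls\<close>

text \<open>
  Completeness of Lebesgue measure.
\<close>

lemma measurable_lebesgue_cong_AE:
  assumes f: "f \<in> borel_measurable lebesgue" and eq: "AE x in lborel. f x = g x"
  shows "g \<in> borel_measurable lebesgue"
proof (rule measurableI)
  fix A :: "'b set" assume A: "A \<in> sets borel"
  have eq': "AE x in lebesgue. f x = g x"
    using eq by (rule AE_completion)
  show "g -` A \<inter> space lebesgue \<in> sets lebesgue"
  proof (rule completion.complete_measure_axioms[THEN complete_measure.in_sets_AE])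
    show "AE x in lebesgue. x \<in> f -` A \<inter> space lebesgue \<longleftrightarrow> x \<in> g -` A \<inter> space lebesgue"
      using eq' by eventually_elim auto
    show "f -` A \<inter> space lebesgue \<in> sets lebesgue"
      using f A by (rule measurable_sets)
  qed auto
qed auto

lemma AE_lborel_translate:
  fixes a :: "'a::euclidean_space" and P :: "'a \<Rightarrow> bool"
  assumes "AE x in lborel. P x"
  shows "AE x in lborel. P (x + a)"
proof -
  have "AE x in distr lborel borel ((+) a). P x"
    unfolding lborel_distr_plus by (rule assms)
  then have "AE x in lborel. P (a + x)"
    by (rule AE_distrD[rotated]) auto
  then show ?thesis by (simp add: add.commute)
qed

lemma nn_integral_lborel_translate:
  fixes a :: "'a::euclidean_space"
  assumes [measurable]: "F \<in> borel_measurable borel"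
  shows "(\<integral>\<^sup>+x. F (x + a) \<partial>lborel) = (\<integral>\<^sup>+x. F x \<partial>lborel)"
proof -
  have "(\<integral>\<^sup>+x. F x \<partial>lborel) = (\<integral>\<^sup>+x. F x \<partial>distr lborel borel ((+) a))"
    by (simp add: lborel_distr_plus)
  also have "\<dots> = (\<integral>\<^sup>+x. F (a + x) \<partial>lborel)"
    by (subst nn_integral_distr) auto
  finally show ?thesis by (simp add: add.commute)
qed

lemma measurable_lebesgue_translate:
  fixes a :: "'a::euclidean_space" and F :: "'a \<Rightarrow> ennreal"
  assumes "F \<in> borel_measurable lebesgue"
  shows "(\<lambda>x. F (x + a)) \<in> borel_measurable lebesgue"
    and "(\<integral>\<^sup>+x. F (x + a) \<partial>lebesgue) = (\<integral>\<^sup>+x. F x \<partial>lebesgue)"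
proof -
  obtain G where G: "G \<in> borel_measurable lborel" "AE x in lborel. F x = G x"
    using completion_ex_borel_measurable[OF assms] by auto
  have [measurable]: "G \<in> borel_measurable borel" using G(1) by simp
  have eq: "AE x in lborel. F (x + a) = G (x + a)"
    using AE_lborel_translate[OF G(2)] .
  have "(\<lambda>x. G (x + a)) \<in> borel_measurable lborel" by measurable
  moreover have "AE x in lborel. G (x + a) = F (x + a)"
    using eq by eventually_elim simp
  ultimately show "(\<lambda>x. F (x + a)) \<in> borel_measurable lebesgue"
    by (intro measurable_lebesgue_cong_AE[OF measurable_completion])
  show "(\<integral>\<^sup>+x. F (x + a) \<partial>lebesgue) = (\<integral>\<^sup>+x. F x \<partial>lebesgue)"
    unfolding nn_integral_completion
    using nn_integral_cong_AE[OF eq] nn_integral_cong_AE[OF G(2)]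
      nn_integral_lborel_translate[of G a] by simp
qed

text \<open>
  Integrating the sum of the indicator functions of the covering sets.
\<close>

lemma nn_integral_cover_le:
  assumes "finite I" and A: "A \<subseteq> (\<Union>a\<in>I. B a)"
    and F: "F \<in> borel_measurable M" and B: "\<And>a. a \<in> I \<Longrightarrow> B a \<in> sets M"
  shows "(\<integral>\<^sup>+w\<in>A. F w \<partial>M) \<le> (\<Sum>a\<in>I. \<integral>\<^sup>+w\<in>B a. F w \<partial>M)"
proof -
  have "(\<integral>\<^sup>+w\<in>A. F w \<partial>M) \<le> (\<integral>\<^sup>+w. (\<Sum>a\<in>I. F w * indicator (B a) w) \<partial>M)"
  proof (rule nn_integral_mono)
    fix w
    show "F w * indicator A w \<le> (\<Sum>a\<in>I. F w * indicator (B a) w)"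
    proof (cases "w \<in> A")
      case True
      then obtain a where a: "a \<in> I" "w \<in> B a" using A by (meson UN_E subsetD)
      have "F w * indicator (B a) w \<le> (\<Sum>a\<in>I. F w * indicator (B a) w)"
        using a assms(1) by (intro member_le_sum) auto
      then show ?thesis using a True by simp
    qed simp
  qed
  also have "\<dots> = (\<Sum>a\<in>I. \<integral>\<^sup>+w\<in>B a. F w \<partial>M)"
    using F B by (intro nn_integral_sum borel_measurable_times_ennreal borel_measurable_indicator)
  finally show ?thesis .
qed

lemma Ls_norm_mono: "(\<And>z. F z \<le> H z) \<Longrightarrow> 0 < s \<Longrightarrow> Ls_norm s F \<le> Ls_norm s H"
  unfolding Ls_norm_def by (intro epowr_mono nn_integral_mono) auto

text \<open>
  Every \<open>L\<^sup>s\<close> estimate below has this shape. On the left stands, for instance, the oscillation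
  \<open>G_dist q \<tau> f\<close>, an infimum over uncountably many functions; there monotonicity of the integral is used, on the right
  additivity.
\<close>

lemma Ls_norm_le_sum:
  fixes s :: real and H :: "'i \<Rightarrow> complex ^ 'n \<Rightarrow> ennreal"
  assumes "0 < s" "0 \<le> C" "finite I"
    and H: "\<And>i. i \<in> I \<Longrightarrow> H i \<in> borel_measurable lebesgue"
    and le: "\<And>z. F z \<le> ennreal C * (\<Sum>i\<in>I. H i z)"
  shows "Ls_norm s F \<le> ennreal (C * real (card I) * real (card I) powr (1/s)) * (\<Sum>i\<in>I. Ls_norm s (H i))"
proof -
  let ?n = "real (card I)"
  have "(\<integral>\<^sup>+z. epowr (F z) s \<partial>lebesgue)
      \<le> (\<integral>\<^sup>+z. ennreal (C powr s * ?n powr s) * (\<Sum>i\<in>I. epowr (H i z) s) \<partial>lebesgue)"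
  proof (rule nn_integral_mono)
    fix z
    have "epowr (F z) s \<le> epowr (ennreal C * (\<Sum>i\<in>I. H i z)) s"
      using le assms by (intro epowr_mono)
    also have "\<dots> = ennreal (C powr s) * epowr (\<Sum>i\<in>I. H i z) s"
      using assms by (simp add: epowr_mult epowr_ennreal)
    also have "\<dots> \<le> ennreal (C powr s) * (ennreal (?n powr s) * (\<Sum>i\<in>I. epowr (H i z) s))"
      using assms by (intro mult_left_mono epowr_sum_le) auto
    finally show "epowr (F z) s \<le> ennreal (C powr s * ?n powr s) * (\<Sum>i\<in>I. epowr (H i z) s)"
      by (simp add: ennreal_mult mult.assoc)
  qed
  also have "\<dots> = ennreal (C powr s * ?n powr s) * (\<Sum>i\<in>I. \<integral>\<^sup>+z. epowr (H i z) s \<partial>lebesgue)"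
  proof -
    have m: "(\<lambda>z. epowr (H i z) s) \<in> borel_measurable lebesgue" if "i \<in> I" for i
      using measurable_compose[OF H[OF that] epowr_measurable] .
    show ?thesis
      by (subst nn_integral_cmult) (auto simp: nn_integral_sum m intro!: borel_measurable_sum m)
  qed
  finally have "Ls_norm s F \<le> epowr (ennreal (C powr s * ?n powr s) * (\<Sum>i\<in>I. \<integral>\<^sup>+z. epowr (H i z) s \<partial>lebesgue)) (1/s)"
    unfolding Ls_norm_def using assms by (intro epowr_mono) auto
  also have "\<dots> = ennreal (C * ?n) * epowr (\<Sum>i\<in>I. \<integral>\<^sup>+z. epowr (H i z) s \<partial>lebesgue) (1/s)"
    using assms by (simp add: epowr_mult epowr_ennreal powr_mult powr_powr)
  also have "\<dots> \<le> ennreal (C * ?n) * (ennreal (?n powr (1/s)) * (\<Sum>i\<in>I. Ls_norm s (H i)))"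
    unfolding Ls_norm_def using assms by (intro mult_left_mono epowr_sum_le) auto
  finally show ?thesis
    using assms by (simp add: ennreal_mult mult.assoc)
qed

lemma Ls_norm_translate:
  assumes "F \<in> borel_measurable lebesgue"
  shows "Ls_norm s (\<lambda>z. F (z + a)) = Ls_norm s F"
  unfolding Ls_norm_def
  using measurable_lebesgue_translate(2)[OF measurable_compose[OF assms epowr_measurable]] by simp

lemma Ls_norm_le_translates:
  fixes H :: "complex ^ 'n \<Rightarrow> ennreal"
  assumes "0 < s" "0 \<le> C" "finite I" and H: "H \<in> borel_measurable lebesgue"
    and le: "\<And>z. F z \<le> ennreal C * (\<Sum>a\<in>I. H (z + a))"
  shows "Ls_norm s F \<le> ennreal (C * (real (card I))^2 * real (card I) powr (1/s)) * Ls_norm s H"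
proof -
  have "Ls_norm s F \<le> ennreal (C * real (card I) * real (card I) powr (1/s)) * (\<Sum>a\<in>I. Ls_norm s (\<lambda>z. H (z + a)))"
    using assms by (intro Ls_norm_le_sum measurable_lebesgue_translate(1)[OF H])
  also have "(\<Sum>a\<in>I. Ls_norm s (\<lambda>z. H (z + a))) = ennreal (real (card I)) * Ls_norm s H"
    by (simp add: Ls_norm_translate[OF H] ennreal_of_nat_eq_real_of_nat)
  also have eq: "ennreal (C * real (card I) * real (card I) powr (1/s)) * (ennreal (real (card I)) * Ls_norm s H)
      = ennreal (C * (real (card I))^2 * real (card I) powr (1/s)) * Ls_norm s H"
  proof -
    have "ennreal (C * (real (card I))^2 * real (card I) powr (1/s))
      = ennreal (C * real (card I) * real (card I) powr (1/s)) * ennreal (real (card I))"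
      using assms by (subst ennreal_mult[symmetric]) (auto simp: power2_eq_square)
    then show ?thesis by (simp only: mult.assoc)
  qed
  finally show ?thesis .
qed

lemma Ls_norm_add_le:
  fixes F H :: "complex ^ 'n \<Rightarrow> ennreal"
  assumes "0 < s" "F \<in> borel_measurable lebesgue" "H \<in> borel_measurable lebesgue"
  shows "Ls_norm s (\<lambda>z. F z + H z) \<le> ennreal (2 * 2 powr (1/s)) * (Ls_norm s F + Ls_norm s H)"
  using Ls_norm_le_sum[of s 1 "UNIV :: bool set" "\<lambda>b. if b then F else H" "\<lambda>z. F z + H z"] assms
  by (simp add: UNIV_bool add.commute)

definition I_ball :: "real \<Rightarrow> (complex ^ 'n \<Rightarrow> 'b::real_normed_vector) \<Rightarrow> complex ^ 'n \<Rightarrow> real \<Rightarrow> ennreal" where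
  "I_ball q f z r = (\<integral>\<^sup>+w\<in>ball z r. ennreal (norm (f w) powr q) \<partial>lebesgue)"

text \<open>
  The type argument selects the dimension; by translation invariance the centre is irrelevant.
\<close>

definition ball_vol :: "'a::euclidean_space itself \<Rightarrow> real \<Rightarrow> real" where
  "ball_vol _ r = measure lebesgue (ball (0 :: 'a) r)"

lemma emeasure_ball_eq_vol:
  fixes z :: "'a::euclidean_space"
  shows "emeasure lebesgue (ball z r) = ennreal (ball_vol TYPE('a) r)"
proof -
  have "emeasure lebesgue (ball z r) = ennreal (measure lebesgue (ball z r))"
    by (rule emeasure_eq_ennreal_measure) (use emeasure_bounded_finite[of "ball z r"] in auto)
  also have "measure lebesgue (ball z r) = ball_vol TYPE('a) r"
    unfolding ball_vol_def using measure_translation[of z "ball 0 r"] by (simp add: image_add_ball)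
  finally show ?thesis .
qed

lemma ball_vol_pos: "0 < (r::real) \<Longrightarrow> 0 < ball_vol TYPE('a::euclidean_space) r"
  unfolding ball_vol_def by (simp add: content_ball_pos)

lemma M_avg_eq:
  fixes f :: "complex ^ 'n \<Rightarrow> 'b::real_normed_vector"
  assumes "0 < q" "0 < r"
  shows "M_avg q r f z = ennreal (ball_vol TYPE(complex ^ 'n) r powr (- 1 / q)) * epowr (I_ball q f z r) (1/q)"
proof -
  have "I_ball q f z r / ennreal (ball_vol TYPE(complex ^ 'n) r) = ennreal (inverse (ball_vol TYPE(complex ^ 'n) r)) * I_ball q f z r"
    using ball_vol_pos[OF assms(2), where 'a="complex ^ 'n"] by (simp add: divide_ennreal_def inverse_ennreal mult.commute)
  moreover have "inverse (ball_vol TYPE(complex ^ 'n) r) powr (1/q) = ball_vol TYPE(complex ^ 'n) r powr (- 1 / q)"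
    using ball_vol_pos[OF assms(2), where 'a="complex ^ 'n"] by (simp add: inverse_powr powr_minus[symmetric])
  moreover have "0 \<le> inverse (ball_vol TYPE(complex ^ 'n) r)"
    using ball_vol_pos[OF assms(2), where 'a="complex ^ 'n"] by simp
  ultimately show ?thesis
    using assms unfolding M_avg_def emeasure_ball_eq_vol I_ball_def[symmetric]
    by (simp only: epowr_mult epowr_ennreal divide_pos_pos zero_less_one)
qed

lemma measurable_powr_ennreal:
  assumes "f \<in> borel_measurable lebesgue"
  shows "(\<lambda>w. ennreal (norm (f w) powr q)) \<in> borel_measurable lebesgue"
  using assms by measurable

text \<open>
  After \<open>f\<close> has been replaced by a Borel function on the complement of a null set, this is Tonelli's theorem for the indicator function of
  \<open>{(z, w). dist z w < r}\<close>.
\<close>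

lemma I_ball_measurable:
  fixes f :: "complex ^ 'n \<Rightarrow> 'b::{real_normed_vector,second_countable_topology}"
  assumes "f \<in> borel_measurable lebesgue"
  shows "(\<lambda>z. I_ball q f z r) \<in> borel_measurable borel"
proof -
  obtain g where g: "g \<in> borel_measurable lborel" "AE x in lborel. ennreal (norm (f x) powr q) = g x"
    using completion_ex_borel_measurable[OF measurable_powr_ennreal[OF assms]] by auto
  have [measurable]: "g \<in> borel_measurable borel" using g(1) by simp
  have "I_ball q f z r = (\<integral>\<^sup>+w. g w * indicator {p. dist (fst p) (snd p) < r} (z, w) \<partial>lborel)" for z
    unfolding I_ball_def nn_integral_completion using g(2)
    by (intro nn_integral_cong_AE) (auto elim!: eventually_mono split: split_indicator)
  moreover have "(\<lambda>z. \<integral>\<^sup>+w. g w * indicator {p. dist (fst p) (snd p) < r} (z, w) \<partial>lborel) \<in> borel_measurable lborel"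
  proof (rule lborel.borel_measurable_nn_integral)
    have "open {p :: (complex^'n) \<times> (complex^'n). dist (fst p) (snd p) < r}"
      by (intro open_Collect_less continuous_intros)
    then have [measurable]: "{p :: (complex^'n) \<times> (complex^'n). dist (fst p) (snd p) < r} \<in> sets borel"
      by simp
    show "(\<lambda>(z, w). g w * indicator {p. dist (fst p) (snd p) < r} (z, w)) \<in> borel_measurable (lborel \<Otimes>\<^sub>M lborel)"
    proof -
      have "snd \<in> borel_measurable (borel :: ((complex^'n) \<times> (complex^'n)) measure)"
        by (intro borel_measurable_continuous_onI continuous_on_snd continuous_on_id)
      then have [measurable]: "(\<lambda>p::(complex^'n) \<times> (complex^'n). g (snd p)) \<in> borel_measurable borel"
        by (rule measurable_compose) simp
      show ?thesis unfolding lborel_prod split_beta by simp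
    qed
  qed
  ultimately show ?thesis by simp
qed

lemma M_avg_measurable:
  fixes f :: "complex ^ 'n \<Rightarrow> 'b::{real_normed_vector,second_countable_topology}"
  assumes "f \<in> borel_measurable lebesgue" "0 < q" "0 < r"
  shows "M_avg q r f \<in> borel_measurable lebesgue"
proof -
  note [measurable] = I_ball_measurable[OF assms(1)]
  have "M_avg q r f \<in> borel_measurable lborel"
    unfolding M_avg_eq[OF assms(2,3), abs_def] by measurable
  then show ?thesis by (rule measurable_completion)
qed

text \<open>
  A large ball is covered by finitely many translates of a small one, and the translation vectors do
  not depend on the centre.
\<close>

lemma M_avg_radius:
  assumes q: "0 < q" and "0 < R" "0 < r"
  obtains C I where "0 \<le> C" "finite I"
    "\<And>(f :: complex ^ 'n \<Rightarrow> 'b::{real_normed_vector,second_countable_topology}) z.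
       f \<in> borel_measurable lebesgue \<Longrightarrow> M_avg q R f z \<le> ennreal C * (\<Sum>a\<in>I. M_avg q r f (z + a))"
proof -
  obtain I :: "(complex^'n) set" where I: "finite I" "cball 0 R \<subseteq> (\<Union>a\<in>I. ball a r)"
    using compact_cball[of "0 :: complex^'n" R] \<open>0 < r\<close> unfolding compact_eq_totally_bounded by blast
  define C where "C = ball_vol TYPE(complex ^ 'n) R powr (- 1 / q) * real (card I) powr (1/q) * ball_vol TYPE(complex ^ 'n) r powr (1 / q)"
  show thesis
  proof (rule that[of C I])
    fix f :: "complex ^ 'n \<Rightarrow> 'b" and z assume f: "f \<in> borel_measurable lebesgue"
    have cover: "ball z R \<subseteq> (\<Union>a\<in>I. ball (z + a) r)"
    proof
      fix w assume "w \<in> ball z R"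
      then have "w - z \<in> cball 0 R" by (simp add: dist_norm norm_minus_commute)
      then have "w - z \<in> (\<Union>a\<in>I. ball a r)" by (rule subsetD[OF I(2)])
      then obtain a where a: "a \<in> I" "w - z \<in> ball a r" by (rule UN_E)
      have "a - (w - z) = z + a - w" by simp
      then have "w \<in> ball (z + a) r" using a(2) unfolding mem_ball dist_norm by metis
      with a(1) show "w \<in> (\<Union>a\<in>I. ball (z + a) r)" by (rule UN_I)
    qed
    have "I_ball q f z R \<le> (\<Sum>a\<in>I. I_ball q f (z + a) r)"
      unfolding I_ball_def by (rule nn_integral_cover_le[OF I(1) cover measurable_powr_ennreal[OF f]]) simp
    then have "epowr (I_ball q f z R) (1/q) \<le> epowr (\<Sum>a\<in>I. I_ball q f (z + a) r) (1/q)"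
      using q by (intro epowr_mono) auto
    also have "\<dots> \<le> ennreal (real (card I) powr (1/q)) * (\<Sum>a\<in>I. epowr (I_ball q f (z + a) r) (1/q))"
      using q I by (intro epowr_sum_le) auto
    finally have "M_avg q R f z \<le> ennreal (ball_vol TYPE(complex ^ 'n) R powr (- 1 / q)) *
        (ennreal (real (card I) powr (1/q)) * (\<Sum>a\<in>I. epowr (I_ball q f (z + a) r) (1/q)))"
      unfolding M_avg_eq[OF q \<open>0 < R\<close>] by (rule mult_left_mono) simp
    also have "\<dots> = ennreal C * (\<Sum>a\<in>I. M_avg q r f (z + a))"
    proof -
      have "ball_vol TYPE(complex ^ 'n) r powr (1 / q) * ball_vol TYPE(complex ^ 'n) r powr (- 1 / q) = 1"
        using ball_vol_pos[OF \<open>0 < r\<close>, where 'a="complex ^ 'n"] by (simp add: powr_add[symmetric])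
      then have inv: "ennreal (ball_vol TYPE(complex ^ 'n) r powr (1 / q)) * (ennreal (ball_vol TYPE(complex ^ 'n) r powr (- 1 / q)) * x) = x" for x
        by (simp add: mult.assoc[symmetric] ennreal_mult[symmetric])
      note [simp del] = minus_divide_left minus_divide_left[symmetric] divide_minus_left
      show ?thesis
        unfolding M_avg_eq[OF q \<open>0 < r\<close>] C_def sum_distrib_left[symmetric]
        by (simp add: ennreal_mult mult.assoc inv)
    qed
    finally show "M_avg q R f z \<le> ennreal C * (\<Sum>a\<in>I. M_avg q r f (z + a))" .
  qed (auto simp: C_def I)
qed

section \<open>Functions of class \<open>C\<^sup>k\<close> on open sets\<close>

text \<open>
  The local version of \<open>Ck\<close>: holomorphic competitors are smooth on their ball only.
\<close>

primrec Ck_on :: "nat \<Rightarrow> ('a::euclidean_space \<Rightarrow> 'b::real_normed_vector) \<Rightarrow> 'a set \<Rightarrow> bool" where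
  "Ck_on 0 f S \<longleftrightarrow> continuous_on S f"
| "Ck_on (Suc k) f S \<longleftrightarrow> (\<forall>x\<in>S. f differentiable (at x)) \<and>
     (\<forall>v. Ck_on k (\<lambda>x. frechet_derivative f (at x) v) S)"

lemma Ck_on_UNIV: "Ck_on k f UNIV \<longleftrightarrow> Ck k f"
  by (induction k arbitrary: f) auto

lemma frechet_derivative_cong:
  assumes "open S" "x \<in> S" "\<And>y. y \<in> S \<Longrightarrow> f y = g y" "f differentiable (at x)"
  shows "g differentiable (at x)" "frechet_derivative g (at x) = frechet_derivative f (at x)"
proof -
  have "(f has_derivative frechet_derivative f (at x)) (at x)"
    using assms(4) by (simp add: frechet_derivative_works)
  then have *: "(g has_derivative frechet_derivative f (at x)) (at x)"
    by (rule has_derivative_transform_within_open[OF _ assms(1,2)]) (use assms(3) in auto)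
  then show "g differentiable (at x)" by (rule differentiableI)
  show "frechet_derivative g (at x) = frechet_derivative f (at x)"
    using frechet_derivative_at[OF *] by simp
qed

lemma Ck_on_cong:
  assumes "open S" "\<And>y. y \<in> S \<Longrightarrow> f y = g y" "Ck_on k f S"
  shows "Ck_on k g S"
  using assms(2,3)
proof (induction k arbitrary: f g)
  case 0
  then show ?case by (simp cong: continuous_on_cong)
next
  case (Suc k)
  have "Ck_on k (\<lambda>x. frechet_derivative g (at x) v) S" for v
  proof (rule Suc.IH)
    show "Ck_on k (\<lambda>x. frechet_derivative f (at x) v) S" using Suc.prems by simp
    show "frechet_derivative f (at x) v = frechet_derivative g (at x) v" if "x \<in> S" for x
      using Suc.prems that frechet_derivative_cong(2)[OF assms(1) that, of f g] by simp
  qed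
  moreover have "\<forall>x\<in>S. g differentiable (at x)"
    using Suc.prems frechet_derivative_cong(1)[OF assms(1), of _ f g] by auto
  ultimately show ?case by simp
qed

lemma Ck_on_subset: "Ck_on k f S \<Longrightarrow> T \<subseteq> S \<Longrightarrow> Ck_on k f T"
  by (induction k arbitrary: f) (auto intro: continuous_on_subset)

text \<open>
  Smoothness is a local property; this is how functions given by different formulas on overlapping
  open sets are glued.
\<close>

lemma Ck_on_Union:
  assumes "\<And>x. x \<in> S \<Longrightarrow> \<exists>T. open T \<and> x \<in> T \<and> Ck_on k f T"
  shows "Ck_on k f S"
  using assms
proof (induction k arbitrary: f)
  case 0
  then show ?case
    by (metis Ck_on.simps(1) continuous_at_imp_continuous_on continuous_on_eq_continuous_at)
next
  case (Suc k)
  have "f differentiable (at x)" if "x \<in> S" for x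
    using Suc.prems[OF that] by auto
  moreover have "Ck_on k (\<lambda>x. frechet_derivative f (at x) v) S" for v
    by (rule Suc.IH) (use Suc.prems in fastforce)
  ultimately show ?case by simp
qed

lemma Ck_on_Suc_D: "Ck_on (Suc k) f S \<Longrightarrow> Ck_on k f S"
proof (induction k arbitrary: f)
  case 0
  then show ?case
    by (auto intro!: continuous_at_imp_continuous_on differentiable_imp_continuous_within)
next
  case (Suc k)
  have "Ck_on k (\<lambda>x. frechet_derivative f (at x) v) S" for v
    by (rule Suc.IH) (use Suc.prems in simp)
  then show ?case using Suc.prems by simp
qed

lemma Ck_on_const: "Ck_on k (\<lambda>x. c) S"
  by (induction k arbitrary: c) (auto simp: frechet_derivative_const)

lemma Ck_on_add:
  assumes "open S" "Ck_on k f S" "Ck_on k g S"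
  shows "Ck_on k (\<lambda>x. f x + g x) S"
  using assms(2,3)
proof (induction k arbitrary: f g)
  case 0
  then show ?case by (simp add: continuous_on_add)
next
  case (Suc k)
  have der: "((\<lambda>x. f x + g x) has_derivative (\<lambda>v. frechet_derivative f (at x) v + frechet_derivative g (at x) v)) (at x)"
    if "x \<in> S" for x
    using Suc.prems that by (intro has_derivative_add) (simp_all add: frechet_derivative_works)
  have "Ck_on k (\<lambda>x. frechet_derivative (\<lambda>x. f x + g x) (at x) v) S" for v
  proof (rule Ck_on_cong[OF assms(1)])
    show "Ck_on k (\<lambda>x. frechet_derivative f (at x) v + frechet_derivative g (at x) v) S"
      using Suc.prems by (intro Suc.IH) auto
    show "frechet_derivative f (at x) v + frechet_derivative g (at x) v = frechet_derivative (\<lambda>x. f x + g x) (at x) v"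
      if "x \<in> S" for x using frechet_derivative_at[OF der[OF that]] by metis
  qed
  then show ?case using der by (auto simp: differentiable_def)
qed

lemma Ck_on_mult:
  fixes f g :: "'a::euclidean_space \<Rightarrow> 'b::real_normed_algebra"
  assumes "open S" "Ck_on k f S" "Ck_on k g S"
  shows "Ck_on k (\<lambda>x. f x * g x) S"
  using assms(2,3)
proof (induction k arbitrary: f g)
  case 0
  then show ?case by (simp add: continuous_on_mult)
next
  case (Suc k)
  have der: "((\<lambda>x. f x * g x) has_derivative (\<lambda>v. f x * frechet_derivative g (at x) v + frechet_derivative f (at x) v * g x)) (at x)"
    if "x \<in> S" for x
    using Suc.prems that by (intro has_derivative_mult) (simp_all add: frechet_derivative_works)
  have "Ck_on k (\<lambda>x. frechet_derivative (\<lambda>x. f x * g x) (at x) v) S" for v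
  proof (rule Ck_on_cong[OF assms(1)])
    show "Ck_on k (\<lambda>x. f x * frechet_derivative g (at x) v + frechet_derivative f (at x) v * g x) S"
      using Suc.prems Suc.prems[THEN Ck_on_Suc_D] by (intro Ck_on_add assms(1) Suc.IH) auto
    show "f x * frechet_derivative g (at x) v + frechet_derivative f (at x) v * g x = frechet_derivative (\<lambda>x. f x * g x) (at x) v"
      if "x \<in> S" for x using frechet_derivative_at[OF der[OF that]] by metis
  qed
  then show ?case using der by (auto simp: differentiable_def)
qed

lemma Ck_on_sum:
  assumes "open S" "\<And>i. i \<in> I \<Longrightarrow> Ck_on k (f i) S"
  shows "Ck_on k (\<lambda>x. \<Sum>i\<in>I. f i x) S"
  using assms(2) by (induction I rule: infinite_finite_induct) (auto simp: Ck_on_const Ck_on_add[OF assms(1)])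

lemma Ck_on_prod:
  fixes f :: "'i \<Rightarrow> 'a::euclidean_space \<Rightarrow> 'b::{real_normed_algebra,comm_ring_1}"
  assumes "open S" "\<And>i. i \<in> I \<Longrightarrow> Ck_on k (f i) S"
  shows "Ck_on k (\<lambda>x. \<Prod>i\<in>I. f i x) S"
  using assms(2) by (induction I rule: infinite_finite_induct) (auto simp: Ck_on_const Ck_on_mult[OF assms(1)])

section \<open>Smoothness of holomorphic functions of several variables\<close>

lemma holomorphic_Cn_deriv:
  assumes "holomorphic_Cn h S" "z \<in> S"
  shows "(h has_derivative frechet_derivative h (at z)) (at z)"
    and "frechet_derivative h (at z) (c *s v) = c * frechet_derivative h (at z) v"
proof -
  obtain D where D: "(h has_derivative D) (at z)" "\<And>c v. D (c *s v) = c * D v"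
    using assms by (auto simp: holomorphic_Cn_def)
  have "frechet_derivative h (at z) = D" using frechet_derivative_at[OF D(1)] by simp
  then show "(h has_derivative frechet_derivative h (at z)) (at z)"
    and "frechet_derivative h (at z) (c *s v) = c * frechet_derivative h (at z) v" using D by auto
qed

lemma holomorphic_Cn_continuous: "holomorphic_Cn h S \<Longrightarrow> continuous_on S h"
  unfolding holomorphic_Cn_def using has_derivative_continuous by (blast intro: continuous_at_imp_continuous_on)

lemma norm_smult_vec: "norm (c *s (v :: complex ^ 'n)) = cmod c * norm v"
  by (simp add: norm_vec_def L2_set_def norm_mult power_mult_distrib sum_distrib_left[symmetric] real_sqrt_mult)

lemma smult_real_vec: "complex_of_real c *s (v :: complex ^ 'n) = c *\<^sub>R v"
  unfolding vec_eq_iff vector_smult_component vector_scaleR_component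
  using scaleR_conv_of_real[where 'a=complex] by simp

lemma bounded_linear_smult_left: "bounded_linear (\<lambda>c. c *s (v :: complex ^ 'n))"
proof (rule bounded_linear_intro[where K="norm v"])
  show "(r *\<^sub>R c) *s v = r *\<^sub>R (c *s v)" for r c
    unfolding smult_real_vec[symmetric] by (simp add: scaleR_conv_of_real)
qed (auto simp: vec_eq_iff norm_smult_vec algebra_simps)

text \<open>
  Cauchy's formula for the derivative at \<open>0\<close> of the function \<open>c \<mapsto> h (z + c v)\<close> of one variable.
\<close>

lemma holomorphic_Cn_Cauchy:
  fixes h :: "complex ^ 'n \<Rightarrow> complex"
  assumes hol: "holomorphic_Cn h S" and r: "0 < r" and sub: "\<And>c. cmod c \<le> r \<Longrightarrow> z + c *s v \<in> S"
  shows "frechet_derivative h (at z) v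
    = integral (cbox 0 1) (\<lambda>t. h (z + (of_real r * exp (2 * of_real pi * \<i> * of_real t)) *s v)
        / (of_real r * exp (2 * of_real pi * \<i> * of_real t)))"
proof -
  define g where "g = (\<lambda>c. h (z + c *s v))"
  have der: "(g has_field_derivative frechet_derivative h (at (z + c *s v)) v) (at c)" if "cmod c \<le> r" for c
  proof -
    have "((\<lambda>c. z + c *s v) has_derivative (\<lambda>c. c *s v)) (at c)"
      using has_derivative_add[OF has_derivative_const bounded_linear_imp_has_derivative[OF bounded_linear_smult_left]] by simp
    from has_derivative_compose[OF this holomorphic_Cn_deriv(1)[OF hol sub[OF that]]]
    show ?thesis
      unfolding has_field_derivative_def g_def
      by (simp add: holomorphic_Cn_deriv(2)[OF hol sub[OF that]] mult.commute[of _ "frechet_derivative h _ v"] o_def)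
  qed
  have cont: "continuous_on (cball 0 r) g"
    by (rule DERIV_continuous_on, rule has_field_derivative_at_within, rule der) auto
  have holg: "g holomorphic_on ball 0 r"
  proof (rule holomorphic_onI)
    fix c :: complex assume "c \<in> ball 0 r"
    then have "cmod c \<le> r" by simp
    from has_field_derivative_at_within[OF der[OF this]]
    show "g field_differentiable at c within ball 0 r" unfolding field_differentiable_def by blast
  qed
  have "((\<lambda>u. g u / (u - 0) ^ (Suc 1)) has_contour_integral ((2 * pi * \<i>) / (fact 1) * (deriv ^^ 1) g 0)) (circlepath 0 r)"
    using Cauchy_has_contour_integral_higher_derivative_circlepath[OF cont holg, of 0 1] r by simp
  then have "((\<lambda>t. g (circlepath 0 r t) / (circlepath 0 r t)^2 * vector_derivative (circlepath 0 r) (at t within {0..1}))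
      has_integral (2 * pi * \<i>) * deriv g 0) {0..1}"
    by (simp add: has_contour_integral_def power2_eq_square)
  then have "((\<lambda>t. (2 * pi * \<i>) * (g (circlepath 0 r t) / circlepath 0 r t)) has_integral (2 * pi * \<i>) * deriv g 0) {0..1}"
  proof (rule has_integral_eq[rotated])
    fix t :: real assume "t \<in> {0..1}"
    then have "vector_derivative (circlepath 0 r) (at t within {0..1}) = (2 * pi * \<i>) * circlepath 0 r t"
      by (subst vector_derivative_circlepath01) (auto simp: circlepath)
    moreover have "circlepath 0 r t \<noteq> 0" using r by (simp add: circlepath)
    ultimately show "g (circlepath 0 r t) / (circlepath 0 r t)^2 * vector_derivative (circlepath 0 r) (at t within {0..1})
        = (2 * pi * \<i>) * (g (circlepath 0 r t) / circlepath 0 r t)"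
      by (simp only:) (simp add: power2_eq_square)
  qed
  note I = this
  have cancel: "inverse (2 * pi * \<i>) * ((2 * pi * \<i>) * x) = x" for x
    by (simp add: field_simps)
  have "((\<lambda>t. g (circlepath 0 r t) / circlepath 0 r t) has_integral deriv g 0) {0..1}"
    using has_integral_mult_right[OF I, of "inverse (2 * pi * \<i>)"] unfolding cancel .
  moreover have "deriv g 0 = frechet_derivative h (at z) v"
    using DERIV_imp_deriv[OF der[of 0]] r by simp
  ultimately show ?thesis
    by (simp add: g_def circlepath cbox_interval integral_unique)
qed

text \<open>
  The radius of the circle of integration can be kept fixed while the point moves in a small convex ball,
  which makes the formula differentiable in the point.
\<close>

lemma holomorphic_Cn_deriv_local:
  fixes h :: "complex ^ 'n \<Rightarrow> complex"
  assumes "holomorphic_Cn h S" "open S" "z0 \<in> S"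
  obtains U E where "open U" "convex U" "z0 \<in> U" "U \<subseteq> S" "continuous_on UNIV E" "\<And>t. E t \<noteq> 0"
    "\<And>z t. z \<in> U \<Longrightarrow> z + E t *s v \<in> S"
    "\<And>z. z \<in> U \<Longrightarrow> frechet_derivative h (at z) v = integral (cbox 0 (1::real)) (\<lambda>t. h (z + E t *s v) / E t)"
proof -
  obtain e where e: "0 < e" "ball z0 e \<subseteq> S"
    using assms(2,3) open_contains_ball by blast
  define r where "r = e / (2 * (norm v + 1))"
  have n: "0 < norm v + 1" using norm_ge_zero[of v] by linarith
  have "e * norm v < e * (norm v + 1)" using e(1) by simp
  then have r: "0 < r" "r * norm v < e / 2"
    using e(1) n by (simp_all add: r_def divide_simps)
  define E where "E = (\<lambda>t::real. of_real r * exp (2 * of_real pi * \<i> * of_real t))"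
  have normE: "cmod (E t) = r" for t
    using r by (simp add: E_def norm_mult)
  have sub: "z + c *s v \<in> S" if "z \<in> ball z0 (e/2)" "cmod c \<le> r" for z c
  proof -
    have "norm (c *s v) \<le> r * norm v" using that(2) by (simp add: norm_smult_vec mult_right_mono)
    then have "dist z0 (z + c *s v) < e"
      using that(1) r(2) norm_triangle_ineq4[of "z0 - z" "c *s v"] by (simp add: dist_norm algebra_simps)
    then show ?thesis using e(2) by auto
  qed
  show thesis
  proof (rule that[of "ball z0 (e/2)" E])
    show "continuous_on UNIV E" unfolding E_def by (intro continuous_intros)
    show "E t \<noteq> 0" for t using r by (simp add: E_def)
    show "z + E t *s v \<in> S" if "z \<in> ball z0 (e/2)" for z t using sub[OF that] normE[of t] by simp
    show "frechet_derivative h (at z) v = integral (cbox 0 (1::real)) (\<lambda>t. h (z + E t *s v) / E t)"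
      if "z \<in> ball z0 (e/2)" for z
      unfolding E_def by (rule holomorphic_Cn_Cauchy[OF assms(1) r(1) sub[OF that]])
    show "ball z0 (e/2) \<subseteq> S" using e by force
  qed (use e in auto)
qed

lemma continuous_on_smult [continuous_intros]:
  "continuous_on S f \<Longrightarrow> continuous_on S (\<lambda>x. f x *s (v :: complex ^ 'n))"
  using bounded_linear.continuous_on[OF bounded_linear_smult_left] .

lemma holomorphic_Cn_deriv_continuous:
  fixes h :: "complex ^ 'n \<Rightarrow> complex"
  assumes "holomorphic_Cn h S" "open S"
  shows "continuous_on S (\<lambda>z. frechet_derivative h (at z) v)"
proof -
  have "isCont (\<lambda>z. frechet_derivative h (at z) v) z0" if "z0 \<in> S" for z0
  proof -
    obtain U E where U: "open U" "convex U" "z0 \<in> U" "U \<subseteq> S" and E: "continuous_on UNIV E" "\<And>t. E t \<noteq> 0"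
      and sub: "\<And>z t. z \<in> U \<Longrightarrow> z + E t *s v \<in> S"
      and eq: "\<And>z. z \<in> U \<Longrightarrow> frechet_derivative h (at z) v = integral (cbox 0 (1::real)) (\<lambda>t. h (z + E t *s v) / E t)"
      by (rule holomorphic_Cn_deriv_local[OF assms \<open>z0 \<in> S\<close>, where v=v]) (rule that; simp)
    have "continuous_on U (\<lambda>z. integral (cbox 0 (1::real)) (\<lambda>t. h (z + E t *s v) / E t))"
    proof (rule integral_continuous_on_param)
      show "continuous_on (U \<times> cbox 0 1) (\<lambda>(z, t). h (z + E t *s v) / E t)"
        unfolding split_beta using sub E(2)
        by (intro continuous_intros continuous_on_compose2[OF holomorphic_Cn_continuous[OF assms(1)]]
             continuous_on_compose2[OF E(1)]) auto
    qed
    then have "continuous_on U (\<lambda>z. frechet_derivative h (at z) v)"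
      using eq by (simp cong: continuous_on_cong)
    then show ?thesis using U(1,3) continuous_on_eq_continuous_at by blast
  qed
  then show ?thesis by (rule continuous_at_imp_continuous_on[OF ballI])
qed

lemma holomorphic_Cn_deriv_blinfun:
  fixes h :: "complex ^ 'n \<Rightarrow> complex"
  assumes "holomorphic_Cn h S" "open S"
  shows "\<And>z. z \<in> S \<Longrightarrow> blinfun_apply (Blinfun (frechet_derivative h (at z))) = frechet_derivative h (at z)"
    and "continuous_on S (\<lambda>z. Blinfun (frechet_derivative h (at z)))"
proof -
  show eq: "blinfun_apply (Blinfun (frechet_derivative h (at z))) = frechet_derivative h (at z)" if "z \<in> S" for z
    by (rule bounded_linear_Blinfun_apply, rule has_derivative_bounded_linear[OF holomorphic_Cn_deriv(1)[OF assms(1) that]])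
  show "continuous_on S (\<lambda>z. Blinfun (frechet_derivative h (at z)))"
    by (rule continuous_on_blinfun_componentwise)
       (use eq holomorphic_Cn_deriv_continuous[OF assms] in \<open>simp cong: continuous_on_cong\<close>)
qed

text \<open>
  Differentiation of Cauchy's formula under the integral sign. The derivative of the integrand is
  complex linear, hence so is its integral.
\<close>

lemma holomorphic_Cn_directional_derivative:
  fixes h :: "complex ^ 'n \<Rightarrow> complex"
  assumes hol: "holomorphic_Cn h S" and "open S"
  shows "holomorphic_Cn (\<lambda>z. frechet_derivative h (at z) v) S"
  unfolding holomorphic_Cn_def
proof
  fix z0 assume "z0 \<in> S"
  obtain U E where U: "open U" "convex U" "z0 \<in> U" "U \<subseteq> S" and E: "continuous_on UNIV E" "\<And>t. E t \<noteq> 0"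
    and sub: "\<And>z t. z \<in> U \<Longrightarrow> z + E t *s v \<in> S"
    and eq: "\<And>z. z \<in> U \<Longrightarrow> frechet_derivative h (at z) v = integral (cbox 0 (1::real)) (\<lambda>t. h (z + E t *s v) / E t)"
    by (rule holomorphic_Cn_deriv_local[OF assms \<open>z0 \<in> S\<close>, where v=v]) (rule that; simp)
  define h' where "h' = (\<lambda>z. Blinfun (frechet_derivative h (at z)))"
  have h': "blinfun_apply (h' z) = frechet_derivative h (at z)" if "z \<in> S" for z
    unfolding h'_def using holomorphic_Cn_deriv_blinfun(1)[OF assms that] .
  have cont_h': "continuous_on S h'"
    unfolding h'_def using holomorphic_Cn_deriv_blinfun(2)[OF assms] .
  define F where "F = (\<lambda>z t. blinfun_mult_right (inverse (E t)) o\<^sub>L h' (z + E t *s v))"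
  have F: "blinfun_apply (F z t) w = frechet_derivative h (at (z + E t *s v)) w / E t" if "z \<in> U" for z t w
    using h'[OF sub[OF that, of t]] by (simp add: F_def divide_inverse mult.commute)
  have contF: "continuous_on (U \<times> cbox 0 1) (\<lambda>(z, t). F z t)"
    unfolding split_beta F_def using sub E(2)
    by (intro continuous_intros continuous_on_compose2[OF cont_h'] continuous_on_compose2[OF E(1)]
        bounded_linear.continuous_on[OF bounded_linear_blinfun_mult_right]) auto
  have "((\<lambda>z. integral (cbox 0 1) (\<lambda>t. h (z + E t *s v) / E t)) has_derivative integral (cbox 0 1) (F z0)) (at z0 within U)"
  proof (rule leibniz_rule)
    fix z t assume z: "z \<in> U"
    have "((\<lambda>z. z + E t *s v) has_derivative (\<lambda>w. w)) (at z within U)"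
      by (auto intro!: derivative_eq_intros)
    from has_derivative_compose[OF this holomorphic_Cn_deriv(1)[OF hol sub[OF z]]]
    have "((\<lambda>z. h (z + E t *s v)) has_derivative frechet_derivative h (at (z + E t *s v))) (at z within U)" .
    from has_derivative_mult_left[OF this, of "inverse (E t)"]
    show "((\<lambda>z. h (z + E t *s v) / E t) has_derivative blinfun_apply (F z t)) (at z within U)"
      unfolding ext[of "blinfun_apply (F z t)", OF F[OF z, of t]] divide_inverse .
  next
    fix z assume z: "z \<in> U"
    show "(\<lambda>t. h (z + E t *s v) / E t) integrable_on cbox 0 1"
      using sub[OF z] E(2)
      by (intro integrable_continuous continuous_intros continuous_on_compose2[OF holomorphic_Cn_continuous[OF hol]]
           continuous_on_subset[OF E(1)]) auto
  qed (use contF U in auto)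
  then have der: "((\<lambda>z. frechet_derivative h (at z) v) has_derivative integral (cbox 0 1) (F z0)) (at z0)"
    using U eq by (subst (asm) at_within_open) (auto elim!: has_derivative_transform_within_open)
  have intF: "F z0 integrable_on cbox 0 1"
  proof (rule integrable_continuous)
    have "continuous_on (cbox 0 1) (\<lambda>t. (\<lambda>(z, t). F z t) (z0, t))"
      by (rule continuous_on_compose2[OF contF]) (use U in \<open>auto intro!: continuous_intros\<close>)
    then show "continuous_on (cbox 0 1) (F z0)" by simp
  qed
  have app: "blinfun_apply (integral (cbox 0 1) (F z0)) w
      = integral (cbox 0 1) (\<lambda>t. frechet_derivative h (at (z0 + E t *s v)) w / E t)" for w
    using blinfun_apply_integral[OF intF, of w] F[OF U(3)] by simp
  have "blinfun_apply (integral (cbox 0 1) (F z0)) (c *s w) = c * blinfun_apply (integral (cbox 0 1) (F z0)) w" for c w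
    unfolding app using holomorphic_Cn_deriv(2)[OF hol sub[OF U(3)]] by (simp add: integral_mult_right[symmetric])
  with der show "\<exists>D. ((\<lambda>z. frechet_derivative h (at z) v) has_derivative D) (at z0) \<and> (\<forall>c w. D (c *s w) = c * D w)"
    by blast
qed

lemma holomorphic_Cn_imp_Ck_on:
  fixes h :: "complex ^ 'n \<Rightarrow> complex"
  assumes "holomorphic_Cn h S" "open S"
  shows "Ck_on k h S"
  using assms
proof (induction k arbitrary: h)
  case 0
  then show ?case by (simp add: holomorphic_Cn_continuous)
next
  case (Suc k)
  then show ?case
    using holomorphic_Cn_directional_derivative holomorphic_Cn_deriv(1)[OF Suc.prems(1), THEN differentiableI]
    by auto
qed

section \<open>A cubic spline step\<close>

definition pos_power :: "nat \<Rightarrow> real \<Rightarrow> real" where "pos_power k x = (if 0 \<le> x then x ^ k else 0)"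

text \<open>
  A third difference of \<open>x\<^sub>+\<^sup>3 / 6\<close>: it is piecewise cubic and twice continuously differentiable, and
  since the third difference of \<open>x\<^sup>3 / 6\<close> is \<open>1\<close>, it is constant for \<open>x \<ge> 3\<close>. The next two functions are its first two
  derivatives.
\<close>

definition smooth_step :: "real \<Rightarrow> real" where
  "smooth_step x = (pos_power 3 x - 3 * pos_power 3 (x - 1) + 3 * pos_power 3 (x - 2) - pos_power 3 (x - 3)) / 6"

definition smooth_step1 :: "real \<Rightarrow> real" where
  "smooth_step1 x = (pos_power 2 x - 3 * pos_power 2 (x - 1) + 3 * pos_power 2 (x - 2) - pos_power 2 (x - 3)) / 2"

definition smooth_step2 :: "real \<Rightarrow> real" where
  "smooth_step2 x = pos_power 1 x - 3 * pos_power 1 (x - 1) + 3 * pos_power 1 (x - 2) - pos_power 1 (x - 3)"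

lemma pos_power_deriv:
  assumes "2 \<le> k"
  shows "(pos_power k has_field_derivative (real k * pos_power (k - 1) x)) (at x)"
proof -
  consider "x < 0" | "x = 0" | "0 < x" by linarith
  then show ?thesis
  proof cases
    case 1
    have "((\<lambda>x. 0) has_field_derivative 0) (at x)" by simp
    then have "(pos_power k has_field_derivative 0) (at x)"
      by (rule has_field_derivative_transform_within_open[of _ _ _ "{..<0}"]) (use 1 in \<open>auto simp: pos_power_def\<close>)
    then show ?thesis using 1 by (simp add: pos_power_def)
  next
    case 3
    have "((\<lambda>x. x ^ k) has_field_derivative (real k * x ^ (k - 1))) (at x)"
      by (auto intro!: derivative_eq_intros)
    then have "(pos_power k has_field_derivative (real k * x ^ (k - 1))) (at x)"
      by (rule has_field_derivative_transform_within_open[of _ _ _ "{0<..}"]) (use 3 in \<open>auto simp: pos_power_def\<close>)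
    then show ?thesis using 3 by (simp add: pos_power_def)
  next
    case 2
    have z: "(0::real) ^ k = 0" "(0::real) ^ (k - Suc 0) = 0" using assms by (auto simp: zero_power)
    have "((\<lambda>h. (pos_power k (0 + h) - pos_power k 0) / h) \<longlongrightarrow> 0) (at 0)"
    proof (rule tendsto_0_le[where K=1])
      have "((\<lambda>h::real. h ^ (k - 1)) \<longlongrightarrow> 0 ^ (k - 1)) (at 0)" by (intro tendsto_intros)
      then show "((\<lambda>h::real. h ^ (k - 1)) \<longlongrightarrow> 0) (at 0)" using assms by (simp add: zero_power)
      show "\<forall>\<^sub>F h in at 0. norm ((pos_power k (0 + h) - pos_power k 0) / h) \<le> norm (h ^ (k - 1)) * 1"
      proof (rule eventuallyI)
        fix h :: real
        have "h ^ k = h * h ^ (k - 1)" using assms by (cases k) auto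
        then show "norm ((pos_power k (0 + h) - pos_power k 0) / h) \<le> norm (h ^ (k - 1)) * 1"
          by (simp add: pos_power_def z)
      qed
    qed
    then show ?thesis using 2 by (simp add: DERIV_def pos_power_def z)
  qed
qed

lemma smooth_step_deriv: "(smooth_step has_field_derivative smooth_step1 x) (at x)"
proof -
  have p: "((\<lambda>x. pos_power 3 (x - c)) has_field_derivative (3 * pos_power 2 (x - c))) (at x)" for c
  proof -
    have "((\<lambda>x. x - c) has_field_derivative 1) (at x)" by (auto intro!: derivative_eq_intros)
    from DERIV_chain2[where f="pos_power 3", OF pos_power_deriv this] show ?thesis by simp
  qed
  show ?thesis
    unfolding smooth_step_def[abs_def] smooth_step1_def
    using p[of 0] by (auto intro!: derivative_eq_intros p simp: field_simps)
qed

lemma smooth_step1_deriv: "(smooth_step1 has_field_derivative smooth_step2 x) (at x)"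
proof -
  have p: "((\<lambda>x. pos_power 2 (x - c)) has_field_derivative (2 * pos_power 1 (x - c))) (at x)" for c
  proof -
    have "((\<lambda>x. x - c) has_field_derivative 1) (at x)" by (auto intro!: derivative_eq_intros)
    from DERIV_chain2[where f="pos_power 2", OF pos_power_deriv this] show ?thesis by simp
  qed
  show ?thesis
    unfolding smooth_step1_def[abs_def] smooth_step2_def
    using p[of 0] by (auto intro!: derivative_eq_intros p simp: field_simps)
qed

lemma smooth_step2_continuous: "continuous_on UNIV smooth_step2"
proof -
  have "pos_power 1 = (\<lambda>x. max 0 x)" by (auto simp: pos_power_def)
  then show ?thesis unfolding smooth_step2_def[abs_def] by (auto intro!: continuous_intros)
qed

lemma smooth_step1_continuous: "continuous_on S smooth_step1"
  using smooth_step1_deriv by (meson DERIV_continuous_on has_field_derivative_at_within)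

lemma smooth_step_eq_0: "x \<le> 0 \<Longrightarrow> smooth_step x = 0"
  and smooth_step1_eq_0: "x \<le> 0 \<or> 3 \<le> x \<Longrightarrow> smooth_step1 x = 0"
  by (cases "x = 0"; cases "x = 3"; auto simp: smooth_step_def smooth_step1_def pos_power_def power2_eq_square power3_eq_cube algebra_simps)+

lemma smooth_step_eq_1: "3 \<le> x \<Longrightarrow> smooth_step x = 1"
  by (auto simp: smooth_step_def pos_power_def power3_eq_cube algebra_simps)

text \<open>
  On this interval the quadratic spline equals \<open>((x - 1) (2 - x)) + 1 / 2\<close>.
\<close>

lemma smooth_step1_middle:
  assumes "1 \<le> x" "x \<le> 2"
  shows "1 / 2 \<le> smooth_step1 x"
proof -
  define p where "p = (x - 1) * (2 - x)"
  have "0 \<le> p" using assms unfolding p_def by (intro mult_nonneg_nonneg) auto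
  moreover have "smooth_step1 x = (2 * p + 1) / 2"
    using assms unfolding p_def
    by (cases "x = 2") (auto simp: smooth_step1_def pos_power_def power2_eq_square algebra_simps)
  ultimately show ?thesis by simp
qed

lemma smooth_step1_nonneg: "0 \<le> smooth_step1 x"
proof -
  consider "x \<le> 0 \<or> 3 \<le> x" | "0 < x" "x < 1" | "1 \<le> x" "x \<le> 2" | "2 < x" "x < 3" by linarith
  then show ?thesis
  proof cases
    case 3
    then show ?thesis using smooth_step1_middle[of x] by simp
  next
    case 4
    then have "smooth_step1 x = (3 - x)\<^sup>2 * (1 / 2)"
      by (simp add: smooth_step1_def pos_power_def power2_eq_square field_simps)
    then show ?thesis by (metis mult_nonneg_nonneg zero_le_power2 zero_le_divide_1_iff zero_le_numeral)
  next
    case 1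
    then show ?thesis using smooth_step1_eq_0 by auto
  next
    case 2
    then show ?thesis by (simp add: smooth_step1_def pos_power_def)
  qed
qed

lemma smooth_step_mono: "x \<le> y \<Longrightarrow> smooth_step x \<le> smooth_step y"
  using DERIV_nonneg_imp_nondecreasing[of x y smooth_step] smooth_step_deriv smooth_step1_nonneg by blast

lemma smooth_step_bounds: "0 \<le> smooth_step x" "smooth_step x \<le> 1"
  using smooth_step_mono[of "min x 0" x] smooth_step_mono[of x "max x 3"] by (auto simp: smooth_step_eq_0 smooth_step_eq_1)

section \<open>The Cauchy--Pompeiu formula\<close>

lemma Ck_on_SucI:
  assumes "open S" "\<And>x. x \<in> S \<Longrightarrow> (f has_derivative D x) (at x)" "\<And>v. Ck_on k (\<lambda>x. D x v) S"
  shows "Ck_on (Suc k) f S"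
proof -
  have "frechet_derivative f (at x) = D x" if "x \<in> S" for x
    using frechet_derivative_at[OF assms(2)[OF that]] by simp
  then have "Ck_on k (\<lambda>x. frechet_derivative f (at x) v) S" for v
    by (intro Ck_on_cong[OF assms(1) _ assms(3)]) simp
  then show ?thesis using assms(2) by (auto simp: differentiable_def)
qed

lemma integrable_compact_support:
  fixes f :: "'a::euclidean_space \<Rightarrow> 'b::{banach, second_countable_topology}"
  assumes "continuous_on UNIV f" "\<And>x. M < norm x \<Longrightarrow> f x = 0"
  shows "integrable lborel f"
proof -
  have "integrable lborel (\<lambda>x. indicator (cball 0 M) x *\<^sub>R f x)"
    by (rule borel_integrable_compact) (auto intro: continuous_on_subset[OF assms(1)])
  moreover have "(\<lambda>x. indicator (cball 0 M) x *\<^sub>R f x) = f"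
    using assms(2) by (auto simp: indicator_def fun_eq_iff)
  ultimately show ?thesis by simp
qed

lemma integral_lborel_translate:
  fixes f :: "'a::euclidean_space \<Rightarrow> 'b::{banach, second_countable_topology}"
  assumes "f \<in> borel_measurable borel"
  shows "(\<integral>x. f (x + a) \<partial>lborel) = (\<integral>x. f x \<partial>lborel)"
proof -
  have "(\<integral>x. f x \<partial>lborel) = (\<integral>x. f x \<partial>distr lborel borel ((+) a))"
    by (simp add: lborel_distr_plus)
  also have "\<dots> = (\<integral>x. f (a + x) \<partial>lborel)"
    using assms by (subst integral_distr) auto
  finally show ?thesis by (simp add: add.commute)
qed

text \<open>
  Lebesgue measure is translation invariant, so the integral of \<open>F (x + v / n) - F x\<close> vanishes;
  multiplying by \<open>n\<close> and passing to the limit gives the claim. The mean value theorem provides the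
  dominating function.
\<close>

lemma integral_derivative_zero:
  fixes F :: "'a::euclidean_space \<Rightarrow> 'b::euclidean_space"
  assumes F: "Ck_on 1 F UNIV" and supp: "\<And>x. M < norm x \<Longrightarrow> F x = 0"
  shows "(\<integral>x. frechet_derivative F (at x) v \<partial>lborel) = 0"
proof -
  let ?D = "\<lambda>x. frechet_derivative F (at x) v"
  have der: "(F has_derivative frechet_derivative F (at x)) (at x)" for x
    using F by (simp add: frechet_derivative_works)
  have contF: "continuous_on UNIV F" and contD: "continuous_on UNIV ?D"
    using Ck_on_Suc_D[of 0 F UNIV] F by auto
  have "bounded (?D ` cball 0 (M + 2 * norm v))"
    by (intro compact_imp_bounded compact_continuous_image continuous_on_subset[OF contD]) auto
  then obtain K where "\<forall>x\<in>cball 0 (M + 2 * norm v). norm (?D x) \<le> K"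
    unfolding bounded_iff by (auto simp del: mem_cball)
  then have K: "norm (?D x) \<le> K" if "norm x \<le> M + 2 * norm v" for x
    using that by simp
  define Q where "Q = (\<lambda>n x. real (Suc n) *\<^sub>R (F (x + (1 / real (Suc n)) *\<^sub>R v) - F x))"
  have Qbound: "norm (Q n x) \<le> K * indicator (cball 0 (M + norm v)) x" for n x
  proof -
    define N where "N = real (Suc n)"
    have N: "1 \<le> N" by (simp add: N_def)
    have Q: "norm (Q n x) = N * norm (F (x + (1 / N) *\<^sub>R v) - F x)"
      unfolding Q_def N_def by simp
    show ?thesis
    proof (cases "norm x \<le> M + norm v")
      case True
      have "\<exists>s\<in>{0<..<1 / N}. norm (F (x + (1 / N) *\<^sub>R v) - F (x + 0 *\<^sub>R v)) \<le> norm ((1 / N - 0) *\<^sub>R ?D (x + s *\<^sub>R v))"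
      proof (rule mvt_general)
        fix s :: real
        have "((\<lambda>s. x + s *\<^sub>R v) has_derivative (\<lambda>s. s *\<^sub>R v)) (at s)" by (auto intro!: derivative_eq_intros)
        from has_derivative_compose[OF this der]
        show "((\<lambda>s. F (x + s *\<^sub>R v)) has_derivative (\<lambda>r. r *\<^sub>R ?D (x + s *\<^sub>R v))) (at s)"
          using linear_scale[OF has_derivative_linear[OF der]] by simp
      qed (use N in \<open>auto intro!: continuous_intros continuous_on_compose2[OF contF]\<close>)
      then obtain s where s: "0 < s" "s < 1 / N"
        and le: "norm (F (x + (1 / N) *\<^sub>R v) - F x) \<le> 1 / N * norm (?D (x + s *\<^sub>R v))"
        using N by auto
      have "1 / N \<le> 1" using N by simp
      then have "s \<le> 1" using s by linarith
      then have "norm (s *\<^sub>R v) \<le> norm v" using s(1) by (simp add: mult_left_le_one_le)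
      then have "norm (x + s *\<^sub>R v) \<le> M + 2 * norm v"
        using True norm_triangle_ineq[of x "s *\<^sub>R v"] by linarith
      then have "norm (?D (x + s *\<^sub>R v)) \<le> K" by (rule K)
      moreover have "norm (Q n x) \<le> N * (1 / N * norm (?D (x + s *\<^sub>R v)))"
        unfolding Q using le N by (intro mult_left_mono) auto
      ultimately show ?thesis using True N by simp
    next
      case False
      have "norm ((1 / N) *\<^sub>R v) \<le> 1 * norm v"
        using N unfolding norm_scaleR by (intro mult_right_mono) auto
      then have "M < norm (x + (1 / N) *\<^sub>R v)"
        using False norm_diff_ineq[of x "(1 / N) *\<^sub>R v"] by linarith
      moreover have "M < norm x" using False norm_ge_zero[of v] by linarith
      ultimately show ?thesis using False supp by (simp add: Q)
    qed
  qed
  have Qlim: "(\<lambda>n. Q n x) \<longlonglongrightarrow> ?D x" for x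
  proof -
    have "((\<lambda>s. F (x + s *\<^sub>R v)) has_vector_derivative ?D x) (at 0)"
    proof -
      have "((\<lambda>s::real. x + s *\<^sub>R v) has_derivative (\<lambda>s. s *\<^sub>R v)) (at 0)" by (auto intro!: derivative_eq_intros)
      from has_derivative_compose[OF this der]
      show ?thesis
        using linear_scale[OF has_derivative_linear[OF der]] by (simp add: has_vector_derivative_def)
    qed
    then have lim: "((\<lambda>h. (F (x + h *\<^sub>R v) - F x - h *\<^sub>R ?D x) /\<^sub>R \<bar>h\<bar>) \<longlongrightarrow> 0) (at 0)"
      by (simp add: has_vector_derivative_def has_derivative_at_within)
    have "((\<lambda>h. (F (x + h *\<^sub>R v) - F x) /\<^sub>R h - ?D x) \<longlongrightarrow> 0) (at 0)"
    proof (rule tendsto_0_le[OF lim, where K=1], rule eventually_at_filter[THEN iffD2], rule eventuallyI, intro impI)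
      fix h :: real assume "h \<noteq> 0"
      then have "(F (x + h *\<^sub>R v) - F x) /\<^sub>R h - ?D x = (F (x + h *\<^sub>R v) - F x - h *\<^sub>R ?D x) /\<^sub>R h"
        by (simp add: scaleR_diff_right)
      then show "norm ((F (x + h *\<^sub>R v) - F x) /\<^sub>R h - ?D x)
          \<le> norm ((F (x + h *\<^sub>R v) - F x - h *\<^sub>R ?D x) /\<^sub>R \<bar>h\<bar>) * 1"
        by simp
    qed
    then have "((\<lambda>h. (F (x + h *\<^sub>R v) - F x) /\<^sub>R h) \<longlongrightarrow> ?D x) (at 0)"
      by (rule LIM_zero_cancel)
    moreover have "filterlim (\<lambda>n. 1 / real (Suc n)) (at 0) sequentially"
      using LIMSEQ_inverse_real_of_nat by (intro filterlim_atI) (auto simp: divide_inverse)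
    ultimately have "(\<lambda>n. (F (x + (1 / real (Suc n)) *\<^sub>R v) - F x) /\<^sub>R (1 / real (Suc n))) \<longlonglongrightarrow> ?D x"
      by (rule filterlim_compose)
    then show ?thesis by (simp add: Q_def)
  qed
  have intF: "integrable lborel F" by (rule integrable_compact_support[OF contF supp])
  have meas: "F \<in> borel_measurable borel" using contF by (rule borel_measurable_continuous_onI)
  have intFt: "integrable lborel (\<lambda>x. F (x + a))" for a
  proof (rule integrable_compact_support[where M="M + norm a"])
    show "F (x + a) = 0" if "M + norm a < norm x" for x
      using that norm_diff_ineq[of x a] by (intro supp) linarith
  qed (auto intro!: continuous_intros continuous_on_compose2[OF contF])
  have "(\<lambda>n. \<integral>x. Q n x \<partial>lborel) \<longlonglongrightarrow> (\<integral>x. ?D x \<partial>lborel)"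
  proof (rule integral_dominated_convergence[where w="\<lambda>x. K * indicator (cball 0 (M + norm v)) x"])
    show "integrable lborel (\<lambda>x. K * indicator (cball 0 (M + norm v)) x :: real)"
      by (intro integrable_mult_right integrable_real_indicator) (use emeasure_bounded_finite[OF bounded_cball] in auto)
    show "?D \<in> borel_measurable lborel" using contD by (simp add: borel_measurable_continuous_onI)
    show "Q n \<in> borel_measurable lborel" for n
      unfolding Q_def using meas by measurable
  qed (use Qbound Qlim in auto)
  moreover have "(\<integral>x. Q n x \<partial>lborel) = 0" for n
    unfolding Q_def using intF intFt by (simp add: integral_lborel_translate[OF meas])
  ultimately show ?thesis using LIMSEQ_unique[OF _ tendsto_const] by simp
qed

lemma frechet_derivative_affine:
  fixes F :: "'a::euclidean_space \<Rightarrow> 'b::real_normed_vector" and L :: "'c::euclidean_space \<Rightarrow> 'a"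
  assumes "bounded_linear L" "F differentiable (at (a + L x))"
  shows "((\<lambda>x. F (a + L x)) has_derivative (\<lambda>v. frechet_derivative F (at (a + L x)) (L v))) (at x)"
    and "frechet_derivative (\<lambda>x. F (a + L x)) (at x) = (\<lambda>v. frechet_derivative F (at (a + L x)) (L v))"
proof -
  have "((\<lambda>x. a + L x) has_derivative L) (at x)"
    using has_derivative_add[OF has_derivative_const bounded_linear_imp_has_derivative[OF assms(1)]] by simp
  from has_derivative_compose[OF this assms(2)[unfolded frechet_derivative_works]]
  show *: "((\<lambda>x. F (a + L x)) has_derivative (\<lambda>v. frechet_derivative F (at (a + L x)) (L v))) (at x)" .
  show "frechet_derivative (\<lambda>x. F (a + L x)) (at x) = (\<lambda>v. frechet_derivative F (at (a + L x)) (L v))"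
    using frechet_derivative_at[OF *] by simp
qed

lemma Ck_on_affine:
  fixes F :: "'a::euclidean_space \<Rightarrow> 'b::real_normed_vector" and L :: "'c::euclidean_space \<Rightarrow> 'a"
  assumes L: "bounded_linear L"
  shows "Ck_on k F UNIV \<Longrightarrow> Ck_on k (\<lambda>x. F (a + L x)) UNIV"
proof (induction k arbitrary: F)
  case 0
  then show ?case
    by (auto intro!: continuous_on_compose2[of UNIV F] continuous_intros bounded_linear.continuous_on[OF L])
next
  case (Suc k)
  show ?case
  proof (rule Ck_on_SucI)
    show "((\<lambda>x. F (a + L x)) has_derivative (\<lambda>v. frechet_derivative F (at (a + L x)) (L v))) (at x)" for x
      using Suc.prems by (intro frechet_derivative_affine(1)[OF L]) auto
    show "Ck_on k (\<lambda>x. frechet_derivative F (at (a + L x)) (L v)) UNIV" for v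
      using Suc.prems by (intro Suc.IH) auto
  qed auto
qed

text \<open>
  The operator \<open>(\<partial>/\<partial>x + \<i> \<partial>/\<partial>y) / 2\<close> of one variable.
\<close>

definition dbar1 :: "(complex \<Rightarrow> complex) \<Rightarrow> complex \<Rightarrow> complex" where
  "dbar1 F u = (frechet_derivative F (at u) 1 + \<i> * frechet_derivative F (at u) \<i>) / 2"

lemma dbar1_mult:
  assumes "F differentiable (at u)" "G differentiable (at u)"
  shows "dbar1 (\<lambda>u. F u * G u) u = dbar1 F u * G u + F u * dbar1 G u"
proof -
  have "((\<lambda>u. F u * G u) has_derivative (\<lambda>v. F u * frechet_derivative G (at u) v + frechet_derivative F (at u) v * G u)) (at u)"
    using assms by (intro has_derivative_mult) (simp_all add: frechet_derivative_works)
  from frechet_derivative_at[OF this, symmetric] show ?thesis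
    by (simp add: dbar1_def field_simps)
qed

lemma dbar1_continuous: "Ck_on 1 F UNIV \<Longrightarrow> continuous_on UNIV (dbar1 F)"
  unfolding dbar1_def[abs_def] by (auto intro!: continuous_intros)

lemma frechet_derivative_outside_support:
  fixes F :: "'a::euclidean_space \<Rightarrow> 'b::real_normed_vector"
  assumes "\<And>x. M < norm x \<Longrightarrow> F x = 0" "M < norm x"
  shows "frechet_derivative F (at x) = (\<lambda>v. 0)"
proof -
  have "open {x::'a. M < norm x}" by (intro open_Collect_less continuous_intros)
  from frechet_derivative_cong(2)[OF this, of x "\<lambda>x. 0" F] show ?thesis
    using assms by (simp add: frechet_derivative_const)
qed

lemma integral_dbar1_zero:
  assumes F: "Ck_on 1 F UNIV" and supp: "\<And>x. M < norm x \<Longrightarrow> F x = 0"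
  shows "(\<integral>u. dbar1 F u \<partial>lborel) = 0"
proof -
  have "integrable lborel (\<lambda>u. frechet_derivative F (at u) v)" for v
    using F frechet_derivative_outside_support[of M F, OF supp]
    by (intro integrable_compact_support[where M=M]) auto
  then show ?thesis
    using integral_derivative_zero[OF F supp] by (simp add: dbar1_def)
qed

definition radial_step :: "real \<Rightarrow> real \<Rightarrow> complex \<Rightarrow> complex" where
  "radial_step a b u = complex_of_real (smooth_step ((norm u)\<^sup>2 / a - b))"

lemma radial_step_deriv:
  assumes "a \<noteq> 0"
  shows "(radial_step a b has_derivative (\<lambda>v. of_real (smooth_step1 ((norm u)\<^sup>2 / a - b) * (2 * (u \<bullet> v) / a)))) (at u)"
proof -
  have "((\<lambda>u. (u \<bullet> u) / a - b) has_derivative (\<lambda>v. 2 * (u \<bullet> v) / a)) (at u)"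
    using assms by (auto intro!: derivative_eq_intros simp: inner_commute)
  from has_derivative_compose[OF this smooth_step_deriv[unfolded has_field_derivative_def]]
  have "((\<lambda>u. smooth_step ((u \<bullet> u) / a - b)) has_derivative (\<lambda>v. smooth_step1 ((u \<bullet> u) / a - b) * (2 * (u \<bullet> v) / a))) (at u)" .
  then show ?thesis
    unfolding radial_step_def[abs_def] dot_square_norm by (rule has_derivative_of_real)
qed

lemma radial_step_C1: "a \<noteq> 0 \<Longrightarrow> Ck_on 1 (radial_step a b) UNIV"
  unfolding One_nat_def
  by (rule Ck_on_SucI[OF _ radial_step_deriv])
     (auto intro!: continuous_intros continuous_on_compose2[OF smooth_step1_continuous[of UNIV]])

text \<open>
  The chain rule, because the \<open>cnj u\<close>-derivative of \<open>\<bar>u\<bar>\<^sup>2 = u * cnj u\<close> is \<open>u\<close>.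
\<close>

lemma radial_step_dbar1:
  assumes "a \<noteq> 0"
  shows "dbar1 (radial_step a b) u = of_real (smooth_step1 ((norm u)\<^sup>2 / a - b) / a) * u"
proof -
  have "of_real (t / a) * u = (of_real (t * (2 * (u \<bullet> 1) / a)) + \<i> * of_real (t * (2 * (u \<bullet> \<i>) / a))) / 2" for t
    using assms by (simp add: complex_eq_iff inner_complex_def field_simps)
  then show ?thesis
    unfolding dbar1_def frechet_derivative_at[OF radial_step_deriv[OF assms], symmetric] by simp
qed

lemma radial_step_norm_le: "cmod (radial_step a b u) \<le> 1"
  using smooth_step_bounds[of "(norm u)\<^sup>2 / a - b"] by (simp add: radial_step_def)

text \<open>
  A cut-off function that is \<open>1\<close> for \<open>\<bar>u\<bar> \<le> 2 R\<close> and \<open>0\<close> for \<open>\<bar>u\<bar> \<ge> 3 R\<close>; the step runs over \<open>4 R\<^sup>2 \<le> \<bar>u\<bar>\<^sup>2 \<le> 7 R\<^sup>2\<close>.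
\<close>

definition chi :: "real \<Rightarrow> complex \<Rightarrow> complex" where "chi R u = 1 - radial_step (R\<^sup>2) 4 u"

definition dbar_chi :: "real \<Rightarrow> complex \<Rightarrow> complex" where
  "dbar_chi R u = - of_real (smooth_step1 ((norm u)\<^sup>2 / R\<^sup>2 - 4) / R\<^sup>2) * u"

lemma chi_props:
  assumes "0 < R"
  shows "Ck_on 1 (chi R) UNIV" "dbar1 (chi R) u = dbar_chi R u" "cmod (chi R u) \<le> 1"
    "norm u \<le> 2 * R \<Longrightarrow> chi R u = 1" "3 * R \<le> norm u \<Longrightarrow> chi R u = 0"
    "norm u \<le> 2 * R \<Longrightarrow> dbar_chi R u = 0" "3 * R \<le> norm u \<Longrightarrow> dbar_chi R u = 0" "continuous_on UNIV (dbar_chi R)"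
proof -
  have R: "R\<^sup>2 \<noteq> 0" using assms by simp
  have chi: "chi R = (\<lambda>u. 1 + (-1) * radial_step (R\<^sup>2) 4 u)" by (auto simp: chi_def)
  show "Ck_on 1 (chi R) UNIV"
    unfolding chi by (intro Ck_on_add Ck_on_mult Ck_on_const radial_step_C1 R open_UNIV)
  show dc: "dbar1 (chi R) u = dbar_chi R u" for u
  proof -
    have "(chi R has_derivative (\<lambda>v. - of_real (smooth_step1 ((norm u)\<^sup>2 / R\<^sup>2 - 4) * (2 * (u \<bullet> v) / R\<^sup>2)))) (at u)"
      unfolding chi_def[abs_def] using has_derivative_diff[OF has_derivative_const radial_step_deriv[OF R]] by simp
    from frechet_derivative_at[OF this, symmetric]
    have "dbar1 (chi R) u = - dbar1 (radial_step (R\<^sup>2) 4) u"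
      unfolding dbar1_def frechet_derivative_at[OF radial_step_deriv[OF R], symmetric] by (simp add: field_simps)
    then show ?thesis by (simp add: radial_step_dbar1[OF R] dbar_chi_def)
  qed
  show "cmod (chi R u) \<le> 1"
    using smooth_step_bounds[of "(norm u)\<^sup>2 / R\<^sup>2 - 4"] unfolding chi_def radial_step_def
    by (metis abs_of_nonneg diff_ge_0_iff_ge diff_le_eq le_add_same_cancel1 norm_of_real of_real_1 of_real_diff)
  have lo: "(norm u)\<^sup>2 / R\<^sup>2 - 4 \<le> 0" if "norm u \<le> 2 * R"
    using power_mono[OF that, of 2] assms by (simp add: divide_le_eq power_mult_distrib)
  have hi: "3 \<le> (norm u)\<^sup>2 / R\<^sup>2 - 4" if "3 * R \<le> norm u"
  proof -
    have "(3 * R)\<^sup>2 \<le> (norm u)\<^sup>2" using that assms by (intro power_mono) auto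
    moreover have "7 * R\<^sup>2 \<le> (3 * R)\<^sup>2" by (simp add: power_mult_distrib)
    ultimately have "7 * R\<^sup>2 \<le> (norm u)\<^sup>2" by linarith
    then have "7 \<le> (norm u)\<^sup>2 / R\<^sup>2" using R assms by (simp add: le_divide_eq)
    then show ?thesis by simp
  qed
  show "norm u \<le> 2 * R \<Longrightarrow> chi R u = 1" "norm u \<le> 2 * R \<Longrightarrow> dbar_chi R u = 0"
    using lo by (auto simp: chi_def radial_step_def dbar_chi_def smooth_step_eq_0 smooth_step1_eq_0)
  show "3 * R \<le> norm u \<Longrightarrow> chi R u = 0" "3 * R \<le> norm u \<Longrightarrow> dbar_chi R u = 0"
    using hi by (auto simp: chi_def radial_step_def dbar_chi_def smooth_step_eq_1 smooth_step1_eq_0)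
  show "continuous_on UNIV (dbar_chi R)"
    unfolding dbar_chi_def[abs_def] by (intro continuous_intros continuous_on_compose2[OF smooth_step1_continuous[of UNIV]]) (use R in auto)
qed

text \<open>
  The function \<open>1 / w\<close>, switched off smoothly for \<open>\<bar>w\<bar> \<le> e\<close>. Its \<open>cnj w\<close>-derivative is the nonnegative
  bump \<open>approx_delta e\<close>, supported in \<open>e \<le> \<bar>w\<bar> \<le> 2 e\<close>.
\<close>

definition trunc_inv :: "real \<Rightarrow> complex \<Rightarrow> complex" where "trunc_inv e w = radial_step (e\<^sup>2) 1 w / w"

definition approx_delta :: "real \<Rightarrow> complex \<Rightarrow> real" where "approx_delta e w = smooth_step1 ((norm w)\<^sup>2 / e\<^sup>2 - 1) / e\<^sup>2"

lemma trunc_inv_props: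
  assumes "0 < e"
  shows "Ck_on 1 (trunc_inv e) UNIV" "dbar1 (trunc_inv e) w = of_real (approx_delta e w)" "cmod (trunc_inv e w) \<le> 1 / norm w"
    "2 * e \<le> norm w \<Longrightarrow> trunc_inv e w = 1 / w" "2 * e \<le> norm w \<Longrightarrow> approx_delta e w = 0" "0 \<le> approx_delta e w"
    "continuous_on UNIV (approx_delta e)"
proof -
  have e: "e\<^sup>2 \<noteq> 0" using assms by simp
  have lo: "(norm w)\<^sup>2 / e\<^sup>2 - 1 \<le> 0" if "norm w \<le> e" for w :: complex
    using power_mono[OF that, of 2] assms by (simp add: divide_le_eq)
  have hi: "3 \<le> (norm w)\<^sup>2 / e\<^sup>2 - 1" if "2 * e \<le> norm w" for w :: complex
  proof -
    have "(2 * e)\<^sup>2 \<le> (norm w)\<^sup>2" using that assms by (intro power_mono) auto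
    then have "4 \<le> (norm w)\<^sup>2 / e\<^sup>2" using e assms by (simp add: le_divide_eq power_mult_distrib)
    then show ?thesis by simp
  qed
  have zero: "trunc_inv e w = 0" if "w \<in> ball 0 e" for w using lo[of w] that by (simp add: trunc_inv_def radial_step_def smooth_step_eq_0)
  have inv: "((\<lambda>w. 1 / w) has_derivative (\<lambda>v. - 1 / w\<^sup>2 * v)) (at w)" if "w \<noteq> 0" for w :: complex
    using that by (auto intro!: derivative_eq_intros simp: power2_eq_square field_simps)
  have C0: "Ck_on 1 (trunc_inv e) (ball 0 e)"
    using Ck_on_cong[OF open_ball zero[symmetric] Ck_on_const] .
  have Cinv: "Ck_on 1 (\<lambda>w::complex. 1 / w) (- {0})"
    unfolding One_nat_def by (rule Ck_on_SucI[OF _ inv]) (auto intro!: continuous_intros)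
  have C1: "Ck_on 1 (trunc_inv e) (- {0})"
  proof -
    have "Ck_on 1 (\<lambda>w. radial_step (e\<^sup>2) 1 w * (1 / w)) (- {0})"
      by (intro Ck_on_mult Cinv Ck_on_subset[OF radial_step_C1[OF e]]) auto
    then show ?thesis by (simp add: trunc_inv_def[abs_def])
  qed
  show "Ck_on 1 (trunc_inv e) UNIV"
  proof (rule Ck_on_Union)
    fix w :: complex
    show "\<exists>T. open T \<and> w \<in> T \<and> Ck_on 1 (trunc_inv e) T"
    proof (cases "w = 0")
      case True
      then show ?thesis using C0 assms by (intro exI[of _ "ball 0 e"]) simp
    next
      case False
      then show ?thesis using C1 open_Compl[OF closed_singleton, of 0] by (intro exI[of _ "- {0}"]) simp
    qed
  qed
  show "dbar1 (trunc_inv e) w = of_real (approx_delta e w)"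
  proof (cases "w = 0")
    case True
    have "frechet_derivative (trunc_inv e) (at w) = (\<lambda>v. 0)"
      using frechet_derivative_cong(2)[OF open_ball, of w 0 e "\<lambda>w. 0" "trunc_inv e"] zero assms True
      by (simp add: frechet_derivative_const)
    then show ?thesis using lo[of w] assms True by (simp add: dbar1_def approx_delta_def smooth_step1_eq_0)
  next
    case False
    have "dbar1 (\<lambda>w. 1 / w) w = 0"
      unfolding dbar1_def frechet_derivative_at[OF inv[OF False], symmetric] by (simp add: field_simps)
    moreover have "(radial_step (e\<^sup>2) 1) differentiable (at w)" "(\<lambda>w. 1 / w) differentiable (at w)"
      using radial_step_deriv[OF e] inv[OF False] by (auto simp: differentiable_def)
    ultimately have "dbar1 (\<lambda>w. radial_step (e\<^sup>2) 1 w * (1 / w)) w = dbar1 (radial_step (e\<^sup>2) 1) w * (1 / w)"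
      by (simp only: dbar1_mult) simp
    then show ?thesis using False by (simp add: trunc_inv_def[abs_def] radial_step_dbar1[OF e] approx_delta_def)
  qed
  show "cmod (trunc_inv e w) \<le> 1 / norm w"
    using radial_step_norm_le by (simp add: trunc_inv_def norm_divide divide_right_mono)
  show "2 * e \<le> norm w \<Longrightarrow> trunc_inv e w = 1 / w" "2 * e \<le> norm w \<Longrightarrow> approx_delta e w = 0"
    using hi by (auto simp: trunc_inv_def radial_step_def approx_delta_def smooth_step_eq_1 smooth_step1_eq_0)
  show "0 \<le> approx_delta e w" by (simp add: approx_delta_def smooth_step1_nonneg)
  show "continuous_on UNIV (approx_delta e)"
    unfolding approx_delta_def[abs_def] by (intro continuous_intros continuous_on_compose2[OF smooth_step1_continuous[of UNIV]]) (use e in auto)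
qed

lemma dbar1_translate:
  assumes "F differentiable (at (u - z))"
  shows "dbar1 (\<lambda>u. F (u - z)) u = dbar1 F (u - z)"
  using frechet_derivative_affine(2)[OF bounded_linear_ident, of F "- z" u] assms
  by (simp add: dbar1_def)

text \<open>
  The \<open>cnj u\<close>-derivative of the compactly supported function \<open>g u * chi R u * trunc_inv e (u - z)\<close> has
  integral zero. Of the three terms of the product rule, the second is supported where \<open>trunc_inv\<close>
  is the full Cauchy kernel, and the third where \<open>chi\<close> equals \<open>1\<close>.
\<close>

lemma Cauchy_Pompeiu_identity:
  assumes R: "0 < R" and e: "0 < e" "2 * e < R" and z: "norm z < R" and g: "Ck_on 1 g UNIV"
  shows "(\<integral>u. dbar1 g u * chi R u * trunc_inv e (u - z) \<partial>lborel) + (\<integral>u. g u * dbar_chi R u / (u - z) \<partial>lborel)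
     + (\<integral>u. g u * of_real (approx_delta e (u - z)) \<partial>lborel) = 0"
    and "integrable lborel (\<lambda>u. dbar1 g u * chi R u * trunc_inv e (u - z))"
    and "integrable lborel (\<lambda>u. g u * dbar_chi R u / (u - z))"
    and "integrable lborel (\<lambda>u. g u * of_real (approx_delta e (u - z)))"
proof -
  note chi = chi_props[OF R] and trunc_inv = trunc_inv_props[OF e(1)]
  define F where "F = (\<lambda>u. g u * chi R u * trunc_inv e (u - z))"
  have psiz: "Ck_on 1 (\<lambda>u. trunc_inv e (u - z)) UNIV"
    using Ck_on_affine[OF bounded_linear_ident trunc_inv(1), of "- z"] by simp
  have F: "Ck_on 1 F UNIV"
    unfolding F_def by (intro Ck_on_mult g chi(1) psiz open_UNIV)
  have cont: "continuous_on UNIV f" if "Ck_on 1 f UNIV" for f :: "complex \<Rightarrow> complex"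
    using Ck_on_Suc_D[of 0 f UNIV] that by simp
  have far: "2 * e \<le> norm (u - z)" if "dbar_chi R u \<noteq> 0" for u
    using chi(6)[of u] that z e norm_triangle_ineq2[of u z] by force
  have near: "chi R u = 1" if "approx_delta e (u - z) \<noteq> 0" for u
    using trunc_inv(5)[of "u - z"] chi(4)[of u] that z e norm_triangle_sub[of u z] by force
  have d: "f differentiable (at u)" if "Ck_on 1 f UNIV" for f :: "complex \<Rightarrow> complex" and u
    using that by simp
  have eq2: "g u * dbar_chi R u * trunc_inv e (u - z) = g u * dbar_chi R u / (u - z)" for u
    using far[of u] trunc_inv(4)[of "u - z"] by (cases "dbar_chi R u = 0") auto
  have eq3: "g u * chi R u * of_real (approx_delta e (u - z)) = g u * of_real (approx_delta e (u - z))" for u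
    using near[of u] by (cases "approx_delta e (u - z) = 0") auto
  have "dbar1 F u = dbar1 (\<lambda>u. g u * chi R u) u * trunc_inv e (u - z) + g u * chi R u * dbar1 (\<lambda>u. trunc_inv e (u - z)) u" for u
    unfolding F_def by (intro dbar1_mult d psiz Ck_on_mult g chi(1) open_UNIV)
  moreover have "dbar1 (\<lambda>u. g u * chi R u) u = dbar1 g u * chi R u + g u * dbar_chi R u" for u
    unfolding chi(2)[symmetric] by (intro dbar1_mult d g chi(1))
  moreover have "dbar1 (\<lambda>u. trunc_inv e (u - z)) u = of_real (approx_delta e (u - z))" for u
    unfolding trunc_inv(2)[symmetric] by (intro dbar1_translate d trunc_inv(1))
  ultimately have dF: "dbar1 F u = dbar1 g u * chi R u * trunc_inv e (u - z) + g u * dbar_chi R u / (u - z)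
      + g u * of_real (approx_delta e (u - z))" for u
    using eq2[of u] eq3[of u] by (simp add: algebra_simps)
  note conts = cont[OF g] cont[OF chi(1)] cont[OF psiz] dbar1_continuous[OF g] chi(8)
  have contp: "continuous_on UNIV (\<lambda>u. of_real (approx_delta e (u - z)) :: complex)"
    by (intro continuous_intros continuous_on_compose2[OF trunc_inv(7)]) auto
  show 1: "integrable lborel (\<lambda>u. dbar1 g u * chi R u * trunc_inv e (u - z))"
  proof (rule integrable_compact_support[where M="3 * R"])
    show "continuous_on UNIV (\<lambda>u. dbar1 g u * chi R u * trunc_inv e (u - z))"
      by (intro continuous_on_mult conts)
  qed (simp add: chi(5))
  show 2: "integrable lborel (\<lambda>u. g u * dbar_chi R u / (u - z))"
    unfolding eq2[symmetric]
  proof (rule integrable_compact_support[where M="3 * R"])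
    show "continuous_on UNIV (\<lambda>u. g u * dbar_chi R u * trunc_inv e (u - z))"
      by (intro continuous_on_mult conts)
  qed (simp add: chi(7))
  show 3: "integrable lborel (\<lambda>u. g u * of_real (approx_delta e (u - z)))"
    unfolding eq3[symmetric]
  proof (rule integrable_compact_support[where M="3 * R"])
    show "continuous_on UNIV (\<lambda>u. g u * chi R u * of_real (approx_delta e (u - z)))"
      by (intro continuous_on_mult conts contp)
  qed (simp add: chi(5))
  have "(\<integral>u. dbar1 F u \<partial>lborel) = 0"
    by (rule integral_dbar1_zero[OF F, of "3 * R"]) (simp add: F_def chi(5))
  then show "(\<integral>u. dbar1 g u * chi R u * trunc_inv e (u - z) \<partial>lborel) + (\<integral>u. g u * dbar_chi R u / (u - z) \<partial>lborel)
     + (\<integral>u. g u * of_real (approx_delta e (u - z)) \<partial>lborel) = 0"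
    unfolding dF using 1 2 3 by simp
qed

text \<open>
  The identity for the constant function shows that the mass of the bump does not depend on its
  width; this replaces the computation of the constant \<open>\<pi>\<close> of the Cauchy--Pompeiu formula.
\<close>

lemma approx_delta_mass:
  assumes R: "0 < R"
  obtains C where "0 < C" "\<And>e z. 0 < e \<Longrightarrow> 2 * e < R \<Longrightarrow> norm z < R \<Longrightarrow> (\<integral>u. approx_delta e (u - z) \<partial>lborel) = C"
proof -
  define C where "C = (\<integral>u. approx_delta (R/4) u \<partial>lborel)"
  have one: "dbar1 (\<lambda>u. 1) u = 0" for u
    by (simp add: dbar1_def frechet_derivative_const)
  have mass: "complex_of_real (\<integral>u. approx_delta e (u - z) \<partial>lborel) = - (\<integral>u. dbar_chi R u / (u - z) \<partial>lborel)"
    if "0 < e" "2 * e < R" "norm z < R" for e z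
    using Cauchy_Pompeiu_identity(1)[OF R that Ck_on_const[of 1 1 UNIV]]
    by (simp add: one add_eq_0_iff)
  have transl: "(\<integral>u. approx_delta e (u - z) \<partial>lborel) = (\<integral>u. approx_delta e u \<partial>lborel)" if "0 < e" for e z
    using integral_lborel_translate[of "approx_delta e" "- z"] trunc_inv_props(7)[OF that] by (simp add: borel_measurable_continuous_onI)
  have "(\<integral>u. approx_delta e (u - z) \<partial>lborel) = C" if "0 < e" "2 * e < R" "norm z < R" for e z
  proof -
    have "complex_of_real (\<integral>u. approx_delta e (u - 0) \<partial>lborel) = complex_of_real C"
      unfolding C_def using mass[of e 0] mass[of "R/4" 0] that R by simp
    then show ?thesis using transl[of e z] that by simp
  qed
  moreover have "0 < C"
  proof -
    define S where "S = {u :: complex. 2 < (norm u)\<^sup>2 / (R/4)\<^sup>2 \<and> (norm u)\<^sup>2 / (R/4)\<^sup>2 < 3}"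
    have "open S"
      unfolding S_def by (intro open_Collect_conj open_Collect_less continuous_intros) (use R in auto)
    \<comment> \<open>The value \<open>5/2\<close> of \<open>\<bar>u\<bar>\<^sup>2 / e\<^sup>2\<close> is chosen where \<open>smooth_step1\<close>, shifted by \<open>1\<close>, exceeds \<open>1/2\<close>.\<close>
    moreover define u1 where "u1 = complex_of_real (sqrt (5/2) * (R / 4))"
    have "(norm u1)\<^sup>2 / (R/4)\<^sup>2 = 5/2"
      unfolding u1_def norm_of_real power2_abs power_mult_distrib using R by simp
    then have "u1 \<in> S" unfolding S_def mem_Collect_eq by linarith
    ultimately obtain d u0 where d: "0 < d" "ball u0 d \<subseteq> S" by (meson openE)
    define m where "m = 1 / 2 / (R/4)\<^sup>2"
    have "0 < m" using R by (simp add: m_def)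
    have "0 < m * measure lborel (ball u0 d)"
      using \<open>0 < m\<close> content_ball_pos[OF d(1), of u0] by simp
    also have "\<dots> = (\<integral>u. m * indicator (ball u0 d) u \<partial>lborel)"
      by simp
    also have "\<dots> \<le> C"
      unfolding C_def
    proof (rule integral_mono)
      show "integrable lborel (\<lambda>u. m * indicator (ball u0 d) u :: real)"
        by (intro integrable_mult_right integrable_real_indicator) (use emeasure_bounded_finite[OF bounded_ball] in auto)
      show "integrable lborel (approx_delta (R/4))"
        using R by (intro integrable_compact_support[where M="2 * (R/4)"] trunc_inv_props(5,7)) auto
      fix u
      show "m * indicator (ball u0 d) u \<le> approx_delta (R/4) u"
      proof (cases "u \<in> ball u0 d")
        case True
        then have "u \<in> S" using d by blast
        then have "1 / 2 \<le> smooth_step1 ((norm u)\<^sup>2 / (R/4)\<^sup>2 - 1)"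
          unfolding S_def by (intro smooth_step1_middle) auto
        then have "m \<le> approx_delta (R/4) u" unfolding m_def approx_delta_def by (rule divide_right_mono) simp
        then show ?thesis using True by simp
      next
        case False
        then have "m * indicator (ball u0 d) u = 0" by simp
        also have "0 \<le> approx_delta (R/4) u" using R by (intro trunc_inv_props(6)) simp
        finally show ?thesis .
      qed
    qed
    finally show ?thesis .
  qed
  ultimately show thesis using that by blast
qed

text \<open>
  The bump shrinks to the point \<open>z\<close>, and \<open>\<bar>trunc_inv\<bar> \<le> 1 / \<bar>w\<bar>\<close> bounds the first term of the
  identity uniformly in the width.
\<close>

lemma Cauchy_Pompeiu_estimate:
  assumes R: "0 < R"
  shows "\<exists>C>0. \<forall>g z. Ck_on 1 g UNIV \<longrightarrow> norm z < R \<longrightarrow>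
       ennreal (cmod (of_real C * g z + (\<integral>u. g u * dbar_chi R u / (u - z) \<partial>lborel)))
        \<le> (\<integral>\<^sup>+u. ennreal (cmod (dbar1 g u * chi R u) / norm (u - z)) \<partial>lborel)"
proof -
  obtain C where C: "0 < C"
    and mass: "\<And>e z. 0 < e \<Longrightarrow> 2 * e < R \<Longrightarrow> norm z < R \<Longrightarrow> (\<integral>u. approx_delta e (u - z) \<partial>lborel) = C"
    using approx_delta_mass[OF R] by blast
  show ?thesis
  proof (intro exI[of _ C] conjI allI impI C)
    fix g :: "complex \<Rightarrow> complex" and z :: complex assume g: "Ck_on 1 g UNIV" and z: "norm z < R"
    let ?J = "\<integral>u. g u * dbar_chi R u / (u - z) \<partial>lborel"
    let ?B = "\<integral>\<^sup>+u. ennreal (cmod (dbar1 g u * chi R u) / norm (u - z)) \<partial>lborel"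
    have contg: "continuous_on UNIV g"
      using Ck_on_Suc_D[of 0 g UNIV] g by simp
    have main: "ennreal (cmod (of_real C * g z + ?J)) \<le> ?B + ennreal (C * d)" if d: "0 < d" for d
    proof -
      obtain r where r: "0 < r" "\<And>u. dist u z < r \<Longrightarrow> dist (g u) (g z) < d"
        using contg d by (metis UNIV_I continuous_on_iff)
      define e where "e = min r R / 4"
      have e: "0 < e" "2 * e < R" "2 * e < r" using r(1) R by (auto simp: e_def)
      note id = Cauchy_Pompeiu_identity[OF R e(1,2) z g]
      note trunc_inv = trunc_inv_props[OF e(1)]
      let ?p = "\<lambda>u. complex_of_real (approx_delta e (u - z))"
      have contp: "continuous_on UNIV (\<lambda>u. approx_delta e (u - z))"
        by (intro continuous_on_compose2[OF trunc_inv(7)] continuous_intros) auto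
      have intp: "integrable lborel (\<lambda>u. approx_delta e (u - z))"
      proof (rule integrable_compact_support[OF contp, of "norm z + 2 * e"])
        fix u :: complex assume "norm z + 2 * e < norm u"
        then have "2 * e \<le> norm (u - z)" using norm_triangle_ineq2[of u z] by linarith
        then show "approx_delta e (u - z) = 0" by (rule trunc_inv(5))
      qed
      have "of_real C * g z = (\<integral>u. g z * ?p u \<partial>lborel)"
        using mass[OF e(1,2) z] by (simp add: mult.commute)
      then have "of_real C * g z + ?J
        = - (\<integral>u. dbar1 g u * chi R u * trunc_inv e (u - z) \<partial>lborel) - (\<integral>u. (g u - g z) * ?p u \<partial>lborel)"
        using id intp by (simp add: left_diff_distrib algebra_simps eq_neg_iff_add_eq_0)
      then have "cmod (of_real C * g z + ?J)
        \<le> cmod (- (\<integral>u. dbar1 g u * chi R u * trunc_inv e (u - z) \<partial>lborel)) + cmod (\<integral>u. (g u - g z) * ?p u \<partial>lborel)"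
        by (simp only:) (rule norm_triangle_ineq4)
      moreover have "cmod (\<integral>u. (g u - g z) * ?p u \<partial>lborel) \<le> (\<integral>u. d * approx_delta e (u - z) \<partial>lborel)"
      proof (rule order_trans[OF integral_norm_bound integral_mono])
        show "integrable lborel (\<lambda>u. cmod ((g u - g z) * ?p u))"
          using id(4) intp by (intro integrable_norm) (simp add: left_diff_distrib)
        show "cmod ((g u - g z) * ?p u) \<le> d * approx_delta e (u - z)" for u
        proof (cases "2 * e \<le> norm (u - z)")
          case False
          then have "cmod (g u - g z) \<le> d" using r(2)[of u] e by (simp add: dist_norm)
          then show ?thesis using trunc_inv(6)[of "u - z"] by (simp add: norm_mult mult_right_mono)
        qed (simp add: trunc_inv(5))
      qed (use intp in simp)
      moreover have "(\<integral>u. d * approx_delta e (u - z) \<partial>lborel) = C * d"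
        using mass[OF e(1,2) z] by simp
      ultimately have "cmod (of_real C * g z + ?J) \<le> cmod (\<integral>u. dbar1 g u * chi R u * trunc_inv e (u - z) \<partial>lborel) + C * d"
        unfolding norm_minus_cancel by linarith
      then have "ennreal (cmod (of_real C * g z + ?J))
         \<le> ennreal (cmod (\<integral>u. dbar1 g u * chi R u * trunc_inv e (u - z) \<partial>lborel)) + ennreal (C * d)"
        using C d by (simp add: ennreal_plus[symmetric] del: ennreal_plus)
      also have "ennreal (cmod (\<integral>u. dbar1 g u * chi R u * trunc_inv e (u - z) \<partial>lborel))
         \<le> (\<integral>\<^sup>+u. ennreal (cmod (dbar1 g u * chi R u * trunc_inv e (u - z))) \<partial>lborel)"
        by (rule integral_norm_bound_ennreal[OF id(2)])
      also have "\<dots> \<le> ?B"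
      proof (intro nn_integral_mono ennreal_leI)
        fix u :: complex
        show "cmod (dbar1 g u * chi R u * trunc_inv e (u - z)) \<le> cmod (dbar1 g u * chi R u) / norm (u - z)"
          using mult_left_mono[OF trunc_inv(3)[of "u - z"], of "cmod (dbar1 g u * chi R u)"] by (simp add: norm_mult)
      qed
      finally show ?thesis by (simp add: add_right_mono)
    qed
    show "ennreal (cmod (of_real C * g z + ?J)) \<le> ?B"
    proof (rule ennreal_le_epsilon)
      fix x :: real assume "0 < x"
      then have "0 < x / C" using C by simp
      from main[OF this] have "ennreal (cmod (of_real C * g z + ?J)) \<le> ?B + ennreal (C * (x / C))" .
      moreover have "C * (x / C) = x" using C by simp
      ultimately show "ennreal (cmod (of_real C * g z + ?J)) \<le> ?B + ennreal x"
        by (simp only:)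
    qed
  qed
qed

section \<open>Young's inequality for the Cauchy kernel\<close>

text \<open>
  Integrating the elementary inequality \<open>x \<le> l + l\<^bsup>1 - q\<^esup> x\<^sup>q\<close> against \<open>k\<close> and choosing for \<open>l\<close> the \<open>q\<close>-th
  root of the mean of \<open>G\<^sup>q\<close> yields Jensen's inequality up to the factor \<open>2\<^sup>q\<close>, for functions that may
  take the value \<open>\<infinity>\<close>.
\<close>

lemma jensen_ennreal:
  assumes q: "1 \<le> q" and G[measurable]: "G \<in> borel_measurable M" and k[measurable]: "k \<in> borel_measurable M"
    and mass: "(\<integral>\<^sup>+x. k x \<partial>M) = ennreal K" "0 < K"
  shows "epowr (\<integral>\<^sup>+x. G x * k x \<partial>M) q \<le> ennreal (2 powr q * K powr (q - 1)) * (\<integral>\<^sup>+x. epowr (G x) q * k x \<partial>M)"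
proof -
  note [measurable] = measurable_compose[OF G epowr_measurable]
  let ?A = "\<integral>\<^sup>+x. G x * k x \<partial>M" and ?B = "\<integral>\<^sup>+x. epowr (G x) q * k x \<partial>M"
  have split: "x \<le> ennreal l + ennreal (l powr (1 - q)) * epowr x q" if "0 < l" for l x
  proof (cases x)
    case (real r)
    show ?thesis
    proof (cases "r \<le> l")
      case True
      then have "x \<le> ennreal l" using real by (simp add: ennreal_leI)
      then show ?thesis by (rule order_trans) simp
    next
      case False
      have "r = r powr (1 - q) * r powr q" using False that by (simp add: powr_add[symmetric])
      also have "\<dots> \<le> l powr (1 - q) * r powr q"
        using False that q by (intro mult_right_mono powr_mono2') auto
      finally have "x \<le> ennreal (l powr (1 - q) * r powr q)" using real by (simp add: ennreal_leI)
      also have "\<dots> = ennreal (l powr (1 - q)) * epowr x q"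
        using real by (simp add: ennreal_mult epowr_ennreal)
      finally show ?thesis by (rule order_trans) simp
    qed
  next
    case top
    then show ?thesis using that by (simp add: ennreal_mult_top)
  qed
  have main: "?A \<le> ennreal (l * K) + ennreal (l powr (1 - q)) * ?B" if l: "0 < l" for l
  proof -
    have "?A \<le> (\<integral>\<^sup>+x. ennreal l * k x + ennreal (l powr (1 - q)) * (epowr (G x) q * k x) \<partial>M)"
    proof (rule nn_integral_mono)
      fix x
      have "G x * k x \<le> (ennreal l + ennreal (l powr (1 - q)) * epowr (G x) q) * k x"
        by (rule mult_right_mono[OF split[OF l]]) simp
      then show "G x * k x \<le> ennreal l * k x + ennreal (l powr (1 - q)) * (epowr (G x) q * k x)"
        by (simp add: distrib_right mult.assoc)
    qed
    also have "\<dots> = ennreal l * (\<integral>\<^sup>+x. k x \<partial>M) + ennreal (l powr (1 - q)) * ?B"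
      by (simp add: nn_integral_add nn_integral_cmult)
    also have "ennreal l * (\<integral>\<^sup>+x. k x \<partial>M) = ennreal (l * K)"
      using mass l by (simp add: ennreal_mult)
    finally show ?thesis .
  qed
  show ?thesis
  proof (cases ?B)
    case top
    then show ?thesis using mass(2) by (simp add: ennreal_mult_top)
  next
    case (real b)
    show ?thesis
    proof (cases "b = 0")
      case True
      have "?A \<le> 0"
      proof (rule ennreal_le_epsilon)
        fix e :: real assume e: "0 < e"
        then have "0 < e / K" "e / K * K = e" using mass(2) by auto
        then show "?A \<le> 0 + ennreal e" using main[of "e / K"] True real by simp
      qed
      then show ?thesis by simp
    next
      case False
      \<comment> \<open>With this choice both terms on the right are equal.\<close>
      define l where "l = (b / K) powr (1 / q)"
      have b: "0 < b" using False real by simp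
      then have l: "0 < l" using mass(2) by (simp add: l_def)
      have lq: "l powr q = b / K" using b mass(2) q by (simp add: l_def powr_powr)
      have "l powr (1 - q) * b = l * K"
      proof -
        have "l powr (1 - q) = l / l powr q" using l by (simp add: powr_diff)
        then show ?thesis using lq b mass(2) by (simp add: field_simps)
      qed
      then have "?A \<le> ennreal (l * K) + ennreal (l * K)"
        using main[OF l] real by (simp add: ennreal_mult[symmetric])
      then have "?A \<le> ennreal (2 * (l * K))"
        using l mass(2) by (simp add: ennreal_plus[symmetric] mult.commute del: ennreal_plus)
      then have "epowr ?A q \<le> epowr (ennreal (2 * (l * K))) q" using q by (intro epowr_mono) auto
      also have "\<dots> = ennreal (2 powr q * (l powr q * K powr q))"
        using l mass(2) by (simp add: epowr_ennreal powr_mult)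
      also have "l powr q * K powr q = K powr (q - 1) * b"
        using lq mass(2) by (simp add: powr_diff)
      also have "ennreal (2 powr q * (K powr (q - 1) * b)) = ennreal (2 powr q * K powr (q - 1)) * ?B"
        using real by (simp add: ennreal_mult[symmetric] mult.assoc)
      finally show ?thesis .
    qed
  qed
qed

text \<open>
  By Jensen's inequality and Tonelli's theorem, translation invariance is applied for each fixed \<open>w\<close>. The
  convolution may run over fewer variables than \<open>z\<close> has, without splitting the measure on the space of \<open>z\<close> into
  factors.
\<close>

lemma young_partial_convolution:
  fixes F :: "'a::euclidean_space \<Rightarrow> ennreal" and k :: "'c::euclidean_space \<Rightarrow> ennreal"
  assumes q: "1 \<le> q" and F[measurable]: "F \<in> borel_measurable borel" and k[measurable]: "k \<in> borel_measurable borel"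
    and K: "(\<integral>\<^sup>+x. k x \<partial>lborel) = ennreal K" "0 < K" and L: "continuous_on UNIV L"
  shows "(\<integral>\<^sup>+z. epowr (\<integral>\<^sup>+w. F (z + L w) * k w \<partial>lborel) q \<partial>lborel)
    \<le> ennreal (2 powr q * K powr q) * (\<integral>\<^sup>+z. epowr (F z) q \<partial>lborel)"
proof -
  have [measurable]: "L \<in> borel_measurable borel" using L by (rule borel_measurable_continuous_onI)
  note Fq[measurable] = measurable_compose[OF F epowr_measurable]
  have meas: "(\<lambda>(z, w). epowr (F (z + L w)) q * k w) \<in> borel_measurable (lborel \<Otimes>\<^sub>M lborel)"
    by measurable
  have "(\<integral>\<^sup>+z. epowr (\<integral>\<^sup>+w. F (z + L w) * k w \<partial>lborel) q \<partial>lborel)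
    \<le> (\<integral>\<^sup>+z. ennreal (2 powr q * K powr (q - 1)) * (\<integral>\<^sup>+w. epowr (F (z + L w)) q * k w \<partial>lborel) \<partial>lborel)"
    by (intro nn_integral_mono jensen_ennreal[OF q _ _ K]) auto
  also have "\<dots> = ennreal (2 powr q * K powr (q - 1)) * (\<integral>\<^sup>+z. \<integral>\<^sup>+w. epowr (F (z + L w)) q * k w \<partial>lborel \<partial>lborel)"
    using meas by (intro nn_integral_cmult lborel.borel_measurable_nn_integral)
  also have "(\<integral>\<^sup>+z. \<integral>\<^sup>+w. epowr (F (z + L w)) q * k w \<partial>lborel \<partial>lborel)
      = (\<integral>\<^sup>+w. \<integral>\<^sup>+z. epowr (F (z + L w)) q * k w \<partial>lborel \<partial>lborel)"
    using lborel_pair.Fubini'[OF meas] by simp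
  also have "\<dots> = (\<integral>\<^sup>+w. (\<integral>\<^sup>+z. epowr (F z) q \<partial>lborel) * k w \<partial>lborel)"
    using nn_integral_lborel_translate[OF Fq] by (simp add: nn_integral_multc)
  also have "\<dots> = (\<integral>\<^sup>+z. epowr (F z) q \<partial>lborel) * ennreal K"
    using K(1) by (simp add: nn_integral_cmult)
  also have "ennreal (2 powr q * K powr (q - 1)) * ((\<integral>\<^sup>+z. epowr (F z) q \<partial>lborel) * ennreal K)
      = ennreal (2 powr q * K powr (q - 1) * K) * (\<integral>\<^sup>+z. epowr (F z) q \<partial>lborel)"
    using K(2) by (simp add: ennreal_mult mult_ac)
  also have "2 powr q * K powr (q - 1) * K = 2 powr q * K powr q"
    using K(2) by (simp add: powr_diff)
  finally show ?thesis .
qed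

definition cauchy_ker :: "real \<Rightarrow> complex \<Rightarrow> real" where
  "cauchy_ker R w = indicator (ball 0 R) w / norm w"

lemma cauchy_ker_measurable [measurable]: "cauchy_ker R \<in> borel_measurable borel"
  unfolding cauchy_ker_def[abs_def]
  by (intro borel_measurable_divide borel_measurable_indicator borel_measurable_norm) auto

text \<open>
  On the dyadic annulus with outer radius \<open>R 2\<^bsup>-n\<^esup>\<close> the kernel is of size \<open>2\<^sup>n / R\<close>, while the area is of size \<open>R\<^sup>2 4\<^bsup>-n\<^esup>\<close>.
\<close>

lemma cauchy_ker_integrable:
  assumes R: "0 < R"
  obtains K where "0 < K" "(\<integral>\<^sup>+w. ennreal (cauchy_ker R w) \<partial>lborel) = ennreal K"
proof -
  define V where "V = unit_ball_vol (real DIM(complex))"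
  have V: "0 < V" by (simp add: V_def)
  define r where "r = (\<lambda>n. R * (1/2) ^ n)"
  have r: "0 < r n" for n using R by (simp add: r_def)
  have "ennreal (cauchy_ker R w) \<le> (\<Sum>n. ennreal (2 / r n) * indicator (ball 0 (r n)) w)" if "w \<noteq> 0" for w
  proof (cases "w \<in> ball 0 R")
    case True
    have "r \<longlonglongrightarrow> R * 0" unfolding r_def by (intro tendsto_intros) auto
    then have "\<forall>\<^sub>F n in sequentially. r n < norm w" using that order_tendstoD(2)[of r 0 sequentially "norm w"] by simp
    then have ex: "\<exists>n. r n \<le> norm w" by (auto simp: eventually_sequentially intro: less_imp_le)
    define N where "N = (LEAST n. r n \<le> norm w)"
    have N: "r N \<le> norm w" unfolding N_def by (rule LeastI_ex[OF ex])
    have "r 0 = R" by (simp add: r_def)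
    then have "N \<noteq> 0" using N True by (metis dist_0_norm mem_ball not_less)
    then obtain m where m: "N = Suc m" using not0_implies_Suc by blast
    have "\<not> r m \<le> norm w" using not_less_Least[of m "\<lambda>n. r n \<le> norm w"] m by (simp add: N_def[symmetric])
    then have in_ball: "w \<in> ball 0 (r m)" by simp
    have "r m / 2 \<le> norm w" using N m by (simp add: r_def)
    then have "1 / norm w \<le> 2 / r m" using r[of m] that by (simp add: field_simps)
    then have "ennreal (cauchy_ker R w) \<le> ennreal (2 / r m) * indicator (ball 0 (r m)) w"
      using in_ball True by (simp add: cauchy_ker_def ennreal_leI)
    also have "\<dots> \<le> (\<Sum>n. ennreal (2 / r n) * indicator (ball 0 (r n)) w)"
    proof -
      define f where "f = (\<lambda>n. ennreal (2 / r n) * indicator (ball 0 (r n)) w)"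
      have "sum f {m} \<le> suminf f" by (rule sum_le_suminf) auto
      then have "f m \<le> suminf f" by simp
      then show ?thesis unfolding f_def .
    qed
    finally show ?thesis .
  qed (simp add: cauchy_ker_def)
  then have "AE w in lborel. ennreal (cauchy_ker R w) \<le> (\<Sum>n. ennreal (2 / r n) * indicator (ball 0 (r n)) w)"
    using AE_lborel_singleton[of "0::complex"] by (auto elim: eventually_mono)
  then have "(\<integral>\<^sup>+w. ennreal (cauchy_ker R w) \<partial>lborel) \<le> (\<integral>\<^sup>+(w::complex). (\<Sum>n. ennreal (2 / r n) * indicator (ball 0 (r n)) w) \<partial>lborel)"
    by (rule nn_integral_mono_AE)
  also have "\<dots> = (\<Sum>n. \<integral>\<^sup>+w. ennreal (2 / r n) * indicator (ball 0 (r n)) (w::complex) \<partial>lborel)"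
    by (intro nn_integral_suminf borel_measurable_times_ennreal borel_measurable_indicator) auto
  also have "\<dots> = (\<Sum>n. ennreal (2 * V * R * (1/2) ^ n))"
  proof (rule suminf_cong)
    fix n
    have "(\<integral>\<^sup>+w. ennreal (2 / r n) * indicator (ball 0 (r n)) (w::complex) \<partial>lborel)
        = ennreal (2 / r n) * ennreal (V * r n ^ 2)"
      using r[of n] by (subst nn_integral_cmult_indicator) (auto simp: emeasure_ball V_def)
    also have "\<dots> = ennreal (2 / r n * (V * r n ^ 2))"
      using r[of n] V by (subst ennreal_mult) (auto intro: less_imp_le)
    also have "2 / r n * (V * r n ^ 2) = 2 * V * r n"
      using r[of n] by (simp add: power2_eq_square)
    finally show "(\<integral>\<^sup>+w. ennreal (2 / r n) * indicator (ball 0 (r n)) (w::complex) \<partial>lborel) = ennreal (2 * V * R * (1/2) ^ n)"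
      by (simp add: r_def mult.assoc)
  qed
  also have "\<dots> < top"
  proof -
    have "summable (\<lambda>n. 2 * V * R * (1/2) ^ n)" by (intro summable_mult summable_geometric) simp
    then show ?thesis
      using V R by (subst suminf_ennreal2) (auto simp: less_top[symmetric])
  qed
  finally have fin: "(\<integral>\<^sup>+w. ennreal (cauchy_ker R w) \<partial>lborel) < top" .
  then obtain K where K: "0 \<le> K" "(\<integral>\<^sup>+w. ennreal (cauchy_ker R w) \<partial>lborel) = ennreal K"
    by (cases "\<integral>\<^sup>+w. ennreal (cauchy_ker R w) \<partial>lborel") auto
  have "K \<noteq> 0"
  proof
    assume "K = 0"
    have "0 < ennreal (1 / R) * emeasure lborel (ball (0::complex) R)"
      using R V by (simp add: emeasure_ball V_def[symmetric] ennreal_zero_less_mult_iff)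
    also have "\<dots> = (\<integral>\<^sup>+w. ennreal (1 / R) * indicator (ball (0::complex) R) w \<partial>lborel)"
      by (subst nn_integral_cmult_indicator) auto
    also have "\<dots> \<le> (\<integral>\<^sup>+w. ennreal (cauchy_ker R w) \<partial>lborel)"
    proof (rule nn_integral_mono_AE)
      show "AE w in lborel. ennreal (1 / R) * indicator (ball (0::complex) R) w \<le> ennreal (cauchy_ker R w)"
        using AE_lborel_singleton[of "0::complex"]
      proof eventually_elim
        case (elim w)
        then show ?case
          using R by (auto simp: cauchy_ker_def indicator_def intro!: ennreal_leI divide_left_mono)
      qed
    qed
    finally show False using K \<open>K = 0\<close> by simp
  qed
  then show thesis using that[of K] K by simp
qed

section \<open>Approximation by holomorphic functions on polydiscs\<close>

definition set_coord :: "complex ^ 'n \<Rightarrow> 'n \<Rightarrow> complex \<Rightarrow> complex ^ 'n" where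
  "set_coord z i u = z + axis i (u - z $ i)"

lemma set_coord_nth: "set_coord z i u $ j = (if j = i then u else z $ j)"
  by (simp add: set_coord_def axis_def)

lemma set_coord_same: "set_coord z i (z $ i) = z"
  by (simp add: set_coord_def axis_def vec_eq_iff)

lemma set_coord_shift: "set_coord z i (w + z $ i) = z + axis i w"
  by (simp add: set_coord_def)

lemma norm_axis: "norm (axis i c :: complex ^ 'n) = cmod c"
proof -
  have "axis i c = c *s axis i (1::complex)" by (simp add: vec_eq_iff axis_def)
  then show ?thesis by (simp add: norm_smult_vec)
qed

lemma bounded_linear_axis: "bounded_linear (axis i :: complex \<Rightarrow> complex ^ 'n)"
proof (rule bounded_linear_intro[where K=1])
  show "norm (axis i x :: complex ^ 'n) \<le> norm x * 1" for x by (simp add: norm_axis)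
qed (auto simp: vec_eq_iff axis_def)

lemma bounded_linear_nth: "bounded_linear (\<lambda>z :: complex ^ 'n. z $ i)"
  by (rule bounded_linear_vec_nth)

lemma continuous_on_axis [continuous_intros]:
  "continuous_on S f \<Longrightarrow> continuous_on S (\<lambda>x. axis i (f x) :: complex ^ 'n)"
  using bounded_linear.continuous_on[OF bounded_linear_axis] .

lemma continuous_on_upd:
  "continuous_on S f \<Longrightarrow> continuous_on S g \<Longrightarrow> continuous_on S (\<lambda>x. set_coord (f x) i (g x))"
  unfolding set_coord_def by (intro continuous_intros)

text \<open>
  The coordinates outside \<open>J\<close> are unrestricted, because the integration variable of the averaged
  Cauchy integral runs through the whole plane.
\<close>

definition Omega :: "real \<Rightarrow> 'n set \<Rightarrow> (complex ^ 'n) set" where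
  "Omega R J = {z. \<forall>j\<in>J. cmod (z $ j) < R}"

text \<open>
  The set on which errors are measured. The coordinates from \<open>J\<close> have already been treated; each of
  the others still needs the larger radius that the averaging consumes.
\<close>

definition polydisc :: "real \<Rightarrow> 'n set \<Rightarrow> (complex ^ 'n) set" where
  "polydisc R J = {z. \<forall>j. cmod (z $ j) < (if j \<in> J then R else 3 * R)}"

lemma open_Omega: "open (Omega R J)"
proof -
  have "Omega R J = (\<Inter>j\<in>J. {z. cmod (z $ j) < R})" by (auto simp: Omega_def)
  moreover have "open {z :: complex ^ 'n. cmod (z $ j) < R}" for j
    by (intro open_Collect_less continuous_intros)
  ultimately show ?thesis by (auto intro!: open_INT)
qed

lemma open_polydisc: "open (polydisc R J :: (complex ^ 'n) set)"
proof -
  have "polydisc R J = (\<Inter>j\<in>UNIV. {z :: complex ^ 'n. cmod (z $ j) < (if j \<in> J then R else 3 * R)})"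
    unfolding polydisc_def by blast
  moreover have "open {z :: complex ^ 'n. cmod (z $ j) < c}" for j c
    by (intro open_Collect_less continuous_intros)
  ultimately show ?thesis by (simp only:) (intro open_INT finite ballI)
qed

lemma convex_Omega: "convex (Omega R J :: (complex ^ 'n) set)"
proof -
  have "Omega R J = (\<Inter>j\<in>J. (\<lambda>z :: complex ^ 'n. z $ j) -` ball 0 R)" by (auto simp: Omega_def)
  moreover have "convex ((\<lambda>z :: complex ^ 'n. z $ j) -` ball 0 R)" for j
    by (intro convex_linear_vimage bounded_linear.linear[OF bounded_linear_nth] convex_ball)
  ultimately show ?thesis by (auto intro!: convex_INT)
qed

text \<open>
  Continuous differentiability in all real directions is part of the notion: it is what allows
  differentiation under the integral sign in the later steps.
\<close>

definition partially_holomorphic :: "real \<Rightarrow> 'n set \<Rightarrow> (complex ^ 'n \<Rightarrow> complex) \<Rightarrow> bool" where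
  "partially_holomorphic R J h \<longleftrightarrow> (\<exists>h'.
     (\<forall>z\<in>Omega R J. (h has_derivative blinfun_apply (h' z)) (at z)) \<and> continuous_on (Omega R J) h' \<and>
     (\<forall>z\<in>Omega R J. \<forall>j\<in>J. \<forall>c. h' z (axis j c) = c * h' z (axis j 1)))"

text \<open>
  The Cauchy integral in the \<open>i\<close>-th coordinate, averaged over circles in the annulus where \<open>dbar_chi\<close> lives. The
  normalising constant \<open>C\<close> is the one from \<open>Cauchy_Pompeiu_estimate\<close>.
\<close>

definition cauchy_average :: "real \<Rightarrow> real \<Rightarrow> 'n \<Rightarrow> (complex ^ 'n \<Rightarrow> complex) \<Rightarrow> complex ^ 'n \<Rightarrow> complex" where
  "cauchy_average R C i h z = - of_real (1 / C) * (\<integral>u. h (set_coord z i u) * dbar_chi R u / (u - z $ i) \<partial>lborel)"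

text \<open>
  A function that is continuous on the whole plane and agrees with \<open>1 / w\<close> wherever the Cauchy kernel is multiplied by a
  nonzero value of \<open>dbar_chi\<close>.
\<close>

definition reg_inverse :: "real \<Rightarrow> complex \<Rightarrow> complex" where
  "reg_inverse R w = cnj w / of_real ((max R (norm w))\<^sup>2)"

lemma reg_inverse_continuous: "0 < R \<Longrightarrow> continuous_on S f \<Longrightarrow> continuous_on S (\<lambda>x. reg_inverse R (f x))"
  unfolding reg_inverse_def by (intro continuous_intros) auto

lemma reg_inverse_eq: "0 < R \<Longrightarrow> R \<le> norm w \<Longrightarrow> reg_inverse R w = 1 / w"
proof -
  assume R: "0 < R" "R \<le> norm w"
  then have "w \<noteq> 0" by auto
  moreover have "max R (norm w) = norm w" using R by simp
  ultimately show ?thesis unfolding reg_inverse_def by (simp only: complex_norm_square) simp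
qed

lemma dbar_chi_far: "0 < R \<Longrightarrow> dbar_chi R u \<noteq> 0 \<Longrightarrow> norm z < R \<Longrightarrow> R \<le> norm (u - z)"
  using chi_props(6)[of R u] norm_triangle_ineq2[of u z] by force

lemma dbar_chi_reg: "0 < R \<Longrightarrow> norm z < R \<Longrightarrow> dbar_chi R u / (u - z) = dbar_chi R u * reg_inverse R (u - z)"
  using dbar_chi_far[of R u z] reg_inverse_eq[of R "u - z"] by (cases "dbar_chi R u = 0") auto

lemma integral_lborel_cbox:
  fixes f :: "'a::euclidean_space \<Rightarrow> 'b::euclidean_space"
  assumes "integrable lborel f" "\<And>x. x \<notin> cbox a b \<Longrightarrow> f x = 0"
  shows "(\<integral>x. f x \<partial>lborel) = integral (cbox a b) f"
proof -
  have "(f has_integral (\<integral>x. f x \<partial>lborel)) UNIV" by (rule has_integral_integral_lborel[OF assms(1)])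
  moreover have "f = (\<lambda>x. if x \<in> cbox a b then f x else 0)" using assms(2) by auto
  ultimately have "(f has_integral (\<integral>x. f x \<partial>lborel)) (cbox a b)"
    using has_integral_restrict_UNIV[of "cbox a b" f] by metis
  then show ?thesis by (simp add: integral_unique)
qed

lemma dbar_chi_outside_box: "0 < R \<Longrightarrow> u \<notin> cbox (Complex (- 3 * R) (- 3 * R)) (Complex (3 * R) (3 * R)) \<Longrightarrow> dbar_chi R u = 0"
  using abs_Re_le_cmod[of u] abs_Im_le_cmod[of u]
  by (intro chi_props(7)) (auto simp: in_cbox_complex_iff)

lemma set_coord_Omega: "i \<notin> J \<Longrightarrow> z \<in> Omega R (insert i J) \<Longrightarrow> set_coord z i u \<in> Omega R J"
  by (auto simp: Omega_def set_coord_nth)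

lemma cauchy_average_integrand:
  assumes R: "0 < R" and z: "norm (z $ i) < R" and h: "continuous_on UNIV (\<lambda>u. h (set_coord z i u))"
  shows "continuous_on UNIV (\<lambda>u. h (set_coord z i u) * dbar_chi R u / (u - z $ i))"
    and "integrable lborel (\<lambda>u. h (set_coord z i u) * dbar_chi R u / (u - z $ i))"
proof -
  have eq: "h (set_coord z i u) * dbar_chi R u / (u - z $ i) = h (set_coord z i u) * (dbar_chi R u * reg_inverse R (u - z $ i))" for u
    unfolding dbar_chi_reg[OF R z, symmetric] by simp
  show 1: "continuous_on UNIV (\<lambda>u. h (set_coord z i u) * dbar_chi R u / (u - z $ i))"
    unfolding eq by (intro continuous_on_mult h chi_props(8)[OF R] reg_inverse_continuous[OF R] continuous_intros)
  show "integrable lborel (\<lambda>u. h (set_coord z i u) * dbar_chi R u / (u - z $ i))"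
    by (rule integrable_compact_support[OF 1, of "3 * R"]) (simp add: chi_props(7)[OF R])
qed

lemma partially_holomorphic_continuous:
  "partially_holomorphic R J h \<Longrightarrow> continuous_on (Omega R J) h"
  unfolding partially_holomorphic_def
  by (metis continuous_at_imp_continuous_on has_derivative_continuous)

lemma slice_continuous:
  assumes "partially_holomorphic R J h" "i \<notin> J" "z \<in> Omega R (insert i J)"
  shows "continuous_on UNIV (\<lambda>u. h (set_coord z i u))"
  by (rule continuous_on_compose2[OF partially_holomorphic_continuous[OF assms(1)]])
     (auto intro!: continuous_on_upd continuous_intros set_coord_Omega[OF assms(2,3)])

text \<open>
  Differentiation under the integral sign. In the direction \<open>i\<close> only the Cauchy kernel depends on \<open>z\<close>,
  and it is holomorphic; in the directions from \<open>J\<close> only \<open>h\<close> does, and it is holomorphic there by assumption.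
\<close>

lemma cauchy_average_partially_holomorphic:
  fixes h :: "complex ^ 'n \<Rightarrow> complex"
  assumes R: "0 < R" and h: "partially_holomorphic R J h" and i: "i \<notin> J"
  shows "partially_holomorphic R (insert i J) (cauchy_average R C i h)"
proof -
  let ?U = "Omega R (insert i J) :: (complex ^ 'n) set"
  define a b where "a = Complex (- 3 * R) (- 3 * R)" and "b = Complex (3 * R) (3 * R)"
  obtain h' where h': "\<And>z. z \<in> Omega R J \<Longrightarrow> (h has_derivative blinfun_apply (h' z)) (at z)"
    and cont_h': "continuous_on (Omega R J) h'"
    and lin: "\<And>z j c. z \<in> Omega R J \<Longrightarrow> j \<in> J \<Longrightarrow> h' z (axis j c) = c * h' z (axis j 1)"
    using h unfolding partially_holomorphic_def by blast
  note cont_h = partially_holomorphic_continuous[OF h]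
  define PI where "PI = Blinfun (\<lambda>v :: complex ^ 'n. v - axis i (v $ i))"
  define PR where "PR = Blinfun (\<lambda>v :: complex ^ 'n. v $ i)"
  have PI: "blinfun_apply PI = (\<lambda>v. v - axis i (v $ i))"
    unfolding PI_def by (intro bounded_linear_Blinfun_apply bounded_linear_sub bounded_linear_ident
      bounded_linear_compose[OF bounded_linear_axis bounded_linear_nth])
  have PR: "blinfun_apply PR = (\<lambda>v. v $ i)"
    unfolding PR_def by (intro bounded_linear_Blinfun_apply bounded_linear_nth)
  define F where "F = (\<lambda>z u. (blinfun_mult_right (dbar_chi R u * reg_inverse R (u - z $ i)) o\<^sub>L (h' (set_coord z i u) o\<^sub>L PI))
     + (blinfun_mult_right (h (set_coord z i u) * (dbar_chi R u * (reg_inverse R (u - z $ i))\<^sup>2)) o\<^sub>L PR))"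
  have F_apply: "blinfun_apply (F z u) v = dbar_chi R u * reg_inverse R (u - z $ i) * h' (set_coord z i u) (v - axis i (v $ i))
     + h (set_coord z i u) * (dbar_chi R u * (reg_inverse R (u - z $ i))\<^sup>2) * (v $ i)" for z u v
    by (simp add: F_def PI PR plus_blinfun.rep_eq)
  have zi: "cmod (z $ i) < R" if "z \<in> ?U" for z using that by (simp add: Omega_def)
  have contF: "continuous_on (?U \<times> cbox a b) (\<lambda>(z, u). F z u)"
    unfolding split_beta F_def
    by (intro continuous_intros continuous_on_compose2[OF cont_h'] continuous_on_compose2[OF cont_h]
        continuous_on_upd reg_inverse_continuous[OF R] continuous_on_compose2[OF chi_props(8)[OF R]]
        bounded_linear.continuous_on[OF bounded_linear_blinfun_mult_right])
       (auto intro: set_coord_Omega[OF i])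
  have der: "((\<lambda>z. integral (cbox a b) (\<lambda>u. h (set_coord z i u) * dbar_chi R u / (u - z $ i))) has_derivative
      integral (cbox a b) (F z)) (at z within ?U)" if "z \<in> ?U" for z
  proof (rule leibniz_rule[OF _ _ contF that convex_Omega])
    fix z u assume z: "z \<in> ?U"
    show "((\<lambda>z. h (set_coord z i u) * dbar_chi R u / (u - z $ i)) has_derivative blinfun_apply (F z u)) (at z within ?U)"
    proof (cases "dbar_chi R u = 0")
      case True
      then show ?thesis by (simp add: F_apply[abs_def])
    next
      case False
      have far: "R \<le> norm (u - z $ i)" using dbar_chi_far[OF R False zi[OF z]] .
      then have ne: "u - z $ i \<noteq> 0" using R by auto
      have "((\<lambda>z. set_coord z i u) has_derivative (\<lambda>v. v - axis i (v $ i))) (at z within ?U)"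
      proof -
        have "((\<lambda>z. (z - axis i (z $ i)) + axis i u) has_derivative (\<lambda>v. (v - axis i (v $ i)) + 0)) (at z within ?U)"
          unfolding PI[symmetric, THEN fun_cong] by (intro has_derivative_add has_derivative_const bounded_linear_imp_has_derivative blinfun.bounded_linear_right)
        moreover have "(z - axis i (z $ i)) + axis i u = set_coord z i u" for z :: "complex ^ 'n"
          by (simp add: set_coord_def vec_eq_iff axis_def)
        ultimately show ?thesis by simp
      qed
      from has_derivative_compose[OF this h'[OF set_coord_Omega[OF i z]]]
      have d1: "((\<lambda>z. h (set_coord z i u)) has_derivative (\<lambda>v. h' (set_coord z i u) (v - axis i (v $ i)))) (at z within ?U)" .
      have "((\<lambda>z. u - z $ i) has_derivative (\<lambda>v. - (v $ i))) (at z within ?U)"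
        using has_derivative_diff[OF has_derivative_const bounded_linear_imp_has_derivative[OF bounded_linear_nth]] by simp
      from has_derivative_divide[OF has_derivative_mult_left[OF d1, of "dbar_chi R u"] this ne]
      show ?thesis
      proof (rule has_derivative_eq_rhs)
        show "(\<lambda>v. - (h (set_coord z i u) * dbar_chi R u) * (inverse (u - z $ i) * (- (v $ i)) * inverse (u - z $ i))
            + h' (set_coord z i u) (v - axis i (v $ i)) * dbar_chi R u / (u - z $ i)) = blinfun_apply (F z u)"
          using ne by (auto simp: F_apply reg_inverse_eq[OF R far] fun_eq_iff power2_eq_square field_simps)
      qed
    qed
  next
    fix z assume z: "z \<in> ?U"
    show "(\<lambda>u. h (set_coord z i u) * dbar_chi R u / (u - z $ i)) integrable_on cbox a b"
      using cauchy_average_integrand(1)[OF R zi[OF z] slice_continuous[OF h i z]]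
      by (intro integrable_continuous) (auto intro: continuous_on_subset)
  qed
  have cauchy_average_eq: "cauchy_average R C i h z = - of_real (1 / C) * integral (cbox a b) (\<lambda>u. h (set_coord z i u) * dbar_chi R u / (u - z $ i))"
    if z: "z \<in> ?U" for z
    unfolding cauchy_average_def a_def b_def
    by (subst integral_lborel_cbox[OF cauchy_average_integrand(2)[OF R zi[OF z] slice_continuous[OF h i z]]])
       (auto simp: dbar_chi_outside_box[OF R])
  define H' where "H' = (\<lambda>z. blinfun_mult_right (- of_real (1 / C)) o\<^sub>L integral (cbox a b) (F z))"
  have "(cauchy_average R C i h has_derivative blinfun_apply (H' z)) (at z)" if z: "z \<in> ?U" for z
  proof -
    have "((\<lambda>z. integral (cbox a b) (\<lambda>u. h (set_coord z i u) * dbar_chi R u / (u - z $ i))) has_derivative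
      integral (cbox a b) (F z)) (at z)"
      using der[OF z] at_within_open[OF z open_Omega] by simp
    from has_derivative_mult_right[OF this, of "- of_real (1 / C)"]
    have "((\<lambda>z. - of_real (1 / C) * integral (cbox a b) (\<lambda>u. h (set_coord z i u) * dbar_chi R u / (u - z $ i)))
      has_derivative blinfun_apply (H' z)) (at z)"
      by (rule has_derivative_eq_rhs) (auto simp: H'_def)
    then show ?thesis
      by (rule has_derivative_transform_within_open[OF _ open_Omega z]) (simp add: cauchy_average_eq)
  qed
  moreover have "continuous_on ?U H'"
    unfolding H'_def by (intro continuous_intros integral_continuous_on_param contF)
  moreover have "H' z (axis j c) = c * H' z (axis j 1)" if z: "z \<in> ?U" and j: "j \<in> insert i J" for z j c
  proof -
    have "F z integrable_on cbox a b"
    proof (rule integrable_continuous)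
      have "continuous_on (cbox a b) (\<lambda>u. (\<lambda>(z, u). F z u) (z, u))"
        by (rule continuous_on_compose2[OF contF]) (use z in \<open>auto intro!: continuous_intros\<close>)
      then show "continuous_on (cbox a b) (F z)" by simp
    qed
    note app = blinfun_apply_integral[OF this]
    have "F z u (axis j c) = c * F z u (axis j 1)" for u
    proof (cases "j = i")
      case True
      then show ?thesis by (simp add: F_apply axis_def[of i _, THEN arg_cong[where f="\<lambda>v. v $ i"]] blinfun.zero_right)
    next
      case False
      then have "j \<in> J" using j by simp
      then have "(axis j c :: complex ^ 'n) $ i = 0" for c using False by (simp add: axis_def)
      moreover have ax0: "axis i 0 = (0 :: complex ^ 'n)" by (simp add: vec_eq_iff axis_def)
      ultimately show ?thesis using lin[OF set_coord_Omega[OF i z] \<open>j \<in> J\<close>, of u c] by (simp add: F_apply ax0)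
    qed
    then show ?thesis by (simp add: H'_def app)
  qed
  ultimately show ?thesis unfolding partially_holomorphic_def by blast
qed

lemma dbar_chi_bounded:
  assumes "0 < R"
  shows "\<exists>K\<ge>1. \<forall>u. cmod (dbar_chi R u) \<le> K"
proof -
  have "bounded (dbar_chi R ` cball 0 (3 * R))"
    by (intro compact_imp_bounded compact_continuous_image continuous_on_subset[OF chi_props(8)[OF assms]]) auto
  then obtain K where K: "\<forall>u\<in>cball 0 (3 * R). cmod (dbar_chi R u) \<le> K"
    unfolding bounded_iff by (auto simp del: mem_cball)
  have "cmod (dbar_chi R u) \<le> max 1 K" for u
    using K chi_props(7)[OF assms, of u] by (cases "3 * R \<le> norm u") (auto simp: le_max_iff_disj)
  then show ?thesis by (intro exI[of _ "max 1 K"]) simp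
qed

lemma dbar_component_continuous:
  assumes "Ck_on 1 f UNIV"
  shows "continuous_on UNIV (\<lambda>y. dbar f y $ i)"
proof -
  have "dbar f y $ i = (frechet_derivative f (at y) (axis i 1) + \<i> * frechet_derivative f (at y) (axis i \<i>)) / 2" for y
    by (simp add: dbar_def)
  moreover have "continuous_on UNIV (\<lambda>y. frechet_derivative f (at y) v)" for v
    using assms by simp
  ultimately show ?thesis by (simp only:) (intro continuous_intros; simp)
qed

lemma dbar_component_measurable:
  assumes "Ck_on 1 f UNIV" "open S"
  shows "(\<lambda>y. ennreal (cmod (dbar f y $ i)) * indicator S y) \<in> borel_measurable borel"
proof -
  have [measurable]: "(\<lambda>y. dbar f y $ i) \<in> borel_measurable borel"
    by (rule borel_measurable_continuous_onI[OF dbar_component_continuous[OF assms(1)]])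
  have [measurable]: "S \<in> sets borel" using assms(2) by simp
  show ?thesis by measurable
qed

lemma polydisc_subset_Omega: "polydisc R J \<subseteq> Omega R J"
proof
  fix z assume z: "z \<in> polydisc R J"
  have "cmod (z $ j) < R" if j: "j \<in> J" for j
  proof -
    have "cmod (z $ j) < (if j \<in> J then R else 3 * R)" using z unfolding polydisc_def by blast
    then show ?thesis using j by simp
  qed
  then show "z \<in> Omega R J" by (simp add: Omega_def)
qed

lemma polydisc_mono: "0 < R \<Longrightarrow> polydisc R J \<subseteq> polydisc R {}"
proof
  fix z assume R: "0 < R" and z: "z \<in> polydisc R J"
  have "cmod (z $ j) < 3 * R" for j
  proof -
    have "cmod (z $ j) < (if j \<in> J then R else 3 * R)" using z unfolding polydisc_def by blast
    also have "\<dots> \<le> 3 * R" using R by simp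
    finally show ?thesis .
  qed
  then show "z \<in> polydisc R {}" by (simp add: polydisc_def)
qed

lemma error_measurable:
  fixes f h :: "complex ^ 'n \<Rightarrow> complex"
  assumes "Ck_on 1 f UNIV" "partially_holomorphic R J h"
  shows "(\<lambda>y. ennreal (cmod (f y - h y)) * indicator (polydisc R J) y) \<in> borel_measurable borel"
proof -
  have f: "continuous_on UNIV f" using Ck_on_Suc_D[of 0 f UNIV] assms(1) by simp
  have "continuous_on (polydisc R J) (\<lambda>y. f y - h y)"
    by (rule continuous_on_diff[OF continuous_on_subset[OF f subset_UNIV]
        continuous_on_subset[OF partially_holomorphic_continuous[OF assms(2)] polydisc_subset_Omega]])
  then have "(\<lambda>y. indicator (polydisc R J) y *\<^sub>R (f y - h y)) \<in> borel_measurable borel"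
    by (intro borel_measurable_continuous_on_indicator) (simp_all add: open_polydisc)
  from measurable_compose[OF measurable_compose[OF this borel_measurable_norm] measurable_ennreal]
  have "(\<lambda>y. ennreal (cmod (indicator (polydisc R J) y *\<^sub>R (f y - h y)))) \<in> borel_measurable borel" .
  moreover have "ennreal (cmod (indicator (polydisc R J) y *\<^sub>R (f y - h y))) = ennreal (cmod (f y - h y)) * indicator (polydisc R J) y" for y
    by (simp split: split_indicator)
  ultimately show ?thesis by (simp only:)
qed

text \<open>
  Both parts of the error, the Cauchy transform of the \<open>i\<close>-th Cauchy--Riemann derivative of \<open>f\<close> and the averaged old
  error \<open>f - h\<close>, are dominated by the same convolution with the Cauchy kernel in the \<open>i\<close>-th coordinate.
\<close>

lemma cauchy_average_error:
  assumes R: "0 < R"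
  shows "\<exists>C>0. \<exists>B>0. \<forall>(f :: complex ^ 'n \<Rightarrow> complex) h J i z.
       Ck_on 1 f UNIV \<longrightarrow> partially_holomorphic R J h \<longrightarrow> i \<notin> J \<longrightarrow> z \<in> polydisc R (insert i J) \<longrightarrow>
       ennreal (cmod (f z - cauchy_average R C i h z)) \<le> ennreal B *
        (\<integral>\<^sup>+w. (ennreal (cmod (dbar f (z + axis i w) $ i)) * indicator (polydisc R {}) (z + axis i w)
            + ennreal (cmod (f (z + axis i w) - h (z + axis i w))) * indicator (polydisc R J) (z + axis i w))
            * ennreal (cauchy_ker (4 * R) w) \<partial>lborel)"
proof -
  from Cauchy_Pompeiu_estimate[OF R] obtain C where *: "0 < C \<and> (\<forall>g z. Ck_on 1 g UNIV \<longrightarrow> norm z < R \<longrightarrow>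
       ennreal (cmod (of_real C * g z + (\<integral>u. g u * dbar_chi R u / (u - z) \<partial>lborel)))
        \<le> (\<integral>\<^sup>+u. ennreal (cmod (dbar1 g u * chi R u) / norm (u - z)) \<partial>lborel))" ..
  note C = conjunct1[OF *] and CP = conjunct2[OF *, rule_format]
  from dbar_chi_bounded[OF R] obtain K where **: "1 \<le> K \<and> (\<forall>u. cmod (dbar_chi R u) \<le> K)" ..
  note K = conjunct1[OF **] conjunct2[OF **, rule_format]
  have "ennreal (cmod (f z - cauchy_average R C i h z)) \<le> ennreal (K / C) *
        (\<integral>\<^sup>+w. (ennreal (cmod (dbar f (z + axis i w) $ i)) * indicator (polydisc R {}) (z + axis i w)
            + ennreal (cmod (f (z + axis i w) - h (z + axis i w))) * indicator (polydisc R J) (z + axis i w))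
            * ennreal (cauchy_ker (4 * R) w) \<partial>lborel)"
    if f: "Ck_on 1 f UNIV" and h: "partially_holomorphic R J h" and i: "i \<notin> J" and z: "z \<in> polydisc R (insert i J)"
    for f h :: "complex ^ 'n \<Rightarrow> complex" and J i z
  proof -
    have zO: "z \<in> Omega R (insert i J)"
      by (rule subsetD[OF polydisc_subset_Omega z])
    then have zi: "cmod (z $ i) < R" by (simp add: Omega_def)
    define g where "g = (\<lambda>u. f (set_coord z i u))"
    have set_coord_eq: "set_coord z i u = (z - axis i (z $ i)) + axis i u" for u
      by (simp add: set_coord_def vec_eq_iff axis_def)
    have g: "Ck_on 1 g UNIV"
      unfolding g_def set_coord_eq using Ck_on_affine[OF bounded_linear_axis f, of "z - axis i (z $ i)" i] .
    have contg: "continuous_on UNIV g" using Ck_on_Suc_D[of 0 g UNIV] g by simp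
    have dg: "dbar1 g u = dbar f (set_coord z i u) $ i" for u
    proof -
      have "f differentiable (at ((z - axis i (z $ i)) + axis i u))" using f by simp
      from frechet_derivative_affine(2)[OF bounded_linear_axis this]
      have "frechet_derivative g (at u) = (\<lambda>v. frechet_derivative f (at (set_coord z i u)) (axis i v))"
        unfolding g_def set_coord_eq .
      then show ?thesis by (simp only: dbar1_def dbar_def vec_lambda_beta)
    qed
    define d where "d = (\<lambda>u. g u - h (set_coord z i u))"
    have contd: "continuous_on UNIV d"
      unfolding d_def by (intro continuous_on_diff contg slice_continuous[OF h i zO])
    have Ig: "integrable lborel (\<lambda>u. g u * dbar_chi R u / (u - z $ i))"
      using cauchy_average_integrand(2)[of R z i f, OF R zi contg[unfolded g_def]] unfolding g_def .
    note Ih = cauchy_average_integrand(2)[OF R zi slice_continuous[OF h i zO]]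
    let ?Id = "\<integral>u. d u * dbar_chi R u / (u - z $ i) \<partial>lborel"
    have Idi: "integrable lborel (\<lambda>u. d u * dbar_chi R u / (u - z $ i))"
      using Bochner_Integration.integrable_diff[OF Ig Ih] by (simp add: d_def left_diff_distrib diff_divide_distrib)
    have Id: "?Id = (\<integral>u. g u * dbar_chi R u / (u - z $ i) \<partial>lborel) - (\<integral>u. h (set_coord z i u) * dbar_chi R u / (u - z $ i) \<partial>lborel)"
      using Bochner_Integration.integral_diff[OF Ig Ih] by (simp add: d_def left_diff_distrib diff_divide_distrib)
    have "of_real C * (f z - cauchy_average R C i h z) = (of_real C * g (z $ i) + (\<integral>u. g u * dbar_chi R u / (u - z $ i) \<partial>lborel)) - ?Id"
      using C unfolding Id by (simp add: cauchy_average_def g_def set_coord_same field_simps)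
    then have "cmod (of_real C * (f z - cauchy_average R C i h z))
      \<le> cmod (of_real C * g (z $ i) + (\<integral>u. g u * dbar_chi R u / (u - z $ i) \<partial>lborel)) + cmod ?Id"
      by (simp only:) (rule norm_triangle_ineq4)
    then have "ennreal (C * cmod (f z - cauchy_average R C i h z))
      \<le> ennreal (cmod (of_real C * g (z $ i) + (\<integral>u. g u * dbar_chi R u / (u - z $ i) \<partial>lborel))) + ennreal (cmod ?Id)"
      using C by (simp add: norm_mult ennreal_plus[symmetric] del: ennreal_plus)
    also have "\<dots> \<le> (\<integral>\<^sup>+u. ennreal (cmod (dbar1 g u * chi R u) / norm (u - z $ i)) \<partial>lborel)
       + (\<integral>\<^sup>+u. ennreal (cmod (d u * dbar_chi R u / (u - z $ i))) \<partial>lborel)"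
      by (intro add_mono CP[OF g zi] integral_norm_bound_ennreal[OF Idi])
    also have "\<dots> = (\<integral>\<^sup>+u. ennreal (cmod (dbar1 g u * chi R u) / norm (u - z $ i))
       + ennreal (cmod (d u * dbar_chi R u / (u - z $ i))) \<partial>lborel)"
    proof -
      have [measurable]: "dbar1 g \<in> borel_measurable borel" "chi R \<in> borel_measurable borel"
        "d \<in> borel_measurable borel" "dbar_chi R \<in> borel_measurable borel"
        using dbar1_continuous[OF g] contd chi_props(8)[OF R] Ck_on_Suc_D[of 0 "chi R" UNIV] chi_props(1)[OF R]
        by (auto intro: borel_measurable_continuous_onI)
      show ?thesis by (rule nn_integral_add[symmetric]) auto
    qed
    also have "\<dots> = (\<integral>\<^sup>+w. ennreal (cmod (dbar1 g (w + z $ i) * chi R (w + z $ i)) / norm w)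
       + ennreal (cmod (d (w + z $ i) * dbar_chi R (w + z $ i) / w)) \<partial>lborel)"
    proof -
      have [measurable]: "dbar1 g \<in> borel_measurable borel" "chi R \<in> borel_measurable borel"
        "d \<in> borel_measurable borel" "dbar_chi R \<in> borel_measurable borel"
        using dbar1_continuous[OF g] contd chi_props(8)[OF R] Ck_on_Suc_D[of 0 "chi R" UNIV] chi_props(1)[OF R]
        by (auto intro: borel_measurable_continuous_onI)
      define E where "E = (\<lambda>u. ennreal (cmod (dbar1 g u * chi R u) / norm (u - z $ i))
       + ennreal (cmod (d u * dbar_chi R u / (u - z $ i))))"
      have "E \<in> borel_measurable borel" unfolding E_def by measurable
      from nn_integral_lborel_translate[OF this, of "z $ i"] show ?thesis
        by (simp add: E_def)
    qed
    also have "\<dots> \<le> (\<integral>\<^sup>+w. ennreal K * ((ennreal (cmod (dbar f (z + axis i w) $ i)) * indicator (polydisc R {}) (z + axis i w)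
            + ennreal (cmod (f (z + axis i w) - h (z + axis i w))) * indicator (polydisc R J) (z + axis i w))
            * ennreal (cauchy_ker (4 * R) w)) \<partial>lborel)"
    proof (rule nn_integral_mono)
      fix w
      let ?u = "w + z $ i" and ?y = "z + axis i w"
      show "ennreal (cmod (dbar1 g ?u * chi R ?u) / norm w) + ennreal (cmod (d ?u * dbar_chi R ?u / w))
        \<le> ennreal K * ((ennreal (cmod (dbar f ?y $ i)) * indicator (polydisc R {}) ?y
            + ennreal (cmod (f ?y - h ?y)) * indicator (polydisc R J) ?y) * ennreal (cauchy_ker (4 * R) w))"
      proof (cases "3 * R \<le> norm ?u")
        case True
        then show ?thesis using chi_props(5,7)[OF R True] by simp
      next
        case False
        have y: "?y $ j = (if j = i then ?u else z $ j)" for j by (simp add: axis_def)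
        have "cmod (?y $ j) < (if j \<in> J then R else 3 * R)" for j
        proof (cases "j = i")
          case True
          then show ?thesis using False i unfolding y by simp
        next
          case ji: False
          have "cmod (z $ j) < (if j \<in> insert i J then R else 3 * R)" using z unfolding polydisc_def by blast
          then show ?thesis using ji unfolding y by simp
        qed
        then have yJ: "?y \<in> polydisc R J" unfolding polydisc_def by blast
        moreover have "?y \<in> polydisc R {}" by (rule subsetD[OF polydisc_mono[OF R] yJ])
        moreover have "norm w < 4 * R"
          using False zi norm_triangle_ineq4[of ?u "z $ i"] by simp
        then have "cauchy_ker (4 * R) w = 1 / norm w" by (simp add: cauchy_ker_def)
        moreover have "cmod (dbar1 g ?u * chi R ?u) / norm w \<le> K * (cmod (dbar f ?y $ i) * (1 / norm w))"
        proof -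
          have "cmod (dbar1 g ?u * chi R ?u) \<le> cmod (dbar f ?y $ i) * 1"
            unfolding norm_mult dg set_coord_shift using chi_props(3)[OF R] by (intro mult_left_mono) auto
          also have "\<dots> \<le> K * cmod (dbar f ?y $ i)" using K(1) mult_right_mono[of 1 K "cmod (dbar f ?y $ i)"] by simp
          finally show ?thesis by (simp add: divide_right_mono)
        qed
        moreover have "cmod (d ?u * dbar_chi R ?u / w) \<le> K * (cmod (f ?y - h ?y) * (1 / norm w))"
        proof -
          have "cmod (d ?u * dbar_chi R ?u) \<le> cmod (f ?y - h ?y) * K"
            unfolding norm_mult d_def g_def set_coord_shift by (intro mult_left_mono K) auto
          then show ?thesis by (simp add: norm_divide divide_right_mono mult.commute)
        qed
        ultimately show ?thesis
          using K(1) by (simp add: distrib_left distrib_right ennreal_mult[symmetric] add_mono ennreal_leI mult.assoc)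
      qed
    qed
    also have "\<dots> = ennreal K * (\<integral>\<^sup>+w. (ennreal (cmod (dbar f (z + axis i w) $ i)) * indicator (polydisc R {}) (z + axis i w)
            + ennreal (cmod (f (z + axis i w) - h (z + axis i w))) * indicator (polydisc R J) (z + axis i w))
            * ennreal (cauchy_ker (4 * R) w) \<partial>lborel)" (is "_ = ennreal K * ?I")
    proof (rule nn_integral_cmult)
      have m: "(\<lambda>w. z + axis i w) \<in> borel_measurable borel"
        by (intro borel_measurable_continuous_onI continuous_intros)
      note m1 = measurable_compose[OF m dbar_component_measurable[OF f open_polydisc]]
        and m2 = measurable_compose[OF m error_measurable[OF f h]]
        and m3 = measurable_compose[OF cauchy_ker_measurable measurable_ennreal]
      show "(\<lambda>w. (ennreal (cmod (dbar f (z + axis i w) $ i)) * indicator (polydisc R {}) (z + axis i w)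
            + ennreal (cmod (f (z + axis i w) - h (z + axis i w))) * indicator (polydisc R J) (z + axis i w))
            * ennreal (cauchy_ker (4 * R) w)) \<in> borel_measurable lborel"
        using borel_measurable_times_ennreal[OF borel_measurable_add[OF m1 m2] m3]
        by (simp only: measurable_lborel2)
    qed
    finally have "ennreal (1 / C) * ennreal (C * cmod (f z - cauchy_average R C i h z)) \<le> ennreal (1 / C) * (ennreal K * ?I)"
      by (rule mult_left_mono) simp
    then show "ennreal (cmod (f z - cauchy_average R C i h z)) \<le> ennreal (K / C) * ?I"
      using C K(1) by (simp add: ennreal_mult[symmetric] mult.assoc[symmetric])
  qed
  then show ?thesis using C K(1) by (intro exI[of _ C] conjI exI[of _ "K / C"] allI impI) simp_all
qed

lemma form_abs_nonneg: "0 \<le> form_abs w" by (simp add: form_abs_def sum_nonneg)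

lemma component_le_form_abs: "cmod (w $ i) \<le> form_abs w"
  unfolding form_abs_def by (rule member_le_sum) auto

text \<open>
  Induction on the set of coordinates in which the approximation is holomorphic; for \<open>J = {}\<close> it is
  \<open>f\<close> itself.
\<close>

lemma dbar_polydisc_estimate:
  fixes J :: "'n::finite set"
  assumes R: "0 < R" and q: "1 \<le> q"
  shows "\<exists>A\<ge>0. \<forall>f :: complex ^ 'n \<Rightarrow> complex. Ck_on 1 f UNIV \<longrightarrow> (\<exists>h. partially_holomorphic R J h \<and>
     (\<integral>\<^sup>+z. epowr (ennreal (cmod (f z - h z)) * indicator (polydisc R J) z) q \<partial>lborel)
     \<le> ennreal A * (\<integral>\<^sup>+z. epowr (ennreal (form_abs (dbar f z)) * indicator (polydisc R {}) z) q \<partial>lborel))"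
  using finite[of J]
proof (induction J rule: finite_induct)
  case empty
  show ?case
  proof (intro exI[of _ 0] conjI allI impI)
    fix f :: "complex ^ 'n \<Rightarrow> complex" assume f: "Ck_on 1 f UNIV"
    have d: "(f has_derivative frechet_derivative f (at z)) (at z)" for z
      using f by (simp add: frechet_derivative_works)
    have bl: "blinfun_apply (Blinfun (frechet_derivative f (at z))) = frechet_derivative f (at z)" for z
      by (rule bounded_linear_Blinfun_apply, rule has_derivative_bounded_linear[OF d])
    have "continuous_on UNIV (\<lambda>z. Blinfun (frechet_derivative f (at z)))"
      by (rule continuous_on_blinfun_componentwise) (use f bl in simp)
    then have "partially_holomorphic R {} f"
      unfolding partially_holomorphic_def
      by (intro exI[of _ "\<lambda>z. Blinfun (frechet_derivative f (at z))"]) (auto simp: bl d intro: continuous_on_subset)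
    then show "\<exists>h. partially_holomorphic R {} h \<and>
     (\<integral>\<^sup>+z. epowr (ennreal (cmod (f z - h z)) * indicator (polydisc R {}) z) q \<partial>lborel)
     \<le> ennreal 0 * (\<integral>\<^sup>+z. epowr (ennreal (form_abs (dbar f z)) * indicator (polydisc R {}) z) q \<partial>lborel)"
      by (intro exI[of _ f]) simp
  qed simp
next
  case (insert i J)
  then obtain A where A: "0 \<le> A" and IH: "\<And>f :: complex ^ 'n \<Rightarrow> complex. Ck_on 1 f UNIV \<Longrightarrow> \<exists>h. partially_holomorphic R J h \<and>
     (\<integral>\<^sup>+z. epowr (ennreal (cmod (f z - h z)) * indicator (polydisc R J) z) q \<partial>lborel)
     \<le> ennreal A * (\<integral>\<^sup>+z. epowr (ennreal (form_abs (dbar f z)) * indicator (polydisc R {}) z) q \<partial>lborel)"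
    by blast
  obtain C B where B: "0 < C" "0 < B" and err: "\<And>(f :: complex ^ 'n \<Rightarrow> complex) h J i z.
       Ck_on 1 f UNIV \<Longrightarrow> partially_holomorphic R J h \<Longrightarrow> i \<notin> J \<Longrightarrow> z \<in> polydisc R (insert i J) \<Longrightarrow>
       ennreal (cmod (f z - cauchy_average R C i h z)) \<le> ennreal B *
        (\<integral>\<^sup>+w. (ennreal (cmod (dbar f (z + axis i w) $ i)) * indicator (polydisc R {}) (z + axis i w)
            + ennreal (cmod (f (z + axis i w) - h (z + axis i w))) * indicator (polydisc R J) (z + axis i w))
            * ennreal (cauchy_ker (4 * R) w) \<partial>lborel)"
    using cauchy_average_error[OF R] by blast
  obtain K where K: "0 < K" "(\<integral>\<^sup>+w. ennreal (cauchy_ker (4 * R) w) \<partial>lborel) = ennreal K"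
    using cauchy_ker_integrable[of "4 * R"] R by auto
  define A' where "A' = B powr q * (2 powr q * K powr q) * (2 powr q * (1 + A))"
  show ?case
  proof (intro exI[of _ A'] conjI allI impI)
    show "0 \<le> A'" using A by (simp add: A'_def)
    fix f :: "complex ^ 'n \<Rightarrow> complex" assume f: "Ck_on 1 f UNIV"
    let ?D = "\<integral>\<^sup>+z. epowr (ennreal (form_abs (dbar f z)) * indicator (polydisc R {}) z) q \<partial>lborel"
    obtain h where h: "partially_holomorphic R J h"
      and le: "(\<integral>\<^sup>+z. epowr (ennreal (cmod (f z - h z)) * indicator (polydisc R J) z) q \<partial>lborel) \<le> ennreal A * ?D"
      using IH[OF f] by blast
    define F1 where "F1 = (\<lambda>y. ennreal (cmod (dbar f y $ i)) * indicator (polydisc R {}) y)"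
    define F2 where "F2 = (\<lambda>y. ennreal (cmod (f y - h y)) * indicator (polydisc R J) y)"
    have F1[measurable]: "F1 \<in> borel_measurable borel"
      unfolding F1_def by (rule dbar_component_measurable[OF f open_polydisc])
    have F2[measurable]: "F2 \<in> borel_measurable borel"
      unfolding F2_def by (rule error_measurable[OF f h])
    note [measurable] = measurable_compose[OF F1 epowr_measurable] measurable_compose[OF F2 epowr_measurable]
    have "(\<integral>\<^sup>+z. epowr (ennreal (cmod (f z - cauchy_average R C i h z)) * indicator (polydisc R (insert i J)) z) q \<partial>lborel)
      \<le> (\<integral>\<^sup>+z. ennreal (B powr q) * epowr (\<integral>\<^sup>+w. (F1 (z + axis i w) + F2 (z + axis i w)) * ennreal (cauchy_ker (4 * R) w) \<partial>lborel) q \<partial>lborel)"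
    proof (rule nn_integral_mono)
      fix z
      have "ennreal (cmod (f z - cauchy_average R C i h z)) * indicator (polydisc R (insert i J)) z
        \<le> ennreal B * (\<integral>\<^sup>+w. (F1 (z + axis i w) + F2 (z + axis i w)) * ennreal (cauchy_ker (4 * R) w) \<partial>lborel)"
        using err[OF f h insert.hyps(2), of z] unfolding F1_def F2_def by (cases "z \<in> polydisc R (insert i J)") auto
      then have "epowr (ennreal (cmod (f z - cauchy_average R C i h z)) * indicator (polydisc R (insert i J)) z) q
        \<le> epowr (ennreal B * (\<integral>\<^sup>+w. (F1 (z + axis i w) + F2 (z + axis i w)) * ennreal (cauchy_ker (4 * R) w) \<partial>lborel)) q"
        using q by (intro epowr_mono) auto
      then show "epowr (ennreal (cmod (f z - cauchy_average R C i h z)) * indicator (polydisc R (insert i J)) z) q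
        \<le> ennreal (B powr q) * epowr (\<integral>\<^sup>+w. (F1 (z + axis i w) + F2 (z + axis i w)) * ennreal (cauchy_ker (4 * R) w) \<partial>lborel) q"
        using q B by (simp add: epowr_mult epowr_ennreal)
    qed
    also have "\<dots> = ennreal (B powr q) * (\<integral>\<^sup>+z. epowr (\<integral>\<^sup>+w. (F1 (z + axis i w) + F2 (z + axis i w)) * ennreal (cauchy_ker (4 * R) w) \<partial>lborel) q \<partial>lborel)"
    proof (rule nn_integral_cmult)
      have "(\<lambda>z. \<integral>\<^sup>+w. (F1 (z + axis i w) + F2 (z + axis i w)) * ennreal (cauchy_ker (4 * R) w) \<partial>lborel) \<in> borel_measurable lborel"
      proof (rule lborel.borel_measurable_nn_integral)
        have [measurable]: "(axis i :: complex \<Rightarrow> complex ^ 'n) \<in> borel_measurable borel"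
          by (intro borel_measurable_continuous_onI continuous_on_axis continuous_on_id)
        show "(\<lambda>(z, w). (F1 (z + axis i w) + F2 (z + axis i w)) * ennreal (cauchy_ker (4 * R) w)) \<in> borel_measurable (lborel \<Otimes>\<^sub>M lborel)"
          by measurable
      qed
      then show "(\<lambda>z. epowr (\<integral>\<^sup>+w. (F1 (z + axis i w) + F2 (z + axis i w)) * ennreal (cauchy_ker (4 * R) w) \<partial>lborel) q) \<in> borel_measurable lborel"
        by (rule measurable_compose[OF _ epowr_measurable])
    qed
    also have "\<dots> \<le> ennreal (B powr q) * (ennreal (2 powr q * K powr q) * (\<integral>\<^sup>+z. epowr (F1 z + F2 z) q \<partial>lborel))"
      by (intro mult_left_mono young_partial_convolution[OF q _ _ K(2,1)] borel_measurable_add F1 F2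
         continuous_on_axis continuous_on_id measurable_compose[OF cauchy_ker_measurable measurable_ennreal]) auto
    also have "(\<integral>\<^sup>+z. epowr (F1 z + F2 z) q \<partial>lborel) \<le> (\<integral>\<^sup>+z. ennreal (2 powr q) * (epowr (F1 z) q + epowr (F2 z) q) \<partial>lborel)"
      using q by (intro nn_integral_mono epowr_add_le) auto
    also have "\<dots> = ennreal (2 powr q) * ((\<integral>\<^sup>+z. epowr (F1 z) q \<partial>lborel) + (\<integral>\<^sup>+z. epowr (F2 z) q \<partial>lborel))"
      by (simp add: nn_integral_cmult nn_integral_add)
    also have "(\<integral>\<^sup>+z. epowr (F1 z) q \<partial>lborel) \<le> ?D"
      unfolding F1_def using q
      by (intro nn_integral_mono epowr_mono mult_right_mono ennreal_leI component_le_form_abs) auto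
    also have "(\<integral>\<^sup>+z. epowr (F2 z) q \<partial>lborel) \<le> ennreal A * ?D"
      using le unfolding F2_def .
    also have "?D + ennreal A * ?D = ennreal (1 + A) * ?D"
      using A by (simp add: distrib_right)
    also have "ennreal (B powr q) * (ennreal (2 powr q * K powr q) * (ennreal (2 powr q) * (ennreal (1 + A) * ?D))) = ennreal A' * ?D"
      using A by (simp add: A'_def ennreal_mult mult.assoc)
    finally have "(\<integral>\<^sup>+z. epowr (ennreal (cmod (f z - cauchy_average R C i h z)) * indicator (polydisc R (insert i J)) z) q \<partial>lborel) \<le> ennreal A' * ?D"
      by (simp add: mult_left_mono add_mono)
    then show "\<exists>h. partially_holomorphic R (insert i J) h \<and>
     (\<integral>\<^sup>+z. epowr (ennreal (cmod (f z - h z)) * indicator (polydisc R (insert i J)) z) q \<partial>lborel) \<le> ennreal A' * ?D"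
      using cauchy_average_partially_holomorphic[OF R h insert.hyps(2)] by blast
  qed
qed

section \<open>From a decomposition to the oscillation\<close>

lemma component_norm_le: "cmod (z $ j) \<le> norm (z :: complex ^ 'n)"
  by (rule Finite_Cartesian_Product.norm_nth_le)

lemma norm_le_sum_components: "norm (z :: complex ^ 'n) \<le> (\<Sum>j\<in>UNIV. cmod (z $ j))"
  by (simp add: norm_vec_def L2_set_le_sum)

lemma complex_linear_if_on_axes:
  fixes D :: "complex ^ 'n \<Rightarrow> complex"
  assumes "linear D" "\<And>j c. D (axis j c) = c * D (axis j 1)"
  shows "D (c *s v) = c * D v"
proof -
  have exp: "D v = (\<Sum>j\<in>UNIV. v $ j * D (axis j 1))" for v
  proof -
    have "v = (\<Sum>j\<in>UNIV. axis j (v $ j))"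
      by (simp add: vec_eq_iff axis_def sum.delta cong: if_cong)
    then have "D v = D (\<Sum>j\<in>UNIV. axis j (v $ j))" by (rule arg_cong)
    also have "\<dots> = (\<Sum>j\<in>UNIV. D (axis j (v $ j)))" by (rule linear_sum[OF assms(1)])
    also have "\<dots> = (\<Sum>j\<in>UNIV. v $ j * D (axis j 1))" by (rule sum.cong[OF refl assms(2)])
    finally show ?thesis .
  qed
  show ?thesis unfolding exp[of v] exp[of "c *s v"] by (simp add: sum_distrib_left mult.assoc)
qed

lemma form_abs_dbar_continuous:
  assumes "Ck_on 1 f UNIV"
  shows "continuous_on UNIV (\<lambda>y. form_abs (dbar f y))"
  unfolding form_abs_def by (intro continuous_on_sum continuous_on_norm dbar_component_continuous[OF assms])

text \<open>
  The ball with radius \<open>\<tau>\<close> lies in the polydisc with radii \<open>\<tau>\<close>, and the polydisc with radii \<open>3 \<tau>\<close> lies in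
  the ball with radius \<open>R\<close>. By translation one centre suffices.
\<close>

lemma dbar_ball_estimate:
  assumes t: "0 < \<tau>" and q: "1 \<le> q"
  shows "\<exists>A\<ge>0. \<exists>R>0. \<forall>(f :: complex ^ 'n \<Rightarrow> complex) a. Ck_on 1 f UNIV \<longrightarrow>
    (\<exists>h. holomorphic_Cn h (ball a \<tau>) \<and>
      I_ball q (\<lambda>w. f w - h w) a \<tau> \<le> ennreal A * I_ball q (\<lambda>w. form_abs (dbar f w)) a R)"
proof -
  from dbar_polydisc_estimate[OF t q, of "UNIV :: 'n set"] obtain A where
    *: "0 \<le> A \<and> (\<forall>f :: complex ^ 'n \<Rightarrow> complex. Ck_on 1 f UNIV \<longrightarrow> (\<exists>h. partially_holomorphic \<tau> UNIV h \<and>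
     (\<integral>\<^sup>+z. epowr (ennreal (cmod (f z - h z)) * indicator (polydisc \<tau> UNIV) z) q \<partial>lborel)
     \<le> ennreal A * (\<integral>\<^sup>+z. epowr (ennreal (form_abs (dbar f z)) * indicator (polydisc \<tau> {}) z) q \<partial>lborel)))" ..
  note A = conjunct1[OF *] and est = conjunct2[OF *, rule_format]
  define R where "R = 3 * \<tau> * real CARD('n)"
  have R: "0 < R" using t by (simp add: R_def)
  have "\<exists>h. holomorphic_Cn h (ball a \<tau>) \<and>
      I_ball q (\<lambda>w. f w - h w) a \<tau> \<le> ennreal A * I_ball q (\<lambda>w. form_abs (dbar f w)) a R"
    if f: "Ck_on 1 f UNIV" for f :: "complex ^ 'n \<Rightarrow> complex" and a
  proof -
    define fa where "fa = (\<lambda>z. f (a + z))"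
    have fa: "Ck_on 1 fa UNIV"
      unfolding fa_def by (rule Ck_on_affine[OF bounded_linear_ident f])
    have dfa: "dbar fa z = dbar f (a + z)" for z
    proof -
      have "f differentiable (at (a + z))" using f by simp
      from frechet_derivative_affine(2)[OF bounded_linear_ident this]
      have "frechet_derivative fa (at z) = frechet_derivative f (at (a + z))"
        unfolding fa_def by simp
      then show ?thesis by (simp only: dbar_def)
    qed
    from est[OF fa] obtain h0 where h0: "partially_holomorphic \<tau> UNIV h0 \<and>
     (\<integral>\<^sup>+z. epowr (ennreal (cmod (fa z - h0 z)) * indicator (polydisc \<tau> UNIV) z) q \<partial>lborel)
     \<le> ennreal A * (\<integral>\<^sup>+z. epowr (ennreal (form_abs (dbar fa z)) * indicator (polydisc \<tau> {}) z) q \<partial>lborel)" ..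
    from conjunct1[OF h0] obtain h' where h': "\<And>z. z \<in> Omega \<tau> UNIV \<Longrightarrow> (h0 has_derivative blinfun_apply (h' z)) (at z)"
      and lin: "\<And>z j c. z \<in> Omega \<tau> UNIV \<Longrightarrow> h' z (axis j c) = c * h' z (axis j 1)"
      unfolding partially_holomorphic_def by blast
    define h where "h = (\<lambda>w. h0 (w - a))"
    have shift: "w - a \<in> Omega \<tau> UNIV" "w - a \<in> polydisc \<tau> UNIV" if "w \<in> ball a \<tau>" for w
    proof -
      have "cmod ((w - a) $ j) < \<tau>" for j
        using component_norm_le[of "w - a" j] that by (simp add: dist_norm norm_minus_commute)
      then show "w - a \<in> Omega \<tau> UNIV" "w - a \<in> polydisc \<tau> UNIV" by (simp_all add: Omega_def polydisc_def)
    qed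
    have "holomorphic_Cn h (ball a \<tau>)"
      unfolding holomorphic_Cn_def
    proof
      fix w assume w: "w \<in> ball a \<tau>"
      note O = shift(1)[OF w]
      have "((\<lambda>w. w - a) has_derivative (\<lambda>v. v)) (at w)" by (auto intro!: derivative_eq_intros)
      from has_derivative_compose[OF this h'[OF O]]
      have "(h has_derivative blinfun_apply (h' (w - a))) (at w)" unfolding h_def .
      moreover have "h' (w - a) (c *s v) = c * h' (w - a) v" for c v
        by (rule complex_linear_if_on_axes[OF bounded_linear.linear[OF blinfun.bounded_linear_right] lin[OF O]])
      ultimately show "\<exists>D. (h has_derivative D) (at w) \<and> (\<forall>c v. D (c *s v) = c * D v)" by blast
    qed
    moreover have "I_ball q (\<lambda>w. f w - h w) a \<tau> \<le> ennreal A * I_ball q (\<lambda>w. form_abs (dbar f w)) a R"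
    proof -
      define E where "E = (\<lambda>z. epowr (ennreal (cmod (fa z - h0 z)) * indicator (polydisc \<tau> UNIV) z) q)"
      have E: "E \<in> borel_measurable borel"
        unfolding E_def by (rule measurable_compose[OF error_measurable[OF fa conjunct1[OF h0]] epowr_measurable])
      have "I_ball q (\<lambda>w. f w - h w) a \<tau> \<le> (\<integral>\<^sup>+w. E (w + (- a)) \<partial>lborel)"
        unfolding I_ball_def nn_integral_completion
      proof (rule nn_integral_mono)
        fix w
        show "ennreal (cmod (f w - h w) powr q) * indicator (ball a \<tau>) w \<le> E (w + - a)"
          using shift(2)[of w] by (auto simp: E_def fa_def h_def epowr_ennreal split: split_indicator)
      qed
      also have "\<dots> = (\<integral>\<^sup>+z. E z \<partial>lborel)" by (rule nn_integral_lborel_translate[OF E])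
      also have "\<dots> \<le> ennreal A * (\<integral>\<^sup>+z. epowr (ennreal (form_abs (dbar fa z)) * indicator (polydisc \<tau> {}) z) q \<partial>lborel)"
        using conjunct2[OF h0] unfolding E_def .
      also have "(\<integral>\<^sup>+z. epowr (ennreal (form_abs (dbar fa z)) * indicator (polydisc \<tau> {}) z) q \<partial>lborel)
        \<le> (\<integral>\<^sup>+z. ennreal (norm (form_abs (dbar f (z + a))) powr q) * indicator (ball a R) (z + a) \<partial>lborel)"
      proof (rule nn_integral_mono)
        fix z :: "complex ^ 'n"
        have "z + a \<in> ball a R" if z: "z \<in> polydisc \<tau> {}"
        proof -
          have "norm z \<le> (\<Sum>j\<in>UNIV. cmod (z $ j))" by (rule norm_le_sum_components)
          also have "\<dots> < (\<Sum>j\<in>(UNIV::'n set). 3 * \<tau>)"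
            using z by (intro sum_strict_mono) (auto simp: polydisc_def)
          finally show ?thesis by (simp add: R_def dist_norm mult.commute)
        qed
        then show "epowr (ennreal (form_abs (dbar fa z)) * indicator (polydisc \<tau> {}) z) q
          \<le> ennreal (norm (form_abs (dbar f (z + a))) powr q) * indicator (ball a R) (z + a)"
          by (cases "z \<in> polydisc \<tau> {}") (simp_all add: dfa epowr_ennreal form_abs_nonneg add.commute)
      qed
      also have "\<dots> = I_ball q (\<lambda>w. form_abs (dbar f w)) a R"
      proof -
        have m: "(\<lambda>w. form_abs (dbar f w)) \<in> borel_measurable borel"
          by (rule borel_measurable_continuous_onI[OF form_abs_dbar_continuous[OF f]])
        have "(\<lambda>w. ennreal (norm (form_abs (dbar f w)) powr q) * indicator (ball a R) w) \<in> borel_measurable borel"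
          using m by (intro borel_measurable_times_ennreal borel_measurable_indicator) auto
        from nn_integral_lborel_translate[OF this, of a] show ?thesis
          unfolding I_ball_def nn_integral_completion .
      qed
      finally show ?thesis by (simp add: mult_left_mono)
    qed
    ultimately show ?thesis by blast
  qed
  then show ?thesis using A R by blast
qed

lemma M_avg_add_le:
  fixes g1 :: "complex ^ 'n \<Rightarrow> 'b::real_normed_vector" and g2 :: "complex ^ 'n \<Rightarrow> 'c::real_normed_vector"
    and g :: "complex ^ 'n \<Rightarrow> 'd::real_normed_vector"
  assumes q: "1 \<le> q" and r: "0 < r"
    and m1: "(\<lambda>w. ennreal (norm (g1 w) powr q) * indicator (ball z r) w) \<in> borel_measurable lebesgue"
    and m2: "(\<lambda>w. ennreal (norm (g2 w) powr q) * indicator (ball z r) w) \<in> borel_measurable lebesgue"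
    and le: "AE w in lebesgue. w \<in> ball z r \<longrightarrow> norm (g w) \<le> norm (g1 w) + norm (g2 w)"
  shows "M_avg q r g z \<le> ennreal (2 * 2 powr (1 / q)) * (M_avg q r g1 z + M_avg q r g2 z)"
proof -
  have "I_ball q g z r \<le> (\<integral>\<^sup>+w. ennreal (2 powr q) * (ennreal (norm (g1 w) powr q) * indicator (ball z r) w
      + ennreal (norm (g2 w) powr q) * indicator (ball z r) w) \<partial>lebesgue)"
    unfolding I_ball_def
  proof (rule nn_integral_mono_AE)
    show "AE w in lebesgue. ennreal (norm (g w) powr q) * indicator (ball z r) w
       \<le> ennreal (2 powr q) * (ennreal (norm (g1 w) powr q) * indicator (ball z r) w
      + ennreal (norm (g2 w) powr q) * indicator (ball z r) w)"
      using le
    proof eventually_elim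
      case (elim w)
      show ?case
      proof (cases "w \<in> ball z r")
        case True
        then have "epowr (ennreal (norm (g w))) q \<le> epowr (ennreal (norm (g1 w)) + ennreal (norm (g2 w))) q"
          using elim q by (intro epowr_mono) (auto simp: ennreal_plus[symmetric] simp del: ennreal_plus)
        also have "\<dots> \<le> ennreal (2 powr q) * (epowr (ennreal (norm (g1 w))) q + epowr (ennreal (norm (g2 w))) q)"
          using q by (intro epowr_add_le) simp
        finally show ?thesis using True by (simp add: epowr_ennreal)
      qed simp
    qed
  qed
  also have "\<dots> = ennreal (2 powr q) * (I_ball q g1 z r + I_ball q g2 z r)"
    unfolding I_ball_def using m1 m2 by (subst nn_integral_cmult) (auto simp: nn_integral_add)
  finally have "epowr (I_ball q g z r) (1/q) \<le> epowr (ennreal (2 powr q) * (I_ball q g1 z r + I_ball q g2 z r)) (1/q)"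
    using q by (intro epowr_mono) auto
  also have "\<dots> = ennreal 2 * epowr (I_ball q g1 z r + I_ball q g2 z r) (1/q)"
    using q by (simp add: epowr_mult epowr_ennreal powr_powr)
  also have "\<dots> \<le> ennreal 2 * (ennreal (2 powr (1/q)) * (epowr (I_ball q g1 z r) (1/q) + epowr (I_ball q g2 z r) (1/q)))"
    using q by (intro mult_left_mono epowr_add_le) auto
  finally have "epowr (I_ball q g z r) (1/q) \<le> ennreal (2 * 2 powr (1/q)) * (epowr (I_ball q g1 z r) (1/q) + epowr (I_ball q g2 z r) (1/q))"
    by (simp add: ennreal_mult mult.assoc)
  then have "ennreal (ball_vol TYPE(complex ^ 'n) r powr (- 1 / q)) * epowr (I_ball q g z r) (1/q)
    \<le> ennreal (ball_vol TYPE(complex ^ 'n) r powr (- 1 / q)) * (ennreal (2 * 2 powr (1/q)) * (epowr (I_ball q g1 z r) (1/q) + epowr (I_ball q g2 z r) (1/q)))"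
    by (rule mult_left_mono) simp
  moreover have "0 < q" using q by simp
  ultimately show ?thesis
    unfolding M_avg_eq[OF \<open>0 < q\<close> r] by (simp only: distrib_left mult.left_commute)
qed

lemma G_dist_le:
  assumes t: "0 < \<tau>" and q: "1 \<le> q"
  shows "\<exists>C\<ge>0. \<exists>R>0. \<forall>(f :: complex ^ 'n \<Rightarrow> complex) f1 f2 z.
    Ck_on 1 f1 UNIV \<longrightarrow> f2 \<in> borel_measurable lebesgue \<longrightarrow> decomposes f f1 f2 \<longrightarrow>
    G_dist q \<tau> f z \<le> ennreal C * (M_form q R (dbar f1) z + M_avg q \<tau> f2 z)"
proof -
  from dbar_ball_estimate[OF t q, where 'n='n] obtain A where "0 \<le> A \<and> (\<exists>R>0. \<forall>(f :: complex ^ 'n \<Rightarrow> complex) a. Ck_on 1 f UNIV \<longrightarrow>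
    (\<exists>h. holomorphic_Cn h (ball a \<tau>) \<and>
      I_ball q (\<lambda>w. f w - h w) a \<tau> \<le> ennreal A * I_ball q (\<lambda>w. form_abs (dbar f w)) a R))" ..
  then obtain R where A: "0 \<le> A" and *: "0 < R \<and> (\<forall>(f :: complex ^ 'n \<Rightarrow> complex) a. Ck_on 1 f UNIV \<longrightarrow>
    (\<exists>h. holomorphic_Cn h (ball a \<tau>) \<and>
      I_ball q (\<lambda>w. f w - h w) a \<tau> \<le> ennreal A * I_ball q (\<lambda>w. form_abs (dbar f w)) a R))" by blast
  note R = conjunct1[OF *] and est = conjunct2[OF *, rule_format]
  have q0: "0 < q" using q by simp
  define vt vr where "vt = ball_vol TYPE(complex ^ 'n) \<tau>" and "vr = ball_vol TYPE(complex ^ 'n) R"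
  have v: "0 < vt" "0 < vr" unfolding vt_def vr_def using ball_vol_pos t R by auto
  define B where "B = vt powr (- 1 / q) * A powr (1 / q) * vr powr (1 / q)"
  have B: "0 \<le> B" by (simp add: B_def)
  define C where "C = 2 * 2 powr (1 / q) * max 1 B"
  have "G_dist q \<tau> f z \<le> ennreal C * (M_form q R (dbar f1) z + M_avg q \<tau> f2 z)"
    if f1: "Ck_on 1 f1 UNIV" and f2: "f2 \<in> borel_measurable lebesgue" and dec: "decomposes f f1 f2"
    for f f1 f2 :: "complex ^ 'n \<Rightarrow> complex" and z
  proof -
    from est[OF f1, of z] obtain h where h: "holomorphic_Cn h (ball z \<tau>)"
      and le: "I_ball q (\<lambda>w. f1 w - h w) z \<tau> \<le> ennreal A * I_ball q (\<lambda>w. form_abs (dbar f1 w)) z R" by blast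
    have "M_avg q \<tau> (\<lambda>w. f1 w - h w) z \<le> ennreal (vt powr (- 1 / q)) * epowr (ennreal A * I_ball q (\<lambda>w. form_abs (dbar f1 w)) z R) (1/q)"
      unfolding M_avg_eq[OF q0 t] vt_def using le q by (intro mult_left_mono epowr_mono) auto
    also have "\<dots> = ennreal (vt powr (- 1 / q)) * (ennreal (A powr (1/q)) * epowr (I_ball q (\<lambda>w. form_abs (dbar f1 w)) z R) (1/q))"
      using A q by (simp add: epowr_mult epowr_ennreal)
    also have "\<dots> = ennreal B * M_form q R (dbar f1) z"
    proof -
      have "vr powr (1 / q) * vr powr (- 1 / q) = 1"
        using v by (simp add: powr_add[symmetric])
      then have inv: "ennreal (vr powr (1 / q)) * (ennreal (vr powr (- 1 / q)) * x) = x" for x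
        by (simp add: mult.assoc[symmetric] ennreal_mult[symmetric])
      note [simp del] = minus_divide_left minus_divide_left[symmetric] divide_minus_left
      show ?thesis
        unfolding M_form_def M_avg_eq[OF q0 R] B_def vr_def[symmetric]
        by (simp add: ennreal_mult mult.assoc inv)
    qed
    finally have 1: "M_avg q \<tau> (\<lambda>w. f1 w - h w) z \<le> ennreal B * M_form q R (dbar f1) z" .
    have m1: "(\<lambda>w. ennreal (norm (f1 w - h w) powr q) * indicator (ball z \<tau>) w) \<in> borel_measurable lebesgue"
    proof -
      have "continuous_on UNIV f1" using Ck_on_Suc_D[of 0 f1 UNIV] f1 by simp
      then have "continuous_on (ball z \<tau>) (\<lambda>w. f1 w - h w)"
        using continuous_on_diff[OF continuous_on_subset[OF _ subset_UNIV] holomorphic_Cn_continuous[OF h]] by blast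
      then have "(\<lambda>w. indicator (ball z \<tau>) w *\<^sub>R (f1 w - h w)) \<in> borel_measurable borel"
        by (intro borel_measurable_continuous_on_indicator) simp_all
      then have "(\<lambda>w. indicator (ball z \<tau>) w *\<^sub>R (f1 w - h w)) \<in> borel_measurable lebesgue"
        by (intro measurable_completion) simp
      from measurable_powr_ennreal[OF this]
      have "(\<lambda>w. ennreal (norm (indicator (ball z \<tau>) w *\<^sub>R (f1 w - h w)) powr q)) \<in> borel_measurable lebesgue" .
      moreover have "ennreal (norm (indicator (ball z \<tau>) w *\<^sub>R (f1 w - h w)) powr q)
         = ennreal (norm (f1 w - h w) powr q) * indicator (ball z \<tau>) w" for w
        using q by (simp split: split_indicator)
      ultimately show ?thesis by (simp only:)
    qed
    have m2: "(\<lambda>w. ennreal (norm (f2 w) powr q) * indicator (ball z \<tau>) w) \<in> borel_measurable lebesgue"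
      by (intro borel_measurable_times_ennreal measurable_powr_ennreal f2 borel_measurable_indicator) simp
    have "G_dist q \<tau> f z \<le> M_avg q \<tau> (\<lambda>w. f w - h w) z"
      unfolding G_dist_def by (rule INF_lower) (simp add: h)
    also have "\<dots> \<le> ennreal (2 * 2 powr (1 / q)) * (M_avg q \<tau> (\<lambda>w. f1 w - h w) z + M_avg q \<tau> f2 z)"
    proof (rule M_avg_add_le[OF q t m1 m2])
      show "AE w in lebesgue. w \<in> ball z \<tau> \<longrightarrow> norm (f w - h w) \<le> norm (f1 w - h w) + norm (f2 w)"
        using dec[unfolded decomposes_def]
      proof eventually_elim
        case (elim w)
        then have "f w - h w = (f1 w - h w) + f2 w" by simp
        then show ?case by (simp only: norm_triangle_ineq simp_thms)
      qed
    qed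
    also have "\<dots> \<le> ennreal (2 * 2 powr (1 / q)) * (ennreal (max 1 B) * M_form q R (dbar f1) z + ennreal (max 1 B) * M_avg q \<tau> f2 z)"
    proof (intro mult_left_mono add_mono)
      show "M_avg q \<tau> (\<lambda>w. f1 w - h w) z \<le> ennreal (max 1 B) * M_form q R (dbar f1) z"
        by (rule order_trans[OF 1]) (intro mult_right_mono ennreal_leI, simp_all)
      have "1 * M_avg q \<tau> f2 z \<le> ennreal (max 1 B) * M_avg q \<tau> f2 z"
        by (intro mult_right_mono) (simp_all add: one_ennreal.rep_eq ennreal_1[symmetric] ennreal_leI del: ennreal_1)
      then show "M_avg q \<tau> f2 z \<le> ennreal (max 1 B) * M_avg q \<tau> f2 z" by simp
    qed simp
    also have "\<dots> = ennreal C * (M_form q R (dbar f1) z + M_avg q \<tau> f2 z)"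
      by (simp add: C_def ennreal_mult distrib_left mult.assoc)
    finally show ?thesis .
  qed
  moreover have "0 \<le> C" using B by (simp add: C_def)
  ultimately show ?thesis using R by blast
qed

lemma Ls_norm_M_avg_radius:
  assumes "0 < q" "0 < s" "0 < R" "0 < r"
  shows "\<exists>C\<ge>0. \<forall>g :: complex ^ 'n \<Rightarrow> 'b::{real_normed_vector,second_countable_topology}.
    g \<in> borel_measurable lebesgue \<longrightarrow> Ls_norm s (M_avg q R g) \<le> ennreal C * Ls_norm s (M_avg q r g)"
proof -
  have "\<exists>C I. 0 \<le> C \<and> finite I \<and> (\<forall>(f :: complex ^ 'n \<Rightarrow> 'b) z. f \<in> borel_measurable lebesgue \<longrightarrow>
      M_avg q R f z \<le> ennreal C * (\<Sum>a\<in>I. M_avg q r f (z + a)))"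
    by (rule M_avg_radius[OF assms(1,3,4), where ?'b='b and ?'n='n]) blast
  then obtain C I where C: "0 \<le> C" "finite I" and *: "\<forall>(f :: complex ^ 'n \<Rightarrow> 'b) z. f \<in> borel_measurable lebesgue \<longrightarrow>
      M_avg q R f z \<le> ennreal C * (\<Sum>a\<in>I. M_avg q r f (z + a))"
    by (elim exE conjE)
  show ?thesis
  proof (intro exI[of _ "C * (real (card I))^2 * real (card I) powr (1/s)"] conjI allI impI)
    show "0 \<le> C * (real (card I))^2 * real (card I) powr (1/s)" using C by simp
    fix g :: "complex ^ 'n \<Rightarrow> 'b" assume g: "g \<in> borel_measurable lebesgue"
    show "Ls_norm s (M_avg q R g) \<le> ennreal (C * (real (card I))^2 * real (card I) powr (1/s)) * Ls_norm s (M_avg q r g)"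
      by (rule Ls_norm_le_translates[OF assms(2) C M_avg_measurable[OF g assms(1,4)] *[rule_format, OF g]])
  qed
qed

lemma form_abs_dbar_measurable:
  assumes "Ck_on 1 f UNIV"
  shows "(\<lambda>y. form_abs (dbar f y)) \<in> borel_measurable lebesgue"
  by (intro measurable_completion) (simp add: borel_measurable_continuous_onI[OF form_abs_dbar_continuous[OF assms]])

lemma Ck_2_imp_Ck_on_1: "Ck 2 f \<Longrightarrow> Ck_on 1 f UNIV"
  unfolding Ck_on_UNIV[symmetric] numeral_2_eq_2 One_nat_def by (rule Ck_on_Suc_D)

lemma decomposes_measurable:
  assumes "f \<in> L_loc q" "Ck_on 1 f1 UNIV" "decomposes f f1 f2"
  shows "f2 \<in> borel_measurable lebesgue"
proof -
  have "f \<in> borel_measurable lebesgue" using assms(1) by (simp add: L_loc_def)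
  moreover have "f1 \<in> borel_measurable lebesgue"
    using Ck_on_Suc_D[of 0 f1 UNIV] assms(2)
    by (intro measurable_completion) (simp add: borel_measurable_continuous_onI)
  ultimately have "(\<lambda>z. f z - f1 z) \<in> borel_measurable lebesgue" by (rule borel_measurable_diff)
  moreover have "AE z in lborel. f z - f1 z = f2 z"
    using assms(3) unfolding decomposes_def AE_completion_iff by eventually_elim simp
  ultimately show ?thesis by (rule measurable_lebesgue_cong_AE)
qed

lemma star_cond_iff:
  assumes "1 \<le> q" "0 < s" "0 < r" "f2 \<in> borel_measurable lebesgue"
  shows "star_cond s q r f1 f2 \<longleftrightarrow>
    Ck 2 f1 \<and> Ls_norm s (M_form q r (dbar f1)) < \<infinity> \<and> Ls_norm s (M_avg q r f2) < \<infinity>"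
proof (cases "Ck 2 f1")
  case True
  have q: "0 < q" using assms by simp
  have m1: "M_form q r (dbar f1) \<in> borel_measurable lebesgue"
    unfolding M_form_def by (rule M_avg_measurable[OF form_abs_dbar_measurable[OF Ck_2_imp_Ck_on_1[OF True]] q assms(3)])
  have m2: "M_avg q r f2 \<in> borel_measurable lebesgue"
    by (rule M_avg_measurable[OF assms(4) q assms(3)])
  show ?thesis
  proof
    assume "star_cond s q r f1 f2"
    then have "Ls_norm s (\<lambda>z. M_form q r (dbar f1) z + M_avg q r f2 z) < \<infinity>"
      unfolding star_cond_def in_Ls_def by blast
    moreover have "Ls_norm s (M_form q r (dbar f1)) \<le> Ls_norm s (\<lambda>z. M_form q r (dbar f1) z + M_avg q r f2 z)"
      by (rule Ls_norm_mono[OF _ assms(2)]) simp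
    moreover have "Ls_norm s (M_avg q r f2) \<le> Ls_norm s (\<lambda>z. M_form q r (dbar f1) z + M_avg q r f2 z)"
      by (rule Ls_norm_mono[OF _ assms(2)]) simp
    ultimately show "Ck 2 f1 \<and> Ls_norm s (M_form q r (dbar f1)) < \<infinity> \<and> Ls_norm s (M_avg q r f2) < \<infinity>"
      using True le_less_trans by blast
  next
    assume *: "Ck 2 f1 \<and> Ls_norm s (M_form q r (dbar f1)) < \<infinity> \<and> Ls_norm s (M_avg q r f2) < \<infinity>"
    have "ennreal (2 * 2 powr (1/s)) * (Ls_norm s (M_form q r (dbar f1)) + Ls_norm s (M_avg q r f2)) < \<infinity>"
      using * by (simp add: ennreal_mult_less_top)
    with Ls_norm_add_le[OF assms(2) m1 m2]
    have "Ls_norm s (\<lambda>z. M_form q r (dbar f1) z + M_avg q r f2 z) < \<infinity>" by (rule le_less_trans)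
    then show "star_cond s q r f1 f2"
      unfolding star_cond_def in_Ls_def using True m1 m2 by (blast intro: borel_measurable_add)
  qed
qed (simp add: star_cond_def)

lemma star_cond_radius:
  fixes f1 f2 :: "complex ^ 'n \<Rightarrow> complex"
  assumes q: "1 \<le> q" and s: "0 < s" and "0 < r" "0 < R" and f2: "f2 \<in> borel_measurable lebesgue" and "star_cond s q r f1 f2"
  shows "star_cond s q R f1 f2"
proof -
  have q0: "0 < q" using q by simp
  have *: "Ck 2 f1" "Ls_norm s (M_form q r (dbar f1)) < \<infinity>" "Ls_norm s (M_avg q r f2) < \<infinity>"
    using star_cond_iff[OF q s \<open>0 < r\<close> f2] assms(6) by blast+
  have larger_radius: "Ls_norm s (M_avg q R g) < \<infinity>" if g: "g \<in> borel_measurable lebesgue" and fin: "Ls_norm s (M_avg q r g) < \<infinity>"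
    for g :: "complex ^ 'n \<Rightarrow> 'b::{real_normed_vector,second_countable_topology}"
  proof -
    obtain C where "Ls_norm s (M_avg q R g) \<le> ennreal C * Ls_norm s (M_avg q r g)"
      using Ls_norm_M_avg_radius[OF q0 s \<open>0 < R\<close> \<open>0 < r\<close>, where ?'b='b and ?'n='n] g by blast
    also have "\<dots> < \<infinity>" using fin by (simp add: ennreal_mult_less_top)
    finally show ?thesis .
  qed
  show ?thesis
    unfolding star_cond_iff[OF q s \<open>0 < R\<close> f2] M_form_def
    using *(1) larger_radius[OF form_abs_dbar_measurable[OF Ck_2_imp_Ck_on_1[OF *(1)]]] larger_radius[OF f2] *(2,3)
    unfolding M_form_def by blast
qed

text \<open>
  Each admissible decomposition gives the same bound, which therefore passes to the infimum.
\<close>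

lemma Ls_norm_G_dist_le_decomp_inf:
  assumes q: "1 \<le> q" and s: "0 < s" and t: "0 < \<tau>" and r: "0 < r"
  shows "\<exists>C>0. \<forall>f \<in> (L_loc q :: (complex ^ 'n \<Rightarrow> complex) set).
    Ls_norm s (G_dist q \<tau> f) \<le> ennreal C * decomp_inf s q r f"
proof -
  have q0: "0 < q" using q by simp
  from G_dist_le[OF t q, where 'n='n] obtain C0 R where C0: "0 \<le> C0" and R: "0 < R"
    and G: "\<forall>(f :: complex ^ 'n \<Rightarrow> complex) f1 f2 z.
    Ck_on 1 f1 UNIV \<longrightarrow> f2 \<in> borel_measurable lebesgue \<longrightarrow> decomposes f f1 f2 \<longrightarrow>
    G_dist q \<tau> f z \<le> ennreal C0 * (M_form q R (dbar f1) z + M_avg q \<tau> f2 z)"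
    by (elim exE conjE)
  from Ls_norm_M_avg_radius[OF q0 s R r, where ?'b=real and ?'n='n] obtain C1 where C1: "0 \<le> C1"
    and r1: "\<forall>g :: complex ^ 'n \<Rightarrow> real. g \<in> borel_measurable lebesgue \<longrightarrow> Ls_norm s (M_avg q R g) \<le> ennreal C1 * Ls_norm s (M_avg q r g)"
    by (elim exE conjE)
  from Ls_norm_M_avg_radius[OF q0 s t r, where ?'b=complex and ?'n='n] obtain C2 where C2: "0 \<le> C2"
    and r2: "\<forall>g :: complex ^ 'n \<Rightarrow> complex. g \<in> borel_measurable lebesgue \<longrightarrow> Ls_norm s (M_avg q \<tau> g) \<le> ennreal C2 * Ls_norm s (M_avg q r g)"
    by (elim exE conjE)
  define B where "B = C0 * 2 * 2 powr (1/s)"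
  define C where "C = B * (C1 + C2) + 1"
  have B: "0 \<le> B" using C0 by (simp add: B_def)
  have C: "0 < C" using B C1 C2 by (simp add: C_def add_nonneg_pos)
  have main: "Ls_norm s (G_dist q \<tau> f) \<le> ennreal C * (Ls_norm s (M_form q r (dbar f1)) + Ls_norm s (M_avg q r f2))"
    if f: "f \<in> L_loc q" and dec: "decomposes f f1 f2" and star: "star_cond s q r f1 f2" for f f1 f2 :: "complex ^ 'n \<Rightarrow> complex"
  proof -
    have c1: "Ck_on 1 f1 UNIV" using star by (intro Ck_2_imp_Ck_on_1) (simp add: star_cond_def)
    have f2: "f2 \<in> borel_measurable lebesgue" by (rule decomposes_measurable[OF f c1 dec])
    have m1: "M_form q R (dbar f1) \<in> borel_measurable lebesgue"
      unfolding M_form_def by (rule M_avg_measurable[OF form_abs_dbar_measurable[OF c1] q0 R])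
    have m2: "M_avg q \<tau> f2 \<in> borel_measurable lebesgue" by (rule M_avg_measurable[OF f2 q0 t])
    let ?H = "\<lambda>b. if b then M_form q R (dbar f1) else M_avg q \<tau> f2"
    have "Ls_norm s (G_dist q \<tau> f) \<le> ennreal (C0 * real (card (UNIV :: bool set)) * real (card (UNIV :: bool set)) powr (1/s))
        * (\<Sum>b\<in>UNIV. Ls_norm s (?H b))"
    proof (rule Ls_norm_le_sum[OF s C0])
      show "?H b \<in> borel_measurable lebesgue" for b using m1 m2 by simp
      show "G_dist q \<tau> f z \<le> ennreal C0 * (\<Sum>b\<in>UNIV. ?H b z)" for z
        using G[rule_format, OF c1 f2 dec, of z] by (simp add: UNIV_bool add.commute)
    qed simp
    then have "Ls_norm s (G_dist q \<tau> f) \<le> ennreal B * (Ls_norm s (M_form q R (dbar f1)) + Ls_norm s (M_avg q \<tau> f2))"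
      by (simp add: UNIV_bool B_def add.commute)
    also have "\<dots> \<le> ennreal B * (ennreal (C1 + C2) * Ls_norm s (M_form q r (dbar f1)) + ennreal (C1 + C2) * Ls_norm s (M_avg q r f2))"
    proof (intro mult_left_mono add_mono)
      have "Ls_norm s (M_form q R (dbar f1)) \<le> ennreal C1 * Ls_norm s (M_form q r (dbar f1))"
        unfolding M_form_def by (rule r1[rule_format, OF form_abs_dbar_measurable[OF c1]])
      also have "\<dots> \<le> ennreal (C1 + C2) * Ls_norm s (M_form q r (dbar f1))"
        using C2 by (intro mult_right_mono ennreal_leI) auto
      finally show "Ls_norm s (M_form q R (dbar f1)) \<le> ennreal (C1 + C2) * Ls_norm s (M_form q r (dbar f1))" .
      have "Ls_norm s (M_avg q \<tau> f2) \<le> ennreal C2 * Ls_norm s (M_avg q r f2)"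
        by (rule r2[rule_format, OF f2])
      also have "\<dots> \<le> ennreal (C1 + C2) * Ls_norm s (M_avg q r f2)"
        using C1 by (intro mult_right_mono ennreal_leI) auto
      finally show "Ls_norm s (M_avg q \<tau> f2) \<le> ennreal (C1 + C2) * Ls_norm s (M_avg q r f2)" .
    qed simp
    also have "\<dots> = ennreal (B * (C1 + C2)) * (Ls_norm s (M_form q r (dbar f1)) + Ls_norm s (M_avg q r f2))"
    proof -
      have "0 \<le> C1 + C2" using C1 C2 by simp
      then show ?thesis unfolding ennreal_mult[OF B \<open>0 \<le> C1 + C2\<close>] by (simp only: distrib_left mult.assoc)
    qed
    also have "\<dots> \<le> ennreal C * (Ls_norm s (M_form q r (dbar f1)) + Ls_norm s (M_avg q r f2))"
      by (intro mult_right_mono ennreal_leI) (simp_all add: C_def)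
    finally show ?thesis .
  qed
  have "Ls_norm s (G_dist q \<tau> f) \<le> ennreal C * decomp_inf s q r f" if f: "f \<in> L_loc q" for f :: "complex ^ 'n \<Rightarrow> complex"
  proof -
    have inv: "ennreal (inverse C) * (ennreal C * x) = x" "ennreal C * (ennreal (inverse C) * x) = x" for x
      using C by (simp_all add: mult.assoc[symmetric] ennreal_mult[symmetric])
    have "ennreal (inverse C) * Ls_norm s (G_dist q \<tau> f) \<le> decomp_inf s q r f"
      unfolding decomp_inf_def
    proof (rule INF_greatest)
      fix p assume p: "p \<in> {(f1, f2). decomposes f f1 f2 \<and> star_cond s q r f1 f2}"
      obtain f1 f2 where pp: "p = (f1, f2)" by (cases p)
      have "ennreal (inverse C) * Ls_norm s (G_dist q \<tau> f)
        \<le> ennreal (inverse C) * (ennreal C * (Ls_norm s (M_form q r (dbar f1)) + Ls_norm s (M_avg q r f2)))"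
        using p pp by (intro mult_left_mono main[OF f]) auto
      then show "ennreal (inverse C) * Ls_norm s (G_dist q \<tau> f)
        \<le> (case p of (f1, f2) \<Rightarrow> Ls_norm s (M_form q r (dbar f1)) + Ls_norm s (M_avg q r f2))"
        unfolding inv pp by simp
    qed
    then have "ennreal C * (ennreal (inverse C) * Ls_norm s (G_dist q \<tau> f)) \<le> ennreal C * decomp_inf s q r f"
      by (rule mult_left_mono) simp
    then show ?thesis unfolding inv .
  qed
  then show ?thesis using C by blast
qed

section \<open>A partition of unity on a cubic lattice\<close>

text \<open>
  Its integer translates form a partition of unity of the real line, since their sum telescopes.
\<close>

definition bump :: "real \<Rightarrow> real" where "bump x = smooth_step x - smooth_step (x - 1)"

lemma bump_eq_0: "x \<le> 0 \<or> 4 \<le> x \<Longrightarrow> bump x = 0"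
  by (auto simp: bump_def smooth_step_eq_0 smooth_step_eq_1)

lemma bump_abs_le: "\<bar>bump x\<bar> \<le> 1"
  using smooth_step_bounds[of x] smooth_step_bounds[of "x - 1"] by (auto simp: bump_def)

lemma bump_telescope: "a \<le> c \<Longrightarrow> (\<Sum>m\<in>{a..c}. bump (x - real_of_int m)) = smooth_step (x - real_of_int a) - smooth_step (x - real_of_int c - 1)"
proof (induction c rule: int_ge_induct)
  case base
  then show ?case by (simp add: bump_def)
next
  case (step c)
  have "{a..c + 1} = insert (c + 1) {a..c}" using step(1) by auto
  then show ?case using step by (simp add: bump_def algebra_simps)
qed

definition coord :: "real \<Rightarrow> 'a::euclidean_space \<Rightarrow> 'a \<Rightarrow> real" where
  "coord \<delta> b z = z \<bullet> ((1 / \<delta>) *\<^sub>R b)"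

text \<open>
  A function of one real variable, composed with a linear functional: differentiation produces a
  constant factor and the derivative of the profile.
\<close>

lemma Ck_on_profile_Suc:
  fixes a :: "'a::euclidean_space"
  assumes "\<And>x. (E has_field_derivative E1 x) (at x)" "Ck_on k (\<lambda>z. complex_of_real (E1 (z \<bullet> a - c))) UNIV"
  shows "Ck_on (Suc k) (\<lambda>z. complex_of_real (E (z \<bullet> a - c))) UNIV"
proof (rule Ck_on_SucI)
  fix z :: 'a
  have "((\<lambda>z. z \<bullet> a - c) has_derivative (\<lambda>v. v \<bullet> a)) (at z)"
    by (auto intro!: derivative_eq_intros)
  from has_derivative_compose[OF this assms(1)[unfolded has_field_derivative_def]]
  have "((\<lambda>z. E (z \<bullet> a - c)) has_derivative (\<lambda>v. E1 (z \<bullet> a - c) * (v \<bullet> a))) (at z)" .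
  then have "((\<lambda>z. complex_of_real (E (z \<bullet> a - c))) has_derivative (\<lambda>v. complex_of_real (E1 (z \<bullet> a - c) * (v \<bullet> a)))) (at z)"
    by (rule has_derivative_of_real)
  then show "((\<lambda>z. complex_of_real (E (z \<bullet> a - c))) has_derivative
      (\<lambda>v. complex_of_real (E1 (z \<bullet> a - c)) * complex_of_real (v \<bullet> a))) (at z)"
    by (simp only: of_real_mult)
next
  show "Ck_on k (\<lambda>z. complex_of_real (E1 (z \<bullet> a - c)) * complex_of_real (v \<bullet> a)) UNIV" for v
    by (intro Ck_on_mult assms(2) Ck_on_const open_UNIV)
qed simp

lemma bump_profile_C2: "Ck_on 2 (\<lambda>z :: 'a::euclidean_space. complex_of_real (bump (z \<bullet> a - c))) UNIV"
proof -
  have e1: "(bump has_field_derivative (smooth_step1 x - smooth_step1 (x - 1))) (at x)" for x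
  proof -
    have "((\<lambda>x. x - 1) has_field_derivative 1) (at x)" by (auto intro!: derivative_eq_intros)
    from DERIV_diff[OF smooth_step_deriv DERIV_chain2[OF smooth_step_deriv this]]
    show ?thesis by (simp add: bump_def[abs_def])
  qed
  have e2: "((\<lambda>x. smooth_step1 x - smooth_step1 (x - 1)) has_field_derivative (smooth_step2 x - smooth_step2 (x - 1))) (at x)" for x
  proof -
    have "((\<lambda>x. x - 1) has_field_derivative 1) (at x)" by (auto intro!: derivative_eq_intros)
    from DERIV_diff[OF smooth_step1_deriv DERIV_chain2[OF smooth_step1_deriv this]]
    show ?thesis by simp
  qed
  have "Ck_on 0 (\<lambda>z :: 'a. complex_of_real (smooth_step2 (z \<bullet> a - c) - smooth_step2 (z \<bullet> a - c - 1))) UNIV"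
    unfolding Ck_on.simps(1)
    by (intro continuous_on_of_real continuous_on_diff continuous_on_compose2[OF smooth_step2_continuous] continuous_on_inner
        continuous_on_id continuous_on_const subset_UNIV)
  from Ck_on_profile_Suc[OF e1 Ck_on_profile_Suc[OF e2 this]] show ?thesis by (simp only: numeral_2_eq_2)
qed

text \<open>
  The lattice points are indexed by the integer vectors \<open>g\<close>, given as functions on the standard basis. The
  value is real; complex values spare coercions in the products with holomorphic functions.
\<close>

definition lattice_bump :: "real \<Rightarrow> (complex ^ 'n \<Rightarrow> int) \<Rightarrow> complex ^ 'n \<Rightarrow> complex" where
  "lattice_bump \<delta> g z = (\<Prod>b\<in>Basis. complex_of_real (bump (coord \<delta> b z - real_of_int (g b))))"

definition cube :: "real \<Rightarrow> (complex ^ 'n \<Rightarrow> int) \<Rightarrow> (complex ^ 'n) set" where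
  "cube \<delta> g = {z. \<forall>b\<in>Basis. 0 \<le> coord \<delta> b z - real_of_int (g b) \<and> coord \<delta> b z - real_of_int (g b) \<le> 4}"

text \<open>
  All indices of lattice points at distance at most \<open>L\<close> from the cell of \<open>z\<close>, in the maximum norm.
\<close>

definition near :: "int \<Rightarrow> real \<Rightarrow> complex ^ 'n \<Rightarrow> (complex ^ 'n \<Rightarrow> int) set" where
  "near L \<delta> z = (\<Pi>\<^sub>E b\<in>Basis. {\<lfloor>coord \<delta> b z\<rfloor> - L..\<lfloor>coord \<delta> b z\<rfloor> + L})"

lemma lattice_bump_C2: "Ck_on 2 (lattice_bump \<delta> g) UNIV"
  unfolding lattice_bump_def[abs_def] coord_def by (intro Ck_on_prod bump_profile_C2 open_UNIV)

lemma lattice_bump_C1: "Ck_on 1 (lattice_bump \<delta> g) UNIV"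
  using Ck_on_Suc_D[of 1 "lattice_bump \<delta> g" UNIV] lattice_bump_C2[of \<delta> g] by (simp add: numeral_2_eq_2)

lemma lattice_bump_norm_le: "cmod (lattice_bump \<delta> g z) \<le> 1"
  unfolding lattice_bump_def prod_norm[symmetric] norm_of_real by (intro prod_le_1) (simp add: bump_abs_le)

lemma lattice_bump_support:
  assumes "lattice_bump \<delta> g z \<noteq> 0" "b \<in> Basis"
  shows "0 < coord \<delta> b z - real_of_int (g b)" "coord \<delta> b z - real_of_int (g b) < 4"
proof -
  have "bump (coord \<delta> b z - real_of_int (g b)) \<noteq> 0"
    using assms by (auto simp: lattice_bump_def)
  then show "0 < coord \<delta> b z - real_of_int (g b)" "coord \<delta> b z - real_of_int (g b) < 4"
    using bump_eq_0[of "coord \<delta> b z - real_of_int (g b)"] by linarith+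
qed

lemma lattice_bump_outside_cube: "z \<notin> cube \<delta> g \<Longrightarrow> lattice_bump \<delta> g z = 0"
proof (rule ccontr)
  assume z: "z \<notin> cube \<delta> g" and "lattice_bump \<delta> g z \<noteq> 0"
  from lattice_bump_support[OF this(2)] have "z \<in> cube \<delta> g"
    unfolding cube_def mem_Collect_eq by (simp add: less_imp_le)
  with z show False by simp
qed

lemma finite_near: "finite (near L \<delta> z)"
  unfolding near_def by (intro finite_PiE) auto

lemma coord_continuous: "continuous_on S (coord \<delta> b)"
  unfolding coord_def[abs_def] by (intro continuous_intros)

lemma closed_cube: "closed (cube \<delta> g :: (complex ^ 'n) set)"
proof -
  have "cube \<delta> g = (\<Inter>b\<in>Basis. {z. real_of_int (g b) \<le> coord \<delta> b z} \<inter> {z :: complex ^ 'n. coord \<delta> b z \<le> real_of_int (g b) + 4})"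
    unfolding cube_def by (auto simp: algebra_simps)
  moreover have "closed ({z. real_of_int (g b) \<le> coord \<delta> b z} \<inter> {z :: complex ^ 'n. coord \<delta> b z \<le> real_of_int (g b) + 4})" for b
    by (intro closed_Int closed_Collect_le coord_continuous continuous_on_const)
  ultimately show ?thesis by (simp only:) (rule closed_INT, blast)
qed

definition nbhd :: "real \<Rightarrow> complex ^ 'n \<Rightarrow> (complex ^ 'n) set" where
  "nbhd \<delta> z0 = {z. \<forall>b\<in>Basis. \<bar>coord \<delta> b z - coord \<delta> b z0\<bar> < 1}"

lemma open_nbhd: "open (nbhd \<delta> z0 :: (complex ^ 'n) set)"
proof -
  have "nbhd \<delta> z0 = (\<Inter>b\<in>Basis. {z :: complex ^ 'n. \<bar>coord \<delta> b z - coord \<delta> b z0\<bar> < 1})"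
    unfolding nbhd_def by blast
  moreover have "open {z :: complex ^ 'n. \<bar>coord \<delta> b z - coord \<delta> b z0\<bar> < 1}" for b
    by (intro open_Collect_less continuous_on_rabs continuous_on_diff coord_continuous continuous_on_const)
  ultimately show ?thesis by (simp only:) (rule open_INT, auto)
qed

lemma nbhd_self: "z \<in> nbhd \<delta> z" by (simp add: nbhd_def)

text \<open>
  The bumps that do not vanish at \<open>z\<close> have indices at distance at most \<open>4\<close>; the additional \<open>1\<close> makes the same
  finite index set work for all points near \<open>z0\<close>.
\<close>

lemma lattice_bump_near:
  fixes z z0 :: "complex ^ 'n"
  assumes "lattice_bump \<delta> g z \<noteq> 0" "g \<in> extensional Basis" "z \<in> nbhd \<delta> z0"
  shows "g \<in> near 5 \<delta> z0"
proof -
  have "g b \<in> {\<lfloor>coord \<delta> b z0\<rfloor> - 5..\<lfloor>coord \<delta> b z0\<rfloor> + 5}" if b: "b \<in> Basis" for b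
  proof -
    have "0 < coord \<delta> b z - real_of_int (g b)" "coord \<delta> b z - real_of_int (g b) < 4" "\<bar>coord \<delta> b z - coord \<delta> b z0\<bar> < 1"
      using lattice_bump_support[OF assms(1) b] assms(3) b by (auto simp: nbhd_def)
    then show ?thesis unfolding atLeastAtMost_iff by linarith
  qed
  then show ?thesis unfolding near_def PiE_def Pi_def using assms(2) by blast
qed

lemma near_extensional: "g \<in> near L \<delta> z \<Longrightarrow> g \<in> extensional Basis"
  unfolding near_def by (simp add: PiE_def)

lemma lattice_bump_partition_of_unity:
  fixes z z0 :: "complex ^ 'n"
  assumes "z \<in> nbhd \<delta> z0"
  shows "(\<Sum>g\<in>near 5 \<delta> z0. lattice_bump \<delta> g z) = 1"
proof -
  have "(\<Sum>g\<in>near 5 \<delta> z0. lattice_bump \<delta> g z)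
    = (\<Prod>b\<in>Basis. \<Sum>m\<in>{\<lfloor>coord \<delta> b z0\<rfloor> - 5..\<lfloor>coord \<delta> b z0\<rfloor> + 5}. complex_of_real (bump (coord \<delta> b z - real_of_int m)))"
    unfolding near_def lattice_bump_def by (rule prod_sum_PiE[symmetric]) auto
  also have "\<dots> = (\<Prod>b\<in>(Basis :: (complex ^ 'n) set). 1)"
  proof (rule prod.cong[OF refl])
    fix b :: "complex ^ 'n" assume b: "b \<in> Basis"
    then have near: "\<bar>coord \<delta> b z - coord \<delta> b z0\<bar> < 1" using assms by (simp add: nbhd_def)
    let ?a = "\<lfloor>coord \<delta> b z0\<rfloor> - 5" and ?c = "\<lfloor>coord \<delta> b z0\<rfloor> + 5"
    have "3 \<le> coord \<delta> b z - real_of_int ?a" "coord \<delta> b z - real_of_int ?c - 1 \<le> 0" using near by linarith+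
    from smooth_step_eq_1[OF this(1)] smooth_step_eq_0[OF this(2)]
    have "(\<Sum>m\<in>{?a..?c}. bump (coord \<delta> b z - real_of_int m)) = 1"
      using bump_telescope[of ?a ?c "coord \<delta> b z"] by simp
    then show "(\<Sum>m\<in>{?a..?c}. complex_of_real (bump (coord \<delta> b z - real_of_int m))) = 1"
      unfolding of_real_sum[symmetric] by (simp only: of_real_1)
  qed
  finally show ?thesis by simp
qed

lemma dbar_cong:
  assumes "open S" "z \<in> S" "\<And>y. y \<in> S \<Longrightarrow> f y = g y" "f differentiable (at z)"
  shows "dbar g z = dbar f z"
  using frechet_derivative_cong(2)[OF assms] by (simp add: dbar_def)

lemma dbar_sum:
  assumes "\<And>i. i \<in> I \<Longrightarrow> P i differentiable (at z)"
  shows "dbar (\<lambda>z. \<Sum>i\<in>I. P i z) z $ j = (\<Sum>i\<in>I. dbar (P i) z $ j)"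
proof -
  have "((\<lambda>z. \<Sum>i\<in>I. P i z) has_derivative (\<lambda>v. \<Sum>i\<in>I. frechet_derivative (P i) (at z) v)) (at z)"
    using assms by (intro has_derivative_sum) (simp add: frechet_derivative_works)
  from frechet_derivative_at[OF this, symmetric] show ?thesis
    by (simp add: dbar_def sum_distrib_left sum.distrib[symmetric] sum_divide_distrib)
qed

lemma dbar_const: "dbar (\<lambda>z. c) z = 0"
  by (simp add: dbar_def frechet_derivative_const vec_eq_iff)

lemma dbar_mult:
  assumes "F differentiable (at z)" "G differentiable (at z)"
  shows "dbar (\<lambda>z. F z * G z) z $ j = dbar F z $ j * G z + F z * dbar G z $ j"
proof -
  have "((\<lambda>u. F u * G u) has_derivative (\<lambda>v. F z * frechet_derivative G (at z) v + frechet_derivative F (at z) v * G z)) (at z)"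
    using assms by (intro has_derivative_mult) (simp_all add: frechet_derivative_works)
  from frechet_derivative_at[OF this, symmetric] show ?thesis
    by (simp add: dbar_def field_simps)
qed

lemma dbar_holomorphic:
  fixes h :: "complex ^ 'n \<Rightarrow> complex"
  assumes "holomorphic_Cn h S" "z \<in> S"
  shows "dbar h z $ j = 0"
proof -
  have "axis j \<i> = \<i> *s (axis j 1 :: complex ^ 'n)" by (simp add: vec_eq_iff axis_def)
  then have "frechet_derivative h (at z) (axis j \<i>) = \<i> * frechet_derivative h (at z) (axis j 1)"
    using holomorphic_Cn_deriv(2)[OF assms, of \<i> "axis j 1"] by simp
  then show ?thesis by (simp add: dbar_def)
qed

lemma dbar_lattice_bump_outside_cube:
  assumes "z \<notin> cube \<delta> g"
  shows "dbar (lattice_bump \<delta> g) z = 0"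
proof -
  have "dbar (lattice_bump \<delta> g) z = dbar (\<lambda>z. 0) z"
    by (rule dbar_cong[of "- cube \<delta> g"]) (use assms closed_cube lattice_bump_outside_cube in \<open>auto simp: open_Compl\<close>)
  then show ?thesis by (simp add: dbar_const)
qed

text \<open>
  All bumps are translates of one of them, which has compact support.
\<close>

lemma dbar_lattice_bump_bounded:
  assumes d: "0 < \<delta>"
  shows "\<exists>B\<ge>0. \<forall>(g :: complex ^ 'n \<Rightarrow> int) z. form_abs (dbar (lattice_bump \<delta> g) z) \<le> B"
proof -
  let ?p = "lattice_bump \<delta> (\<lambda>_. 0) :: complex ^ 'n \<Rightarrow> complex"
  define M where "M = 4 * \<delta> * real DIM(complex ^ 'n)"
  have supp: "?p z = 0" if "M < norm z" for z
  proof (rule ccontr)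
    assume p: "?p z \<noteq> 0"
    have "norm z \<le> (\<Sum>b\<in>Basis. \<bar>z \<bullet> b\<bar>)" by (rule norm_le_l1)
    also have "\<dots> \<le> (\<Sum>b\<in>(Basis :: (complex ^ 'n) set). 4 * \<delta>)"
    proof (rule sum_mono)
      fix b :: "complex ^ 'n" assume "b \<in> Basis"
      from lattice_bump_support[OF p this] have "0 < z \<bullet> b / \<delta>" "z \<bullet> b / \<delta> < 4" by (simp_all add: coord_def)
      then show "\<bar>z \<bullet> b\<bar> \<le> 4 * \<delta>" using d by (simp add: field_simps)
    qed
    finally show False using that by (simp add: M_def mult.commute)
  qed
  have zero: "form_abs (dbar ?p z) = 0" if "M < norm z" for z
    using frechet_derivative_outside_support[of M ?p, OF supp that] by (simp add: dbar_def form_abs_def)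
  have "bounded ((\<lambda>z. form_abs (dbar ?p z)) ` cball 0 M)"
    by (intro compact_imp_bounded compact_continuous_image continuous_on_subset[OF form_abs_dbar_continuous[OF lattice_bump_C1]]) auto
  then obtain B where B: "\<forall>z\<in>cball 0 M. norm (form_abs (dbar ?p z)) \<le> B"
    unfolding bounded_iff by (auto simp del: mem_cball)
  have bound: "form_abs (dbar ?p z) \<le> max 0 B" for z
  proof (cases "M < norm z")
    case False
    then have "norm (form_abs (dbar ?p z)) \<le> B" using B by simp
    then show ?thesis by simp
  qed (simp add: zero)
  have "form_abs (dbar (lattice_bump \<delta> g) z) \<le> max 0 B" for g :: "complex ^ 'n \<Rightarrow> int" and z
  proof -
    define t where "t = (\<Sum>b\<in>Basis. (\<delta> * real_of_int (g b)) *\<^sub>R b)"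
    have tb: "t \<bullet> b = \<delta> * real_of_int (g b)" if "b \<in> Basis" for b
      unfolding t_def using that by (simp add: inner_sum_left_Basis)
    have "lattice_bump \<delta> g = (\<lambda>z. ?p (- t + z))"
    proof
      fix z
      show "lattice_bump \<delta> g z = ?p (- t + z)"
        unfolding lattice_bump_def using d tb
        by (intro prod.cong refl arg_cong[where f="\<lambda>x. complex_of_real (bump x)"]) (simp add: coord_def inner_simps field_simps)
    qed
    moreover have "?p differentiable (at (- t + z))" using lattice_bump_C1[of \<delta> "\<lambda>_ :: complex ^ 'n. 0"] by simp
    from frechet_derivative_affine(2)[OF bounded_linear_ident this]
    have "frechet_derivative (\<lambda>z. ?p (- t + z)) (at z) = frechet_derivative ?p (at (- t + z))" by simp
    ultimately have "dbar (lattice_bump \<delta> g) z = dbar ?p (- t + z)" by (simp only: dbar_def)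
    then show ?thesis using bound[of "- t + z"] by (simp only:)
  qed
  then show ?thesis by (intro exI[of _ "max 0 B"]) simp
qed

text \<open>
  The sum of all \<open>lattice_bump \<delta> g * h g\<close>, restricted to a finite index set outside of which the terms vanish at \<open>z\<close>.
\<close>

definition glue :: "real \<Rightarrow> ((complex ^ 'n \<Rightarrow> int) \<Rightarrow> complex ^ 'n \<Rightarrow> complex) \<Rightarrow> complex ^ 'n \<Rightarrow> complex" where
  "glue \<delta> h z = (\<Sum>g\<in>near 5 \<delta> z. lattice_bump \<delta> g z * h g z)"

lemma glue_local:
  assumes "z \<in> nbhd \<delta> z0"
  shows "glue \<delta> h z = (\<Sum>g\<in>near 5 \<delta> z0. lattice_bump \<delta> g z * h g z)"
  unfolding glue_def
proof (rule sum.mono_neutral_cong[OF finite_near finite_near])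
  fix g assume "g \<in> near 5 \<delta> z0 - near 5 \<delta> z"
  then have "lattice_bump \<delta> g z = 0"
    using lattice_bump_near[OF _ near_extensional nbhd_self] by blast
  then show "lattice_bump \<delta> g z * h g z = 0" by simp
next
  fix g assume "g \<in> near 5 \<delta> z - near 5 \<delta> z0"
  then have "lattice_bump \<delta> g z = 0"
    using lattice_bump_near[OF _ near_extensional assms] by blast
  then show "lattice_bump \<delta> g z * h g z = 0" by simp
qed simp

text \<open>
  Off the cube the product vanishes identically, so it does not matter that \<open>h g\<close> is holomorphic on the ball only.
\<close>

lemma glued_piece:
  assumes hol: "holomorphic_Cn (h g) (ball c \<tau>)" and sub: "cube \<delta> g \<subseteq> ball c \<tau>"
  shows "Ck_on 2 (\<lambda>z. lattice_bump \<delta> g z * h g z) UNIV"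
    and "dbar (\<lambda>z. lattice_bump \<delta> g z * h g z) z $ j = dbar (lattice_bump \<delta> g) z $ j * h g z"
proof -
  have out: "lattice_bump \<delta> g y * h g y = 0" if "y \<in> - cube \<delta> g" for y using lattice_bump_outside_cube[of y] that by simp
  have op: "open (- cube \<delta> g)" using closed_cube by (rule open_Compl)
  show C2: "Ck_on 2 (\<lambda>z. lattice_bump \<delta> g z * h g z) UNIV"
  proof (rule Ck_on_Union)
    fix z
    show "\<exists>T. open T \<and> z \<in> T \<and> Ck_on 2 (\<lambda>z. lattice_bump \<delta> g z * h g z) T"
    proof (cases "z \<in> ball c \<tau>")
      case True
      have "Ck_on 2 (\<lambda>z. lattice_bump \<delta> g z * h g z) (ball c \<tau>)"
        by (intro Ck_on_mult open_ball Ck_on_subset[OF lattice_bump_C2] holomorphic_Cn_imp_Ck_on[OF hol]) simp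
      then show ?thesis using True open_ball by blast
    next
      case False
      have "Ck_on 2 (\<lambda>z. lattice_bump \<delta> g z * h g z) (- cube \<delta> g)"
        by (rule Ck_on_cong[OF op _ Ck_on_const[of 2 0]]) (simp add: out)
      moreover have "z \<in> - cube \<delta> g" using False sub by blast
      ultimately show ?thesis using op by blast
    qed
  qed
  show "dbar (\<lambda>z. lattice_bump \<delta> g z * h g z) z $ j = dbar (lattice_bump \<delta> g) z $ j * h g z"
  proof (cases "z \<in> ball c \<tau>")
    case True
    have "lattice_bump \<delta> g differentiable (at z)" using lattice_bump_C1[of \<delta> g] by simp
    moreover have "h g differentiable (at z)" using holomorphic_Cn_deriv(1)[OF hol True] by (rule differentiableI)
    ultimately show ?thesis using dbar_holomorphic[OF hol True] by (simp add: dbar_mult)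
  next
    case False
    then have z: "z \<in> - cube \<delta> g" using sub by blast
    have "dbar (\<lambda>z. lattice_bump \<delta> g z * h g z) z = dbar (\<lambda>z. 0) z"
      by (rule dbar_cong[OF op z]) (simp_all add: out)
    then show ?thesis using dbar_lattice_bump_outside_cube[of z] z by (simp add: dbar_const)
  qed
qed

text \<open>
  The bumps sum up to \<open>1\<close> near \<open>z\<close>, so their derivatives sum up to zero and any number \<open>v\<close> may be subtracted from
  the coefficients \<open>h g z\<close>. In the application \<open>v\<close> is the value \<open>f z\<close> of a function without any smoothness.
\<close>

lemma glue_props:
  fixes h :: "(complex ^ 'n \<Rightarrow> int) \<Rightarrow> complex ^ 'n \<Rightarrow> complex"
  assumes hol: "\<And>g. g \<in> extensional Basis \<Longrightarrow> holomorphic_Cn (h g) (ball (c g) \<tau>)"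
    and sub: "\<And>g. g \<in> extensional Basis \<Longrightarrow> cube \<delta> g \<subseteq> ball (c g) \<tau>"
    and B: "\<And>(g :: complex ^ 'n \<Rightarrow> int) z. form_abs (dbar (lattice_bump \<delta> g) z) \<le> B"
  shows "Ck 2 (glue \<delta> h)"
    and "form_abs (dbar (glue \<delta> h) z) \<le> B * (\<Sum>g\<in>near 5 \<delta> z. indicator (cube \<delta> g) z * cmod (v - h g z))"
    and "cmod (v - glue \<delta> h z) \<le> (\<Sum>g\<in>near 5 \<delta> z. indicator (cube \<delta> g) z * cmod (v - h g z))"
proof -
  have piece: "Ck_on 2 (\<lambda>z. lattice_bump \<delta> g z * h g z) UNIV"
    "dbar (\<lambda>z. lattice_bump \<delta> g z * h g z) z $ j = dbar (lattice_bump \<delta> g) z $ j * h g z" if g: "g \<in> extensional Basis" for g z j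
    by (rule glued_piece[where h=h and g=g, OF hol[OF g] sub[OF g]])+
  have C2: "Ck_on 2 (\<lambda>z. \<Sum>g\<in>near 5 \<delta> z0. lattice_bump \<delta> g z * h g z) UNIV" for z0
    by (rule Ck_on_sum[OF open_UNIV piece(1)[OF near_extensional]])
  have loc: "(\<Sum>g\<in>near 5 \<delta> z0. lattice_bump \<delta> g z * h g z) = glue \<delta> h z" if "z \<in> nbhd \<delta> z0" for z z0
    using glue_local[OF that] by simp
  have "Ck_on 2 (glue \<delta> h) UNIV"
  proof (rule Ck_on_Union)
    fix z0
    have "Ck_on 2 (glue \<delta> h) (nbhd \<delta> z0)"
      by (rule Ck_on_cong[OF open_nbhd loc Ck_on_subset[OF C2]]) simp_all
    then show "\<exists>T. open T \<and> z0 \<in> T \<and> Ck_on 2 (glue \<delta> h) T"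
      using open_nbhd nbhd_self by blast
  qed
  then show "Ck 2 (glue \<delta> h)" by (simp only: Ck_on_UNIV)
  let ?N = "near 5 \<delta> z"
  have pd: "(\<lambda>z. lattice_bump \<delta> g z * h g z) differentiable (at z)" if "g \<in> ?N" for g
    using piece(1)[OF near_extensional[OF that]] by (simp add: numeral_2_eq_2)
  have "dbar (glue \<delta> h) z = dbar (\<lambda>z'. \<Sum>g\<in>?N. lattice_bump \<delta> g z' * h g z') z"
    by (rule dbar_cong[OF open_nbhd nbhd_self loc]) (auto intro!: differentiable_sum finite_near pd)
  then have "dbar (glue \<delta> h) z $ j = (\<Sum>g\<in>?N. dbar (lattice_bump \<delta> g) z $ j * h g z)" for j
    using piece(2)[OF near_extensional] by (simp add: dbar_sum pd cong: sum.cong)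
  moreover have "(\<Sum>g\<in>?N. dbar (lattice_bump \<delta> g) z $ j) = 0" for j
  proof -
    have "dbar (\<lambda>z'. \<Sum>g\<in>?N. lattice_bump \<delta> g z') z = dbar (\<lambda>z. 1) z"
      by (rule dbar_cong[OF open_nbhd[of \<delta> z] nbhd_self]) (simp_all add: lattice_bump_partition_of_unity)
    then have "dbar (\<lambda>z'. \<Sum>g\<in>?N. lattice_bump \<delta> g z') z $ j = 0" by (simp add: dbar_const)
    moreover have "lattice_bump \<delta> g differentiable (at z)" for g :: "complex ^ 'n \<Rightarrow> int" using lattice_bump_C1[of \<delta> g] by simp
    ultimately show ?thesis by (simp add: dbar_sum)
  qed
  ultimately have dg: "dbar (glue \<delta> h) z $ j = - (\<Sum>g\<in>?N. dbar (lattice_bump \<delta> g) z $ j * (v - h g z))" for j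
    by (simp add: right_diff_distrib sum_subtractf sum_distrib_right[symmetric])
  have "form_abs (dbar (glue \<delta> h) z) \<le> (\<Sum>j\<in>UNIV. \<Sum>g\<in>?N. cmod (dbar (lattice_bump \<delta> g) z $ j) * cmod (v - h g z))"
    unfolding form_abs_def dg norm_minus_cancel by (intro sum_mono sum_norm_le) (simp add: norm_mult)
  also have "\<dots> = (\<Sum>g\<in>?N. form_abs (dbar (lattice_bump \<delta> g) z) * cmod (v - h g z))"
    by (subst sum.swap) (simp add: form_abs_def sum_distrib_right)
  also have "\<dots> \<le> (\<Sum>g\<in>?N. B * (indicator (cube \<delta> g) z * cmod (v - h g z)))"
  proof (rule sum_mono)
    fix g
    show "form_abs (dbar (lattice_bump \<delta> g) z) * cmod (v - h g z) \<le> B * (indicator (cube \<delta> g) z * cmod (v - h g z))"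
    proof (cases "z \<in> cube \<delta> g")
      case True
      then show ?thesis using B[of g z] by (simp add: mult_right_mono)
    next
      case False
      then show ?thesis using dbar_lattice_bump_outside_cube[OF False] by (simp add: form_abs_def)
    qed
  qed
  finally show "form_abs (dbar (glue \<delta> h) z) \<le> B * (\<Sum>g\<in>?N. indicator (cube \<delta> g) z * cmod (v - h g z))"
    by (simp only: sum_distrib_left)
  have "v - glue \<delta> h z = (\<Sum>g\<in>?N. lattice_bump \<delta> g z * (v - h g z))"
    using lattice_bump_partition_of_unity[OF nbhd_self, of \<delta> z]
    by (simp add: glue_def right_diff_distrib sum_subtractf sum_distrib_right[symmetric])
  also have "cmod \<dots> \<le> (\<Sum>g\<in>?N. indicator (cube \<delta> g) z * cmod (v - h g z))"
  proof (rule sum_norm_le)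
    fix g
    show "cmod (lattice_bump \<delta> g z * (v - h g z)) \<le> indicator (cube \<delta> g) z * cmod (v - h g z)"
      using lattice_bump_norm_le[of \<delta> g z] lattice_bump_outside_cube[of z \<delta> g]
      by (cases "z \<in> cube \<delta> g") (simp_all add: norm_mult mult_left_le_one_le)
  qed
  finally show "cmod (v - glue \<delta> h z) \<le> (\<Sum>g\<in>?N. indicator (cube \<delta> g) z * cmod (v - h g z))" .
qed

section \<open>From the oscillation to a decomposition\<close>

text \<open>
  Extensional functions make the index of a cell unique, so that there are countably many indices.
\<close>

definition cell_index :: "real \<Rightarrow> complex ^ 'n \<Rightarrow> (complex ^ 'n \<Rightarrow> int)" where
  "cell_index \<delta> z = restrict (\<lambda>b. \<lfloor>coord \<delta> b z\<rfloor>) Basis"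

definition lattice_vec :: "real \<Rightarrow> (complex ^ 'n \<Rightarrow> int) \<Rightarrow> complex ^ 'n" where
  "lattice_vec \<delta> g = (\<Sum>b\<in>Basis. (\<delta> * real_of_int (g b)) *\<^sub>R b)"

lemma cell_index_extensional: "cell_index \<delta> z \<in> extensional Basis"
  by (simp add: cell_index_def)

lemma countable_extensional: "countable (extensional Basis :: (complex ^ 'n \<Rightarrow> int) set)"
proof -
  have "countable (\<Pi>\<^sub>E b\<in>(Basis :: (complex ^ 'n) set). (UNIV :: int set))"
    by (intro countable_PiE) auto
  then show ?thesis by (simp add: PiE_def)
qed

lemma cell_index_translate:
  assumes "0 < \<delta>" "b \<in> Basis"
  shows "cell_index \<delta> (z + lattice_vec \<delta> g) b = cell_index \<delta> z b + g b"
proof -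
  have "lattice_vec \<delta> g \<bullet> b = \<delta> * real_of_int (g b)"
    unfolding lattice_vec_def using assms(2) by (simp add: inner_sum_left_Basis)
  then have "coord \<delta> b (z + lattice_vec \<delta> g) = coord \<delta> b z + real_of_int (g b)"
    using assms(1) by (simp add: coord_def inner_add_left add_divide_distrib)
  then show ?thesis using assms(2) by (simp add: cell_index_def)
qed

lemma cell_index_lattice_vec:
  fixes g :: "complex ^ 'n \<Rightarrow> int"
  assumes "0 < \<delta>" "g \<in> extensional Basis"
  shows "cell_index \<delta> (lattice_vec \<delta> g) = g"
proof (rule extensionalityI[OF cell_index_extensional assms(2)])
  fix b :: "complex ^ 'n" assume b: "b \<in> Basis"
  have "cell_index \<delta> 0 b = 0" using b by (simp add: cell_index_def coord_def)
  then show "cell_index \<delta> (lattice_vec \<delta> g) b = g b" using cell_index_translate[OF assms(1) b, of 0 g] by simp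
qed

text \<open>
  Any union of cells is a countable union of Borel sets; thus every function of the cell index is Borel
  measurable.
\<close>

lemma cell_index_vimage_sets: "{z :: complex ^ 'n. cell_index \<delta> z \<in> S} \<in> sets borel"
proof -
  have one: "{z :: complex ^ 'n. cell_index \<delta> z = g} \<in> sets borel" if g: "g \<in> extensional Basis" for g
  proof -
    have "{z :: complex ^ 'n. cell_index \<delta> z = g} = (\<Inter>b\<in>Basis. {z. real_of_int (g b) \<le> coord \<delta> b z} \<inter> {z. coord \<delta> b z < real_of_int (g b) + 1})"
    proof (intro set_eqI iffI)
      fix z assume z: "z \<in> {z. cell_index \<delta> z = g}"
      have "\<lfloor>coord \<delta> b z\<rfloor> = g b" if "b \<in> Basis" for b
        using z that unfolding cell_index_def by (metis (mono_tags, lifting) mem_Collect_eq restrict_apply')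
      then show "z \<in> (\<Inter>b\<in>Basis. {z. real_of_int (g b) \<le> coord \<delta> b z} \<inter> {z. coord \<delta> b z < real_of_int (g b) + 1})"
        by (auto simp: floor_eq_iff)
    next
      fix z assume z: "z \<in> (\<Inter>b\<in>Basis. {z. real_of_int (g b) \<le> coord \<delta> b z} \<inter> {z. coord \<delta> b z < real_of_int (g b) + 1})"
      have "cell_index \<delta> z = g"
        by (rule extensionalityI[OF cell_index_extensional g]) (use z in \<open>auto simp: cell_index_def floor_eq_iff\<close>)
      then show "z \<in> {z. cell_index \<delta> z = g}" by simp
    qed
    moreover have "closed {z :: complex ^ 'n. real_of_int (g b) \<le> coord \<delta> b z}" "open {z :: complex ^ 'n. coord \<delta> b z < real_of_int (g b) + 1}" for b
      by (intro closed_Collect_le open_Collect_less coord_continuous continuous_on_const)+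
    ultimately show ?thesis
      by (simp only:) (intro sets.finite_INT sets.Int borel_closed borel_open, auto)
  qed
  have "{z :: complex ^ 'n. cell_index \<delta> z \<in> S} = (\<Union>g\<in>S \<inter> extensional Basis. {z. cell_index \<delta> z = g})"
    using cell_index_extensional by auto
  also have "\<dots> \<in> sets borel"
    using one by (intro sets.countable_UN' countable_subset[OF _ countable_extensional]) auto
  finally show ?thesis .
qed

lemma cell_index_compose_measurable: "(\<lambda>z :: complex ^ 'n. X (cell_index \<delta> z) :: 'b::topological_space) \<in> borel_measurable borel"
proof (rule measurableI)
  fix A :: "'b set"
  show "(\<lambda>z. X (cell_index \<delta> z)) -` A \<inter> space borel \<in> sets borel"
    using cell_index_vimage_sets[of \<delta> "X -` A"] by (simp add: vimage_def)
qed simp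

lemma cell_index_compose_measurable_lebesgue: "(\<lambda>z :: complex ^ 'n. X (cell_index \<delta> z) :: ennreal) \<in> borel_measurable lebesgue"
  by (intro measurable_completion) (simp add: cell_index_compose_measurable)

lemma coord_diff_norm:
  fixes z w :: "complex ^ 'n"
  assumes "0 < \<delta>" "\<And>b. b \<in> Basis \<Longrightarrow> \<bar>coord \<delta> b z - coord \<delta> b w\<bar> \<le> c"
  shows "norm (z - w) \<le> c * \<delta> * real DIM(complex ^ 'n)"
proof -
  have "norm (z - w) \<le> (\<Sum>b\<in>Basis. \<bar>(z - w) \<bullet> b\<bar>)" by (rule norm_le_l1)
  also have "\<dots> \<le> (\<Sum>b\<in>(Basis :: (complex ^ 'n) set). c * \<delta>)"
  proof (rule sum_mono)
    fix b :: "complex ^ 'n" assume b: "b \<in> Basis"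
    have "coord \<delta> b z - coord \<delta> b w = ((z - w) \<bullet> b) / \<delta>" by (simp add: coord_def inner_diff_left diff_divide_distrib)
    then have "\<bar>(z - w) \<bullet> b\<bar> / \<delta> \<le> c" using assms(2)[OF b] assms(1) by (simp add: abs_divide)
    then show "\<bar>(z - w) \<bullet> b\<bar> \<le> c * \<delta>" using assms(1) by (simp add: divide_le_eq)
  qed
  finally show ?thesis by (simp add: mult.commute)
qed

lemma same_cell:
  assumes "cell_index \<delta> z = g" "b \<in> Basis"
  shows "0 \<le> coord \<delta> b z - real_of_int (g b)" "coord \<delta> b z - real_of_int (g b) < 1"
proof -
  have "g b = \<lfloor>coord \<delta> b z\<rfloor>" using assms by (auto simp: cell_index_def)
  then show "0 \<le> coord \<delta> b z - real_of_int (g b)" "coord \<delta> b z - real_of_int (g b) < 1" by linarith+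
qed

lemma cube_subset_ball:
  fixes c :: "complex ^ 'n"
  assumes "0 < \<delta>" "5 * \<delta> * real DIM(complex ^ 'n) \<le> \<tau>" "cell_index \<delta> c = g"
  shows "cube \<delta> g \<subseteq> ball c \<tau>"
proof
  fix z assume z: "z \<in> cube \<delta> g"
  have "\<bar>coord \<delta> b c - coord \<delta> b z\<bar> \<le> 4" if "b \<in> Basis" for b
    using same_cell[OF assms(3) that] z that by (auto simp: cube_def)
  from coord_diff_norm[OF assms(1) this]
  have "norm (c - z) \<le> 4 * \<delta> * real DIM(complex ^ 'n)" .
  also have "\<dots> < 5 * \<delta> * real DIM(complex ^ 'n)" using assms(1) by simp
  finally show "z \<in> ball c \<tau>" using assms(2) by (simp add: dist_norm)
qed

text \<open>
  The infima over the cells need not be attained. The errors that are allowed instead are \<open>L\<^sup>s\<close>-small: there are countably many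
  cells, of bounded volume, so that the terms of a geometric series can be distributed over them.
\<close>

lemma small_step_function:
  assumes s: "0 < s" and d: "0 < \<delta>" and eps: "0 < \<epsilon>"
  shows "\<exists>e :: (complex ^ 'n \<Rightarrow> int) \<Rightarrow> real. (\<forall>g. 0 < e g) \<and> Ls_norm s (\<lambda>z. ennreal (e (cell_index \<delta> z))) \<le> ennreal \<epsilon>"
proof -
  define \<tau> where "\<tau> = 5 * \<delta> * real DIM(complex ^ 'n)"
  define V where "V = ball_vol TYPE(complex ^ 'n) \<tau>"
  have V: "0 < V" unfolding V_def using d by (intro ball_vol_pos) (simp add: \<tau>_def)
  define idx where "idx = to_nat_on (extensional Basis :: (complex ^ 'n \<Rightarrow> int) set)"
  \<comment> \<open>The \<open>n\<close>-th cell receives the share \<open>2\<^bsup>-n-1\<^esup>\<close> of \<open>\<epsilon>\<^sup>s\<close>.\<close>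
  define a where "a = (\<lambda>n::nat. \<epsilon> powr s / V * (1 / 2) ^ Suc n)"
  have a: "0 < a n" for n using eps V by (simp add: a_def)
  define e where "e = (\<lambda>g. a (idx g) powr (1 / s))"
  have e: "0 < e g" for g using a[of "idx g"] by (simp add: e_def)
  have "(\<integral>\<^sup>+z. epowr (ennreal (e (cell_index \<delta> z))) s \<partial>lborel) = (\<integral>\<^sup>+(z :: complex ^ 'n). (\<Sum>n. ennreal (a n) * indicator {z. idx (cell_index \<delta> z) = n} z) \<partial>lborel)"
  proof (rule nn_integral_cong)
    fix z :: "complex ^ 'n"
    have "(\<Sum>n. ennreal (a n) * indicator {z. idx (cell_index \<delta> z) = n} z) = (\<Sum>n\<in>{idx (cell_index \<delta> z)}. ennreal (a n) * indicator {z. idx (cell_index \<delta> z) = n} z)"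
      by (rule suminf_finite) auto
    also have "\<dots> = ennreal (a (idx (cell_index \<delta> z)))" by simp
    also have "\<dots> = epowr (ennreal (e (cell_index \<delta> z))) s"
      using e[of "cell_index \<delta> z"] a[of "idx (cell_index \<delta> z)"] s by (simp add: epowr_ennreal e_def powr_powr)
    finally show "epowr (ennreal (e (cell_index \<delta> z))) s = (\<Sum>n. ennreal (a n) * indicator {z. idx (cell_index \<delta> z) = n} z)" ..
  qed
  also have "\<dots> = (\<Sum>n. \<integral>\<^sup>+(z :: complex ^ 'n). ennreal (a n) * indicator {z. idx (cell_index \<delta> z) = n} z \<partial>lborel)"
  proof (rule nn_integral_suminf)
    fix n
    have "{z :: complex ^ 'n. idx (cell_index \<delta> z) = n} \<in> sets lborel"
      using cell_index_vimage_sets[of \<delta> "{g. idx g = n}"] by simp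
    then show "(\<lambda>z :: complex ^ 'n. ennreal (a n) * indicator {z. idx (cell_index \<delta> z) = n} z) \<in> borel_measurable lborel"
      by (intro borel_measurable_times_ennreal borel_measurable_indicator) simp_all
  qed
  also have "\<dots> \<le> (\<Sum>n. ennreal (\<epsilon> powr s * (1 / 2) ^ Suc n))"
  proof (rule suminf_le)
    fix n
    have "emeasure lborel {z :: complex ^ 'n. idx (cell_index \<delta> z) = n} \<le> ennreal V"
    proof (cases "{z :: complex ^ 'n. idx (cell_index \<delta> z) = n} = {}")
      case False
      then obtain z0 :: "complex ^ 'n" where z0: "idx (cell_index \<delta> z0) = n" by blast
      have "{z :: complex ^ 'n. idx (cell_index \<delta> z) = n} \<subseteq> ball z0 \<tau>"
      proof
        fix z :: "complex ^ 'n" assume "z \<in> {z. idx (cell_index \<delta> z) = n}"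
        then have "idx (cell_index \<delta> z) = idx (cell_index \<delta> z0)" using z0 by simp
        then have same: "cell_index \<delta> z = cell_index \<delta> z0"
          unfolding idx_def using inj_on_to_nat_on[OF countable_extensional] cell_index_extensional
          by (meson inj_onD)
        have "0 \<le> coord \<delta> b z - real_of_int (cell_index \<delta> z0 b) \<and> coord \<delta> b z - real_of_int (cell_index \<delta> z0 b) \<le> 4" if "b \<in> Basis" for b
          using same_cell[OF same that] by linarith
        then have "z \<in> cube \<delta> (cell_index \<delta> z0)" unfolding cube_def by blast
        then show "z \<in> ball z0 \<tau>"
          using cube_subset_ball[OF d _ refl, of \<tau> z0] by (auto simp: \<tau>_def)
      qed
      then have "emeasure lborel {z :: complex ^ 'n. idx (cell_index \<delta> z) = n} \<le> emeasure lborel (ball z0 \<tau>)"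
        by (rule emeasure_mono) simp
      also have "\<dots> = ennreal V"
        using emeasure_ball_eq_vol[of z0 \<tau>] by (simp add: V_def)
      finally show ?thesis .
    next
      case True
      then show ?thesis by (simp only: emeasure_empty) simp
    qed
    then have "ennreal (a n) * emeasure lborel {z :: complex ^ 'n. idx (cell_index \<delta> z) = n} \<le> ennreal (a n) * ennreal V"
      by (rule mult_left_mono) simp
    also have "\<dots> = ennreal (\<epsilon> powr s * (1 / 2) ^ Suc n)"
      using V by (simp add: ennreal_mult'[symmetric] a_def)
    finally show "(\<integral>\<^sup>+(z :: complex ^ 'n). ennreal (a n) * indicator {z. idx (cell_index \<delta> z) = n} z \<partial>lborel)
        \<le> ennreal (\<epsilon> powr s * (1 / 2) ^ Suc n)"
      using cell_index_vimage_sets[of \<delta> "{g. idx g = n}"] by (subst nn_integral_cmult_indicator) simp_all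
  qed auto
  also have "(\<Sum>n. ennreal (\<epsilon> powr s * (1 / 2) ^ Suc n)) = ennreal (\<epsilon> powr s)"
  proof -
    have "(\<lambda>n. \<epsilon> powr s * (1 / 2 :: real) ^ Suc n) sums (\<epsilon> powr s * 1)"
      by (intro sums_mult power_half_series)
    then show ?thesis by (intro sums_unique[symmetric] sums_ennreal[THEN iffD2]) (auto intro: suminf_nonneg)
  qed
  finally have "Ls_norm s (\<lambda>z :: complex ^ 'n. ennreal (e (cell_index \<delta> z))) \<le> epowr (ennreal (\<epsilon> powr s)) (1 / s)"
    unfolding Ls_norm_def nn_integral_completion using s by (intro epowr_mono) auto
  also have "\<dots> = ennreal \<epsilon>" using s eps by (simp add: epowr_ennreal powr_powr)
  finally show ?thesis using e by blast
qed

lemma M_avg_finite: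
  assumes "f \<in> L_loc q" "1 \<le> q" "0 < r"
  shows "M_avg q r f z < \<infinity>"
proof -
  have q: "0 < q" using assms(2) by simp
  have "I_ball q f z r \<le> (\<integral>\<^sup>+w\<in>cball z r. ennreal (norm (f w) powr q) \<partial>lebesgue)"
    unfolding I_ball_def by (intro nn_integral_mono mult_left_mono) (auto split: split_indicator)
  also have "\<dots> < \<infinity>"
    using assms(1) unfolding L_loc_def mem_Collect_eq using compact_cball by blast
  finally show ?thesis
    unfolding M_avg_eq[OF q assms(3)] by (simp add: ennreal_mult_less_top)
qed

text \<open>
  The competitor \<open>0\<close> and the local integrability of \<open>f\<close> show that the infimum over each cell is finite; hence it can be
  approximated within \<open>e g\<close>.
\<close>

lemma near_minimal_competitors:
  fixes f :: "complex ^ 'n \<Rightarrow> complex"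
  assumes f: "f \<in> L_loc q" and q: "1 \<le> q" and t: "0 < \<tau>" and d: "0 < \<delta>" and e: "\<And>g. 0 < e g"
  shows "\<exists>c h. \<forall>g\<in>extensional Basis. cell_index \<delta> (c g) = g \<and> holomorphic_Cn (h g) (ball (c g) \<tau>) \<and>
     M_avg q \<tau> (\<lambda>w. f w - h g w) (c g) \<le> (INF w\<in>{w. cell_index \<delta> w = g}. G_dist q \<tau> f w) + ennreal (e g)"
proof -
  have "\<exists>p. cell_index \<delta> (fst p) = g \<and> holomorphic_Cn (snd p) (ball (fst p) \<tau>) \<and>
     M_avg q \<tau> (\<lambda>w. f w - snd p w) (fst p) \<le> (INF w\<in>{w. cell_index \<delta> w = g}. G_dist q \<tau> f w) + ennreal (e g)"
    if g: "g \<in> extensional Basis" for g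
  proof -
    let ?m = "INF w\<in>{w. cell_index \<delta> w = g}. G_dist q \<tau> f w"
    let ?w = "lattice_vec \<delta> g"
    have hol0: "holomorphic_Cn (\<lambda>w :: complex ^ 'n. 0) S" for S
      unfolding holomorphic_Cn_def by (intro ballI exI[of _ "\<lambda>_. 0"]) simp
    have "?m \<le> G_dist q \<tau> f ?w"
      by (rule INF_lower) (simp add: cell_index_lattice_vec[OF d g])
    also have "\<dots> \<le> M_avg q \<tau> (\<lambda>w. f w - 0) ?w"
      unfolding G_dist_def by (rule INF_lower) (simp add: hol0)
    also have "\<dots> < \<infinity>" using M_avg_finite[OF f q t] by simp
    finally have "?m < ?m + ennreal (e g)"
      using e[of g] by (cases ?m) (auto simp: ennreal_plus[symmetric] ennreal_less_iff simp del: ennreal_plus)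
    then obtain w where w: "cell_index \<delta> w = g" "G_dist q \<tau> f w < ?m + ennreal (e g)"
      unfolding INF_less_iff by blast
    then obtain h where "holomorphic_Cn h (ball w \<tau>)" "M_avg q \<tau> (\<lambda>w. f w - h w) w < ?m + ennreal (e g)"
      unfolding G_dist_def[of q \<tau> f w] INF_less_iff by blast
    then show ?thesis using w(1) by (intro exI[of _ "(w, h)"]) (simp add: less_imp_le)
  qed
  then have "\<exists>p. \<forall>g\<in>extensional Basis. cell_index \<delta> (fst (p g)) = g \<and> holomorphic_Cn (snd (p g)) (ball (fst (p g)) \<tau>) \<and>
     M_avg q \<tau> (\<lambda>w. f w - snd (p g) w) (fst (p g)) \<le> (INF w\<in>{w. cell_index \<delta> w = g}. G_dist q \<tau> f w) + ennreal (e g)"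
    by (intro bchoice) blast
  then obtain p where "\<forall>g\<in>extensional Basis. cell_index \<delta> (fst (p g)) = g \<and> holomorphic_Cn (snd (p g)) (ball (fst (p g)) \<tau>) \<and>
     M_avg q \<tau> (\<lambda>w. f w - snd (p g) w) (fst (p g)) \<le> (INF w\<in>{w. cell_index \<delta> w = g}. G_dist q \<tau> f w) + ennreal (e g)" ..
  then show ?thesis by (intro exI[of _ "\<lambda>g. fst (p g)"] exI[of _ "\<lambda>g. snd (p g)"])
qed

lemma near_subset:
  fixes z w :: "complex ^ 'n"
  assumes "0 < \<delta>" "w \<in> ball z r"
  shows "near 5 \<delta> w \<subseteq> near (6 + \<lceil>r / \<delta>\<rceil>) \<delta> z"
  unfolding near_def
proof (rule PiE_mono)
  fix b :: "complex ^ 'n" assume b: "b \<in> Basis"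
  have "coord \<delta> b w - coord \<delta> b z = ((w - z) \<bullet> b) / \<delta>" by (simp add: coord_def inner_diff_left diff_divide_distrib)
  moreover have "\<bar>(w - z) \<bullet> b\<bar> \<le> r"
    using Basis_le_norm[OF b, of "w - z"] assms(2) by (simp add: dist_norm norm_minus_commute)
  ultimately have "\<bar>coord \<delta> b w - coord \<delta> b z\<bar> \<le> r / \<delta>"
    using assms(1) by (simp add: abs_divide divide_right_mono)
  moreover have "r / \<delta> \<le> real_of_int \<lceil>r / \<delta>\<rceil>" by simp
  ultimately have "\<bar>coord \<delta> b w - coord \<delta> b z\<bar> \<le> real_of_int \<lceil>r / \<delta>\<rceil>" by linarith
  then have "\<lfloor>coord \<delta> b z\<rfloor> - (6 + \<lceil>r / \<delta>\<rceil>) \<le> \<lfloor>coord \<delta> b w\<rfloor> - 5" "\<lfloor>coord \<delta> b w\<rfloor> + 5 \<le> \<lfloor>coord \<delta> b z\<rfloor> + (6 + \<lceil>r / \<delta>\<rceil>)"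
    by linarith+
  then show "{\<lfloor>coord \<delta> b w\<rfloor> - 5..\<lfloor>coord \<delta> b w\<rfloor> + 5} \<subseteq> {\<lfloor>coord \<delta> b z\<rfloor> - (6 + \<lceil>r / \<delta>\<rceil>)..\<lfloor>coord \<delta> b z\<rfloor> + (6 + \<lceil>r / \<delta>\<rceil>)}"
    by auto
qed

lemma card_near: "card (near L \<delta> z :: (complex ^ 'n \<Rightarrow> int) set) = nat (2 * L + 1) ^ DIM(complex ^ 'n)"
  unfolding near_def by (subst card_PiE) (simp_all add: algebra_simps)

definition lattice_shifts :: "real \<Rightarrow> int \<Rightarrow> (complex ^ 'n) set" where
  "lattice_shifts \<delta> L = lattice_vec \<delta> ` (\<Pi>\<^sub>E b\<in>Basis. {- L..L})"

lemma finite_lattice_shifts: "finite (lattice_shifts \<delta> L)"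
  unfolding lattice_shifts_def by (intro finite_imageI finite_PiE) auto

text \<open>
  The neighbouring cells of the cell of \<open>z\<close> are the cells of finitely many translates of \<open>z\<close>. This turns sums over
  neighbours into sums of translates, as required by \<open>Ls_norm_le_translates\<close>.
\<close>

lemma sum_near_le:
  fixes X :: "(complex ^ 'n \<Rightarrow> int) \<Rightarrow> ennreal"
  assumes d: "0 < \<delta>"
  shows "(\<Sum>g\<in>near L \<delta> z. X g) \<le> (\<Sum>a\<in>lattice_shifts \<delta> L. X (cell_index \<delta> (z + a)))"
proof -
  have "near L \<delta> z \<subseteq> (\<lambda>a. cell_index \<delta> (z + a)) ` lattice_shifts \<delta> L"
  proof
    fix g assume g: "g \<in> near L \<delta> z"
    define k where "k = restrict (\<lambda>b. g b - cell_index \<delta> z b) Basis"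
    have flz: "cell_index \<delta> z b = \<lfloor>coord \<delta> b z\<rfloor>" if "b \<in> Basis" for b using that by (simp add: cell_index_def)
    have gb: "g b \<in> {\<lfloor>coord \<delta> b z\<rfloor> - L..\<lfloor>coord \<delta> b z\<rfloor> + L}" if "b \<in> Basis" for b
      using g that unfolding near_def by (rule PiE_mem)
    have "k \<in> (\<Pi>\<^sub>E b\<in>Basis. {- L..L})"
      unfolding k_def by (rule restrict_PiE_iff[THEN iffD2]) (use gb flz in fastforce)
    moreover have "cell_index \<delta> (z + lattice_vec \<delta> k) = g"
    proof (rule extensionalityI[OF cell_index_extensional near_extensional[OF g]])
      fix b :: "complex ^ 'n" assume b: "b \<in> Basis"
      show "cell_index \<delta> (z + lattice_vec \<delta> k) b = g b" using cell_index_translate[OF d b, of z k] b by (simp add: k_def)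
    qed
    ultimately show "g \<in> (\<lambda>a. cell_index \<delta> (z + a)) ` lattice_shifts \<delta> L"
      unfolding lattice_shifts_def by blast
  qed
  then have "(\<Sum>g\<in>near L \<delta> z. X g) \<le> (\<Sum>g\<in>(\<lambda>a. cell_index \<delta> (z + a)) ` lattice_shifts \<delta> L. X g)"
    by (intro sum_mono2 finite_imageI finite_lattice_shifts) auto
  also have "\<dots> \<le> (\<Sum>a\<in>lattice_shifts \<delta> L. X (cell_index \<delta> (z + a)))"
    using sum_image_le[OF finite_lattice_shifts[of \<delta> L], of X "\<lambda>a. cell_index \<delta> (z + a)"] by (simp add: o_def)
  finally show ?thesis .
qed

lemma holomorphic_error_measurable:
  fixes f h :: "complex ^ 'n \<Rightarrow> complex"
  assumes f: "f \<in> borel_measurable lebesgue" and h: "holomorphic_Cn h (ball c \<tau>)"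
  shows "(\<lambda>w. ennreal (norm (f w - h w) powr q) * indicator (ball c \<tau>) w) \<in> borel_measurable lebesgue"
proof -
  have "(\<lambda>w. indicator (ball c \<tau>) w *\<^sub>R h w) \<in> borel_measurable borel"
    by (intro borel_measurable_continuous_on_indicator holomorphic_Cn_continuous[OF h]) simp
  then have "(\<lambda>w. indicator (ball c \<tau>) w *\<^sub>R h w) \<in> borel_measurable lebesgue"
    by (intro measurable_completion) simp
  from borel_measurable_diff[OF f this]
  have "(\<lambda>w. ennreal (norm (f w - indicator (ball c \<tau>) w *\<^sub>R h w) powr q) * indicator (ball c \<tau>) w) \<in> borel_measurable lebesgue"
    by (intro borel_measurable_times_ennreal measurable_powr_ennreal borel_measurable_indicator) simp_all
  moreover have "ennreal (norm (f w - indicator (ball c \<tau>) w *\<^sub>R h w) powr q) * indicator (ball c \<tau>) w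
     = ennreal (norm (f w - h w) powr q) * indicator (ball c \<tau>) w" for w
    by (simp split: split_indicator)
  ultimately show ?thesis by (simp only:)
qed

text \<open>
  Only the errors of competitors with indices in \<open>near L \<delta> z\<close> are seen from \<open>ball z r\<close>. Their number \<open>N\<close> does not depend on
  \<open>z\<close>, so the power of the sum is bounded by a constant times the sum of the powers.
\<close>

lemma M_avg_le_neighbouring_errors:
  fixes f :: "complex ^ 'n \<Rightarrow> complex" and F :: "complex ^ 'n \<Rightarrow> 'b::real_normed_vector"
  assumes q: "1 \<le> q" and r: "0 < r" and t: "0 < \<tau>" and d: "0 < \<delta>" and B: "0 \<le> B"
    and f: "f \<in> borel_measurable lebesgue"
    and hol: "\<And>g. g \<in> extensional Basis \<Longrightarrow> holomorphic_Cn (h g) (ball (c g) \<tau>)"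
    and sub: "\<And>g. g \<in> extensional Basis \<Longrightarrow> cube \<delta> g \<subseteq> ball (c g) \<tau>"
    and F: "\<And>w. norm (F w) \<le> B * (\<Sum>g\<in>near 5 \<delta> w. indicator (cube \<delta> g) w * cmod (f w - h g w))"
    and L: "L = 6 + \<lceil>r / \<delta>\<rceil>" and N: "N = real (nat (2 * L + 1) ^ DIM(complex ^ 'n))"
  shows "M_avg q r F z \<le> ennreal (ball_vol TYPE(complex ^ 'n) r powr (- 1 / q) * (B * N * N powr (1 / q)) * ball_vol TYPE(complex ^ 'n) \<tau> powr (1 / q))
     * (\<Sum>g\<in>near L \<delta> z. M_avg q \<tau> (\<lambda>w. f w - h g w) (c g))"
proof -
  have q0: "0 < q" using q by simp
  have cardN: "real (card (near L \<delta> z)) = N" unfolding N card_near ..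
  have N0: "0 \<le> N" unfolding cardN[symmetric] by simp
  let ?e = "\<lambda>g w. ennreal (norm (f w - h g w) powr q) * indicator (ball (c g) \<tau>) w"
  have ext: "g \<in> extensional Basis" if "g \<in> near L \<delta> z" for g using near_extensional[OF that] .
  have "I_ball q F z r \<le> (\<integral>\<^sup>+w. ennreal (B powr q * N powr q) * (\<Sum>g\<in>near L \<delta> z. ?e g w) \<partial>lebesgue)"
    unfolding I_ball_def
  proof (rule nn_integral_mono)
    fix w
    show "ennreal (norm (F w) powr q) * indicator (ball z r) w \<le> ennreal (B powr q * N powr q) * (\<Sum>g\<in>near L \<delta> z. ?e g w)"
    proof (cases "w \<in> ball z r")
      case True
      have "norm (F w) \<le> B * (\<Sum>g\<in>near L \<delta> z. indicator (cube \<delta> g) w * cmod (f w - h g w))"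
        using near_subset[OF d True] unfolding L
        by (intro order_trans[OF F] mult_left_mono[OF _ B] sum_mono2 finite_near) auto
      then have "epowr (ennreal (norm (F w))) q \<le> epowr (ennreal B * (\<Sum>g\<in>near L \<delta> z. ennreal (indicator (cube \<delta> g) w * cmod (f w - h g w)))) q"
        using q0 B by (intro epowr_mono) (simp_all add: ennreal_mult'[symmetric] sum_ennreal ennreal_leI)
      also have "\<dots> = ennreal (B powr q) * epowr (\<Sum>g\<in>near L \<delta> z. ennreal (indicator (cube \<delta> g) w * cmod (f w - h g w))) q"
        using q0 B by (simp add: epowr_mult epowr_ennreal)
      also have "\<dots> \<le> ennreal (B powr q) * (ennreal (N powr q) * (\<Sum>g\<in>near L \<delta> z. epowr (ennreal (indicator (cube \<delta> g) w * cmod (f w - h g w))) q))"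
        by (rule mult_left_mono[OF epowr_sum_le[OF finite_near[of L \<delta> z] q0, unfolded cardN]]) simp
      also have "(\<Sum>g\<in>near L \<delta> z. epowr (ennreal (indicator (cube \<delta> g) w * cmod (f w - h g w))) q) \<le> (\<Sum>g\<in>near L \<delta> z. ?e g w)"
      proof (rule sum_mono)
        fix g assume "g \<in> near L \<delta> z"
        from sub[OF ext[OF this]] show "epowr (ennreal (indicator (cube \<delta> g) w * cmod (f w - h g w))) q \<le> ?e g w"
          by (cases "w \<in> cube \<delta> g") (auto simp: epowr_ennreal)
      qed
      finally show ?thesis
        using True N0 by (simp add: epowr_ennreal ennreal_mult mult.assoc mult_left_mono)
    qed simp
  qed
  also have "\<dots> = ennreal (B powr q * N powr q) * (\<Sum>g\<in>near L \<delta> z. I_ball q (\<lambda>w. f w - h g w) (c g) \<tau>)"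
  proof -
    have m: "?e g \<in> borel_measurable lebesgue" if "g \<in> near L \<delta> z" for g
      by (rule holomorphic_error_measurable[OF f hol[OF ext[OF that]]])
    show ?thesis
      unfolding I_ball_def by (subst nn_integral_cmult) (auto simp: nn_integral_sum m intro!: borel_measurable_sum m)
  qed
  finally have "epowr (I_ball q F z r) (1/q) \<le> epowr (ennreal (B powr q * N powr q) * (\<Sum>g\<in>near L \<delta> z. I_ball q (\<lambda>w. f w - h g w) (c g) \<tau>)) (1/q)"
    using q0 by (intro epowr_mono) simp_all
  also have "\<dots> = ennreal (B * N) * epowr (\<Sum>g\<in>near L \<delta> z. I_ball q (\<lambda>w. f w - h g w) (c g) \<tau>) (1/q)"
    using q0 B N0 by (simp add: epowr_mult epowr_ennreal powr_mult powr_powr)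
  also have "\<dots> \<le> ennreal (B * N) * (ennreal (N powr (1/q)) * (\<Sum>g\<in>near L \<delta> z. epowr (I_ball q (\<lambda>w. f w - h g w) (c g) \<tau>) (1/q)))"
    using q0 by (intro mult_left_mono epowr_sum_le[OF finite_near[of L \<delta> z], unfolded cardN]) simp_all
  finally have le: "epowr (I_ball q F z r) (1/q) \<le> ennreal (B * N) * (ennreal (N powr (1/q)) * (\<Sum>g\<in>near L \<delta> z. epowr (I_ball q (\<lambda>w. f w - h g w) (c g) \<tau>) (1/q)))" .
  let ?vt = "ball_vol TYPE(complex ^ 'n) \<tau>" and ?vr = "ball_vol TYPE(complex ^ 'n) r"
  have inv: "epowr I (1/q) = ennreal (?vt powr (1/q)) * (ennreal (?vt powr (- 1 / q)) * epowr I (1/q))" for I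
  proof -
    have "?vt powr (1 / q) * ?vt powr (- 1 / q) = 1"
      using ball_vol_pos[OF t, where 'a="complex ^ 'n"] by (simp add: powr_add[symmetric])
    then show ?thesis by (simp add: mult.assoc[symmetric] ennreal_mult[symmetric])
  qed
  have "M_avg q r F z \<le> ennreal (?vr powr (- 1 / q)) * (ennreal (B * N) * (ennreal (N powr (1/q)) * (\<Sum>g\<in>near L \<delta> z. epowr (I_ball q (\<lambda>w. f w - h g w) (c g) \<tau>) (1/q))))"
    unfolding M_avg_eq[OF q0 r] by (rule mult_left_mono[OF le]) simp
  also have "(\<Sum>g\<in>near L \<delta> z. epowr (I_ball q (\<lambda>w. f w - h g w) (c g) \<tau>) (1/q))
     = ennreal (?vt powr (1/q)) * (\<Sum>g\<in>near L \<delta> z. M_avg q \<tau> (\<lambda>w. f w - h g w) (c g))"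
    unfolding M_avg_eq[OF q0 t] sum_distrib_left by (rule sum.cong[OF refl inv])
  also have "ennreal (?vr powr (- 1 / q)) * (ennreal (B * N) * (ennreal (N powr (1/q)) * (ennreal (?vt powr (1/q)) * S)))
     = ennreal (?vr powr (- 1 / q) * (B * N * N powr (1 / q)) * ?vt powr (1 / q)) * S" for S
  proof -
    have BN: "0 \<le> B * N" using B N0 by simp
    have "ennreal (?vr powr (- 1 / q) * (B * N * N powr (1 / q)) * ?vt powr (1 / q))
      = ennreal (?vr powr (- 1 / q)) * (ennreal (B * N) * ennreal (N powr (1 / q))) * ennreal (?vt powr (1 / q))"
      using BN by (simp only: ennreal_mult powr_ge_zero mult_nonneg_nonneg)
    then show ?thesis by (simp only: mult.assoc)
  qed
  finally show ?thesis .
qed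

lemma decomposition_from_oscillation:
  assumes q: "1 \<le> q" and s: "0 < s" and t: "0 < \<tau>" and r: "0 < r"
  shows "\<exists>C>0. \<forall>f \<in> (L_loc q :: (complex ^ 'n \<Rightarrow> complex) set). \<forall>\<epsilon>>0.
    \<exists>f1. Ck 2 f1 \<and> Ls_norm s (M_form q r (dbar f1)) + Ls_norm s (M_avg q r (\<lambda>w. f w - f1 w))
      \<le> ennreal C * (Ls_norm s (G_dist q \<tau> f) + ennreal \<epsilon>)"
proof -
  \<comment> \<open>A cell has side \<open>\<delta>\<close> and its cube side \<open>4 \<delta>\<close>; both fit into a ball with radius \<open>\<tau>\<close> around any point of the cell.\<close>
  define \<delta> where "\<delta> = \<tau> / (5 * real DIM(complex ^ 'n))"
  have d: "0 < \<delta>" "5 * \<delta> * real DIM(complex ^ 'n) \<le> \<tau>" using t by (simp_all add: \<delta>_def)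
  from dbar_lattice_bump_bounded[OF d(1), where 'n='n] obtain B0 where B0: "0 \<le> B0"
    "\<forall>(g :: complex ^ 'n \<Rightarrow> int) z. form_abs (dbar (lattice_bump \<delta> g) z) \<le> B0" by (elim exE conjE)
  define B where "B = max 1 B0"
  have B: "0 \<le> B" "1 \<le> B" "B0 \<le> B" by (simp_all add: B_def)
  define L where "L = 6 + \<lceil>r / \<delta>\<rceil>"
  define N where "N = real (nat (2 * L + 1) ^ DIM(complex ^ 'n))"
  define C1 where "C1 = ball_vol TYPE(complex ^ 'n) r powr (- 1 / q) * (B * N * N powr (1 / q)) * ball_vol TYPE(complex ^ 'n) \<tau> powr (1 / q)"
  have C1: "0 \<le> C1" using B by (simp add: C1_def N_def)
  let ?I = "lattice_shifts \<delta> L :: (complex ^ 'n) set"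
  define C2 where "C2 = C1 * (real (card ?I))\<^sup>2 * real (card ?I) powr (1/s) * (2 * 2 powr (1/s))"
  have C2: "0 \<le> C2" using C1 by (simp add: C2_def)
  have "\<exists>f1. Ck 2 f1 \<and> Ls_norm s (M_form q r (dbar f1)) + Ls_norm s (M_avg q r (\<lambda>w. f w - f1 w))
      \<le> ennreal (2 * C2 + 1) * (Ls_norm s (G_dist q \<tau> f) + ennreal \<epsilon>)"
    if f: "f \<in> L_loc q" and eps: "0 < \<epsilon>" for f :: "complex ^ 'n \<Rightarrow> complex" and \<epsilon>
  proof -
    have fm: "f \<in> borel_measurable lebesgue" using f by (simp add: L_loc_def)
    from small_step_function[OF s d(1) eps, where 'n='n] obtain e :: "(complex ^ 'n \<Rightarrow> int) \<Rightarrow> real"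
      where e: "\<forall>g. 0 < e g" and e_small: "Ls_norm s (\<lambda>z. ennreal (e (cell_index \<delta> z))) \<le> ennreal \<epsilon>" by (elim exE conjE)
    define m where "m = (\<lambda>g. INF w\<in>{w. cell_index \<delta> w = g}. G_dist q \<tau> f w)"
    from near_minimal_competitors[OF f q t d(1), where e=e, OF e[rule_format]] obtain c h where
      ch: "\<forall>g\<in>extensional Basis. cell_index \<delta> (c g) = g \<and> holomorphic_Cn (h g) (ball (c g) \<tau>) \<and>
        M_avg q \<tau> (\<lambda>w. f w - h g w) (c g) \<le> m g + ennreal (e g)"
      unfolding m_def by (elim exE)
    have hol: "holomorphic_Cn (h g) (ball (c g) \<tau>)" and sub: "cube \<delta> g \<subseteq> ball (c g) \<tau>"
      and near_min: "M_avg q \<tau> (\<lambda>w. f w - h g w) (c g) \<le> m g + ennreal (e g)" if "g \<in> extensional Basis" for g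
      using bspec[OF ch that] cube_subset_ball[OF d, of "c g" g] by simp_all
    define f1 where "f1 = glue \<delta> h"
    note glue = glue_props[OF hol sub B0(2)[rule_format], folded f1_def]
    define X where "X = (\<lambda>g. m g + ennreal (e g))"
    have Ls_X: "Ls_norm s (\<lambda>z. X (cell_index \<delta> z)) \<le> ennreal (2 * 2 powr (1/s)) * (Ls_norm s (G_dist q \<tau> f) + ennreal \<epsilon>)"
    proof -
      have "Ls_norm s (\<lambda>z. X (cell_index \<delta> z)) \<le> ennreal (2 * 2 powr (1/s)) * (Ls_norm s (\<lambda>z. m (cell_index \<delta> z)) + Ls_norm s (\<lambda>z. ennreal (e (cell_index \<delta> z))))"
        unfolding X_def
        by (rule Ls_norm_add_le[OF s cell_index_compose_measurable_lebesgue[of m \<delta>] cell_index_compose_measurable_lebesgue[of "\<lambda>g. ennreal (e g)" \<delta>]])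
      also have "\<dots> \<le> ennreal (2 * 2 powr (1/s)) * (Ls_norm s (G_dist q \<tau> f) + ennreal \<epsilon>)"
      proof (intro mult_left_mono add_mono e_small)
        show "Ls_norm s (\<lambda>z. m (cell_index \<delta> z)) \<le> Ls_norm s (G_dist q \<tau> f)"
          by (rule Ls_norm_mono[OF _ s]) (simp add: m_def INF_lower)
      qed simp
      finally show ?thesis .
    qed
    have bound: "Ls_norm s (M_avg q r F) \<le> ennreal C2 * (Ls_norm s (G_dist q \<tau> f) + ennreal \<epsilon>)"
      if F: "\<And>w. norm (F w) \<le> B * (\<Sum>g\<in>near 5 \<delta> w. indicator (cube \<delta> g) w * cmod (f w - h g w))"
      for F :: "complex ^ 'n \<Rightarrow> 'b::real_normed_vector"
    proof -
      have "M_avg q r F z \<le> ennreal C1 * (\<Sum>a\<in>?I. X (cell_index \<delta> (z + a)))" for z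
      proof -
        have "M_avg q r F z \<le> ennreal C1 * (\<Sum>g\<in>near L \<delta> z. M_avg q \<tau> (\<lambda>w. f w - h g w) (c g))"
          unfolding C1_def by (rule M_avg_le_neighbouring_errors[OF q r t d(1) B(1) fm hol sub F L_def N_def])
        also have "\<dots> \<le> ennreal C1 * (\<Sum>g\<in>near L \<delta> z. X g)"
          unfolding X_def by (intro mult_left_mono sum_mono near_min near_extensional) simp_all
        also have "\<dots> \<le> ennreal C1 * (\<Sum>a\<in>?I. X (cell_index \<delta> (z + a)))"
          by (rule mult_left_mono[OF sum_near_le[OF d(1)]]) simp
        finally show ?thesis .
      qed
      then have "Ls_norm s (M_avg q r F) \<le> ennreal (C1 * (real (card ?I))\<^sup>2 * real (card ?I) powr (1/s)) * Ls_norm s (\<lambda>z. X (cell_index \<delta> z))"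
        by (rule Ls_norm_le_translates[OF s C1 finite_lattice_shifts cell_index_compose_measurable_lebesgue])
      also have "\<dots> \<le> ennreal (C1 * (real (card ?I))\<^sup>2 * real (card ?I) powr (1/s)) * (ennreal (2 * 2 powr (1/s)) * (Ls_norm s (G_dist q \<tau> f) + ennreal \<epsilon>))"
        by (rule mult_left_mono[OF Ls_X]) simp
      also have "\<dots> = ennreal C2 * (Ls_norm s (G_dist q \<tau> f) + ennreal \<epsilon>)"
      proof -
        have "ennreal C2 = ennreal (C1 * (real (card ?I))\<^sup>2 * real (card ?I) powr (1/s)) * ennreal (2 * 2 powr (1/s))"
          unfolding C2_def using C1 by (intro ennreal_mult) simp_all
        then show ?thesis by (simp only: mult.assoc)
      qed
      finally show ?thesis .
    qed
    let ?Q = "\<lambda>w. \<Sum>g\<in>near 5 \<delta> w. indicator (cube \<delta> g) w * cmod (f w - h g w)"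
    have Q: "0 \<le> ?Q w" for w by (intro sum_nonneg) simp
    have "Ls_norm s (M_form q r (dbar f1)) \<le> ennreal C2 * (Ls_norm s (G_dist q \<tau> f) + ennreal \<epsilon>)"
      unfolding M_form_def
    proof (rule bound)
      fix w
      have "form_abs (dbar f1 w) \<le> B0 * ?Q w" by (rule glue(2))
      also have "\<dots> \<le> B * ?Q w" by (rule mult_right_mono[OF B(3) Q])
      finally show "norm (form_abs (dbar f1 w)) \<le> B * ?Q w" by (simp add: form_abs_nonneg)
    qed
    moreover have "Ls_norm s (M_avg q r (\<lambda>w. f w - f1 w)) \<le> ennreal C2 * (Ls_norm s (G_dist q \<tau> f) + ennreal \<epsilon>)"
    proof (rule bound)
      fix w
      have "cmod (f w - f1 w) \<le> ?Q w" by (rule glue(3))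
      also have "\<dots> = 1 * ?Q w" by simp
      also have "\<dots> \<le> B * ?Q w" by (rule mult_right_mono[OF B(2) Q])
      finally show "cmod (f w - f1 w) \<le> B * ?Q w" .
    qed
    ultimately have "Ls_norm s (M_form q r (dbar f1)) + Ls_norm s (M_avg q r (\<lambda>w. f w - f1 w))
      \<le> ennreal C2 * (Ls_norm s (G_dist q \<tau> f) + ennreal \<epsilon>) + ennreal C2 * (Ls_norm s (G_dist q \<tau> f) + ennreal \<epsilon>)"
      by (rule add_mono)
    also have "\<dots> = ennreal (C2 + C2) * (Ls_norm s (G_dist q \<tau> f) + ennreal \<epsilon>)"
      by (simp only: ennreal_plus[OF C2 C2] distrib_right)
    also have "\<dots> \<le> ennreal (2 * C2 + 1) * (Ls_norm s (G_dist q \<tau> f) + ennreal \<epsilon>)"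
      by (intro mult_right_mono ennreal_leI) simp_all
    finally show ?thesis using glue(1) by blast
  qed
  moreover have "0 < 2 * C2 + 1" using C2 by simp
  ultimately show ?thesis by blast
qed

text \<open>
  The decompositions depend on \<open>\<epsilon>\<close>, but the infimum over all of them does not; \<open>\<epsilon>\<close> tends to \<open>0\<close>.
\<close>

lemma decomp_inf_le_Ls_norm_G_dist:
  assumes q: "1 \<le> q" and s: "0 < s" and t: "0 < \<tau>" and r: "0 < r"
  shows "\<exists>C>0. \<forall>f \<in> (L_loc q :: (complex ^ 'n \<Rightarrow> complex) set).
    decomp_inf s q r f \<le> ennreal C * Ls_norm s (G_dist q \<tau> f)"
proof -
  from decomposition_from_oscillation[OF q s t r, where 'n='n] obtain C where C: "0 < C"
    and dec: "\<forall>f \<in> (L_loc q :: (complex ^ 'n \<Rightarrow> complex) set). \<forall>\<epsilon>>0.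
    \<exists>f1. Ck 2 f1 \<and> Ls_norm s (M_form q r (dbar f1)) + Ls_norm s (M_avg q r (\<lambda>w. f w - f1 w))
      \<le> ennreal C * (Ls_norm s (G_dist q \<tau> f) + ennreal \<epsilon>)" by (elim exE conjE)
  have "decomp_inf s q r f \<le> ennreal C * Ls_norm s (G_dist q \<tau> f)" if f: "f \<in> L_loc q" for f :: "complex ^ 'n \<Rightarrow> complex"
  proof (cases "Ls_norm s (G_dist q \<tau> f) < \<infinity>")
    case True
    show ?thesis
    proof (rule ennreal_le_epsilon)
      fix x :: real assume x: "0 < x"
      then have "0 < x / C" using C by simp
      with dec f obtain f1 where c2: "Ck 2 f1" and
        le: "Ls_norm s (M_form q r (dbar f1)) + Ls_norm s (M_avg q r (\<lambda>w. f w - f1 w))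
          \<le> ennreal C * (Ls_norm s (G_dist q \<tau> f) + ennreal (x / C))" by blast
      have d: "decomposes f f1 (\<lambda>w. f w - f1 w)" by (simp add: decomposes_def)
      have f2: "(\<lambda>w. f w - f1 w) \<in> borel_measurable lebesgue"
        by (rule decomposes_measurable[OF f Ck_2_imp_Ck_on_1[OF c2] d])
      have "ennreal C * (Ls_norm s (G_dist q \<tau> f) + ennreal (x / C)) < \<infinity>"
        using True by (simp add: ennreal_mult_less_top)
      with le have fin: "Ls_norm s (M_form q r (dbar f1)) + Ls_norm s (M_avg q r (\<lambda>w. f w - f1 w)) < \<infinity>"
        by (rule le_less_trans)
      have "star_cond s q r f1 (\<lambda>w. f w - f1 w)"
        unfolding star_cond_iff[OF q s r f2] using c2 fin by simp
      with d have "decomp_inf s q r f \<le> Ls_norm s (M_form q r (dbar f1)) + Ls_norm s (M_avg q r (\<lambda>w. f w - f1 w))"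
        unfolding decomp_inf_def by (intro INF_lower2[of "(f1, \<lambda>w. f w - f1 w)"]) simp_all
      also note le
      also have "ennreal C * (Ls_norm s (G_dist q \<tau> f) + ennreal (x / C)) = ennreal C * Ls_norm s (G_dist q \<tau> f) + ennreal x"
        using C x by (simp add: distrib_left ennreal_mult'[symmetric])
      finally show "decomp_inf s q r f \<le> ennreal C * Ls_norm s (G_dist q \<tau> f) + ennreal x" .
    qed
  next
    case False
    then have "Ls_norm s (G_dist q \<tau> f) = \<infinity>" by (simp add: less_top[symmetric])
    then show ?thesis using C by (simp add: ennreal_mult_top)
  qed
  then show ?thesis using C by blast
qed

section \<open>Characterisation of \<open>IDA\<close>\<close>

lemma comparable_onI:
  assumes "0 < C" "0 < D" "\<And>f. f \<in> X \<Longrightarrow> A f \<le> ennreal C * B f" "\<And>f. f \<in> X \<Longrightarrow> B f \<le> ennreal D * A f"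
  shows "comparable_on X A B"
proof -
  define E where "E = max C D"
  have E: "0 < E" "C \<le> E" "D \<le> E" using assms(1,2) by (simp_all add: E_def)
  have "ennreal (inverse E) * A f \<le> B f \<and> B f \<le> ennreal E * A f" if f: "f \<in> X" for f
  proof
    have "A f \<le> ennreal E * B f"
      by (rule order_trans[OF assms(3)[OF f] mult_right_mono[OF ennreal_leI[OF E(2)]]]) simp
    then have "ennreal (inverse E) * A f \<le> ennreal (inverse E) * (ennreal E * B f)" by (rule mult_left_mono) simp
    also have "\<dots> = B f" using E(1) by (simp add: mult.assoc[symmetric] ennreal_mult[symmetric])
    finally show "ennreal (inverse E) * A f \<le> B f" .
    show "B f \<le> ennreal E * A f"
      by (rule order_trans[OF assms(4)[OF f] mult_right_mono[OF ennreal_leI[OF E(3)]]]) simp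
  qed
  then show ?thesis unfolding comparable_on_def using E(1) by blast
qed

lemma comparable_on_G_decomp:
  assumes "1 \<le> q" "0 < s" "0 < \<tau>" "0 < r"
  shows "comparable_on (L_loc q :: (complex ^ 'n \<Rightarrow> complex) set) (\<lambda>f. Ls_norm s (G_dist q \<tau> f)) (decomp_inf s q r)"
proof -
  from Ls_norm_G_dist_le_decomp_inf[OF assms, where 'n='n] obtain C where
    C: "0 < C" "\<forall>f \<in> (L_loc q :: (complex ^ 'n \<Rightarrow> complex) set). Ls_norm s (G_dist q \<tau> f) \<le> ennreal C * decomp_inf s q r f"
    by (elim exE conjE)
  from decomp_inf_le_Ls_norm_G_dist[OF assms, where 'n='n] obtain D where
    D: "0 < D" "\<forall>f \<in> (L_loc q :: (complex ^ 'n \<Rightarrow> complex) set). decomp_inf s q r f \<le> ennreal D * Ls_norm s (G_dist q \<tau> f)"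
    by (elim exE conjE)
  show ?thesis by (rule comparable_onI[OF C(1) D(1) C(2)[rule_format] D(2)[rule_format]])
qed

text \<open>
  Both sides are compared with the decompositions for the radius \<open>1\<close>.
\<close>

lemma comparable_on_G_radii:
  assumes "1 \<le> q" "0 < s" "0 < \<tau>" "0 < \<rho>"
  shows "comparable_on (L_loc q :: (complex ^ 'n \<Rightarrow> complex) set)
    (\<lambda>f. Ls_norm s (G_dist q \<rho> f)) (\<lambda>f. Ls_norm s (G_dist q \<tau> f))"
proof -
  have one_sided: "\<exists>C>0. \<forall>f \<in> (L_loc q :: (complex ^ 'n \<Rightarrow> complex) set). Ls_norm s (G_dist q a f) \<le> ennreal C * Ls_norm s (G_dist q b f)"
    if a: "0 < a" and b: "0 < b" for a b
  proof -
    from Ls_norm_G_dist_le_decomp_inf[OF assms(1,2) a zero_less_one, where 'n='n] obtain C where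
      C: "0 < C" "\<forall>f \<in> (L_loc q :: (complex ^ 'n \<Rightarrow> complex) set). Ls_norm s (G_dist q a f) \<le> ennreal C * decomp_inf s q 1 f"
      by (elim exE conjE)
    from decomp_inf_le_Ls_norm_G_dist[OF assms(1,2) b zero_less_one, where 'n='n] obtain D where
      D: "0 < D" "\<forall>f \<in> (L_loc q :: (complex ^ 'n \<Rightarrow> complex) set). decomp_inf s q 1 f \<le> ennreal D * Ls_norm s (G_dist q b f)"
      by (elim exE conjE)
    have "Ls_norm s (G_dist q a f) \<le> ennreal (C * D) * Ls_norm s (G_dist q b f)" if f: "f \<in> L_loc q" for f :: "complex ^ 'n \<Rightarrow> complex"
    proof -
      have "Ls_norm s (G_dist q a f) \<le> ennreal C * (ennreal D * Ls_norm s (G_dist q b f))"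
        by (rule order_trans[OF C(2)[rule_format, OF f] mult_left_mono[OF D(2)[rule_format, OF f]]]) simp
      also have "\<dots> = ennreal (C * D) * Ls_norm s (G_dist q b f)"
        using C(1) D(1) by (simp add: ennreal_mult mult.assoc)
      finally show ?thesis .
    qed
    then show ?thesis using C(1) D(1) by (intro exI[of _ "C * D"]) simp
  qed
  from one_sided[OF assms(4,3)] obtain C where
    C: "0 < C" "\<forall>f \<in> (L_loc q :: (complex ^ 'n \<Rightarrow> complex) set). Ls_norm s (G_dist q \<rho> f) \<le> ennreal C * Ls_norm s (G_dist q \<tau> f)"
    by (elim exE conjE)
  from one_sided[OF assms(3,4)] obtain D where
    D: "0 < D" "\<forall>f \<in> (L_loc q :: (complex ^ 'n \<Rightarrow> complex) set). Ls_norm s (G_dist q \<tau> f) \<le> ennreal D * Ls_norm s (G_dist q \<rho> f)"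
    by (elim exE conjE)
  show ?thesis by (rule comparable_onI[OF C(1) D(1) C(2)[rule_format] D(2)[rule_format]])
qed

lemma IDA_iff_decomposition:
  fixes f :: "complex ^ 'n \<Rightarrow> complex"
  assumes q: "1 \<le> q" and s: "0 < s" and f: "f \<in> L_loc q"
  shows "f \<in> IDA s q \<longleftrightarrow> (\<exists>f1 f2. decomposes f f1 f2 \<and> (\<exists>r>0. star_cond s q r f1 f2))"
proof
  assume "f \<in> IDA s q"
  then have fin: "Ls_norm s (G_dist q 1 f) < \<infinity>" by (simp add: IDA_def IDA_norm_def)
  from decomp_inf_le_Ls_norm_G_dist[OF q s zero_less_one zero_less_one, where 'n='n] obtain C where
    C: "0 < C" "\<forall>f \<in> (L_loc q :: (complex ^ 'n \<Rightarrow> complex) set). decomp_inf s q 1 f \<le> ennreal C * Ls_norm s (G_dist q 1 f)"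
    by (elim exE conjE)
  have "decomp_inf s q 1 f \<le> ennreal C * Ls_norm s (G_dist q 1 f)" using C(2) f by blast
  also have "\<dots> < \<infinity>" using fin by (simp add: ennreal_mult_less_top)
  finally obtain f1 f2 where "decomposes f f1 f2" "star_cond s q 1 f1 f2"
    unfolding decomp_inf_def INF_less_iff by blast
  then show "\<exists>f1 f2. decomposes f f1 f2 \<and> (\<exists>r>0. star_cond s q r f1 f2)"
    using zero_less_one by blast
next
  assume "\<exists>f1 f2. decomposes f f1 f2 \<and> (\<exists>r>0. star_cond s q r f1 f2)"
  then obtain f1 f2 r where dec: "decomposes f f1 f2" and r: "0 < r" and star: "star_cond s q r f1 f2" by blast
  have f2: "f2 \<in> borel_measurable lebesgue"
    using star by (intro decomposes_measurable[OF f Ck_2_imp_Ck_on_1 dec]) (simp add: star_cond_def)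
  from Ls_norm_G_dist_le_decomp_inf[OF q s zero_less_one r, where 'n='n] obtain C where
    C: "0 < C" "\<forall>f \<in> (L_loc q :: (complex ^ 'n \<Rightarrow> complex) set). Ls_norm s (G_dist q 1 f) \<le> ennreal C * decomp_inf s q r f"
    by (elim exE conjE)
  have "decomp_inf s q r f \<le> Ls_norm s (M_form q r (dbar f1)) + Ls_norm s (M_avg q r f2)"
    unfolding decomp_inf_def using dec star by (intro INF_lower2[of "(f1, f2)"]) simp_all
  also have "\<dots> < \<infinity>" using star star_cond_iff[OF q s r f2, of f1] by simp
  finally have "ennreal C * decomp_inf s q r f < \<infinity>" by (simp add: ennreal_mult_less_top)
  moreover have "Ls_norm s (G_dist q 1 f) \<le> ennreal C * decomp_inf s q r f" using C(2) f by blast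
  ultimately have "Ls_norm s (G_dist q 1 f) < \<infinity>" by (rule le_less_trans[rotated])
  then show "f \<in> IDA s q" using f by (simp add: IDA_def IDA_norm_def)
qed

theorem theorem3p8:
  fixes q s :: real
  assumes "1 \<le> q" and "0 < s"
  shows "(\<forall>f \<in> (L_loc q :: (complex ^ 'n \<Rightarrow> complex) set).
            (f \<in> IDA s q \<longleftrightarrow>
               (\<exists>f1 f2. decomposes f f1 f2 \<and> (\<exists>r>0. star_cond s q r f1 f2))) \<and>
            (\<forall>f1 f2. decomposes f f1 f2 \<longrightarrow>
               ((\<exists>r>0. star_cond s q r f1 f2) \<longleftrightarrow> (\<forall>r>0. star_cond s q r f1 f2)))) \<and>
         (\<forall>\<tau>>0. \<forall>r>0.
            comparable_on (L_loc q :: (complex ^ 'n \<Rightarrow> complex) set)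
              (IDA_norm s q) (\<lambda>f. Ls_norm s (G_dist q \<tau> f)) \<and>
            comparable_on (L_loc q :: (complex ^ 'n \<Rightarrow> complex) set)
              (\<lambda>f. Ls_norm s (G_dist q \<tau> f)) (decomp_inf s q r))"
proof (intro conjI ballI allI impI)
  fix f :: "complex ^ 'n \<Rightarrow> complex" assume f: "f \<in> L_loc q"
  show "f \<in> IDA s q \<longleftrightarrow> (\<exists>f1 f2. decomposes f f1 f2 \<and> (\<exists>r>0. star_cond s q r f1 f2))"
    by (rule IDA_iff_decomposition[OF assms f])
  fix f1 f2 assume dec: "decomposes f f1 f2"
  show "(\<exists>r>0. star_cond s q r f1 f2) \<longleftrightarrow> (\<forall>r>0. star_cond s q r f1 f2)"
  proof
    assume "\<exists>r>0. star_cond s q r f1 f2"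
    then obtain r where r: "0 < r" and star: "star_cond s q r f1 f2" by blast
    have f2: "f2 \<in> borel_measurable lebesgue"
      using star by (intro decomposes_measurable[OF f Ck_2_imp_Ck_on_1 dec]) (simp add: star_cond_def)
    show "\<forall>r>0. star_cond s q r f1 f2"
      using star_cond_radius[OF assms r _ f2 star] by blast
  next
    assume "\<forall>r>0. star_cond s q r f1 f2"
    then show "\<exists>r>0. star_cond s q r f1 f2" using zero_less_one by blast
  qed
next
  fix \<tau> r :: real assume pos: "0 < \<tau>" "0 < r"
  show "comparable_on (L_loc q :: (complex ^ 'n \<Rightarrow> complex) set) (IDA_norm s q) (\<lambda>f. Ls_norm s (G_dist q \<tau> f))"
    unfolding IDA_norm_def[abs_def] by (rule comparable_on_G_radii[OF assms pos(1) zero_less_one])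
  show "comparable_on (L_loc q :: (complex ^ 'n \<Rightarrow> complex) set) (\<lambda>f. Ls_norm s (G_dist q \<tau> f)) (decomp_inf s q r)"
    by (rule comparable_on_G_decomp[OF assms pos])
qed

end
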